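(* Let $d\ge1$ and let $\Omega\subset\mathbb{R}^{d+1}$ be a bounded domain satisfying the corkscrew condition and the capacity density condition. Assume that $\Omega$ has the following packing property: there is $\varepsilon_0>0$ such that for every $0<\varepsilon<\varepsilon_0$ there is $C(\varepsilon)$ such that whenever $x\in\partial\Omega$, $R>0$, $p_j\in\Omega\cap B(x,R)$ and Borel sets $E_j\subset\partial\Omega$ satisfy $\omega(p_j,E_j,\Omega)\ge1-\varepsilon$ for all $j$ and $E_j\cap E_k=\emptyset$ for $k\ne j$, one has $\sum_j\mathrm{dist}(p_j,\partial\Omega)^d\le C(\varepsilon)R^d$. Then there exist a positive integer $N$ and a family $\mathcal{S}=\bigcup_{j\ge0}\mathcal{S}_j$ of Borel subsets of $\partial\Omega$ with the following properties, where $\ell(S)=2^{-Nj}$ for $S\in\mathcal{S}_j$: 1. $\mathrm{diam}(S)\sim2^{-Nj}$ if $S\in\mathcal{S}_j$ (with comparability constants independent of $j$ and $S$); 2. $\partial\Omega=\bigcup_{S\in\mathcal{S}_j}S$ for all $j$; 3. $S\cap S'=\emptyset$ if $S,S'\in\mathcal{S}_j$ and $S'\ne S$; 4. if $j<k$, $S_j\in\mathcal{S}_j$ and $S_k\in\mathcal{S}_k$, then $S_k\subset S_j$ or $S_k\cap S_j=\emptyset$; 5. there is a constant $c_0>0$ such that for all $S\in\mathcal{S}$ there exists $x_S\in S$ with $B(x_S,c_0\ell(S))\cap\partial\Omega\subset S$; 6. (small boundary property) there is a constant $C$ such that $N_\tau(S_j)\le C\,\tau^{(1/C)-d}$ for all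 $0<\tau<1$, all $j\ge 0$ and all $S_j\in\mathcal{S}_j$. Here, for $0<\tau<1$ and $S_j\in\mathcal{S}_j$, $$\Delta_\tau(S_j)=\{y\in S_j:\mathrm{dist}(y,\partial\Omega\setminus S_j)<\tau2^{-Nj}\}\cup\{y\in\partial\Omega\setminus S_j:\mathrm{dist}(y,S_j)<\tau2^{-Nj}\},$$ $$\mathcal{G}(\tau2^{-Nj})=\Bigl\{K=\bigcap_{1\le i\le d+1}\{x\in\mathbb{R}^{d+1}:k_i\tau2^{-Nj}\le x_i\le(k_i+1)\tau2^{-Nj}\}:\ k_i\in\mathbb{Z}\Bigr\},$$ $$N_\tau(S_j)=\#\{K\in\mathcal{G}(\tau2^{-Nj}):K\cap\Delta_\tau(S_j)\ne\emptyset\}.$$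
   Context: A domain is a connected open set; $B(x,r)$ is the ball with center $x$ and radius $r$. Corkscrew condition: there is a constant $\alpha>0$ such that whenever $x\in\partial\Omega$ and $0<r<\mathrm{diam}(\Omega)$ there is a ball $B(p,\alpha r)\subset\Omega\cap B(x,r)$. Capacity density condition: there is $\beta>0$ such that for all $x\in\partial\Omega$ and $0<r\le\mathrm{diam}(\Omega)$, $\mathrm{Cap}(B(x,r)\setminus\Omega)\ge\beta r$ if $d+1=2$ and $\mathrm{Cap}(B(x,r)\setminus\Omega)\ge\beta r^{d-1}$ if $d+1\ge3$, where $\mathrm{Cap}$ is logarithmic capacity when $d+1=2$ and Newtonian capacity when $d+1\ge3$. Harmonic measure: under the capacity density condition every point of $\partial\Omega$ is regular for the Dirichlet problem, and for $p\in\Omega$, $\omega(p,\cdot,\Omega)$ is the unique Borel probability measure on $\partial\Omega$ with $u(p)=\int_{\partial\Omega}u(x)\,d\omega(p,x,\Omega)$ for $u$ continuous on $\overline\Omega$ and harmonic on $\Omega$. *)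

theory Defs
  imports "HOL-Probability.Probability"
begin

text \<open>The ambient space $\mathbb{R}^{d+1}$ is \<open>real ^ 'n\<close> with \<open>CARD('n) = d + 1\<close>, and balls are open.\<close>

definition corkscrew_condition :: "(real ^ 'n) set \<Rightarrow> bool" where
  "corkscrew_condition \<Omega> \<longleftrightarrow>
     (\<exists>\<alpha>>0. \<forall>x\<in>frontier \<Omega>. \<forall>r. 0 < r \<and> r < diameter \<Omega> \<longrightarrow>
        (\<exists>p. ball p (\<alpha> * r) \<subseteq> \<Omega> \<inter> ball x r))"

text \<open>Capacities are defined through energies of Borel probability measures supported in a compact
  subset of the given set; for Borel sets this is the usual (inner) capacity.\<close>

definition compact_prob_measures :: "(real ^ 'n) set \<Rightarrow> (real ^ 'n) measure set" where
  "compact_prob_measures E =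
     {\<mu>. prob_space \<mu> \<and> sets \<mu> = sets borel \<and> (\<exists>K. compact K \<and> K \<subseteq> E \<and> emeasure \<mu> K = 1)}"

definition log_kernel :: "real ^ 'n \<Rightarrow> real ^ 'n \<Rightarrow> ereal" where
  "log_kernel x y = (if x = y then \<infinity> else ereal (ln (1 / dist x y)))"

text \<open>The positive minus the negative part; the latter is finite when \<open>\<mu>\<close> has compact support,
  so the difference is never \<open>\<infinity> - \<infinity>\<close>.\<close>

definition log_energy :: "(real ^ 'n) measure \<Rightarrow> ereal" where
  "log_energy \<mu> =
     enn2ereal (\<integral>\<^sup>+ x. (\<integral>\<^sup>+ y. e2ennreal (log_kernel x y) \<partial>\<mu>) \<partial>\<mu>) -
     enn2ereal (\<integral>\<^sup>+ x. (\<integral>\<^sup>+ y. e2ennreal (- log_kernel x y) \<partial>\<mu>) \<partial>\<mu>)"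

text \<open>$\exp(-V)$, where $V$ is the infimum of the energies (\<open>\<infinity>\<close> if the set is polar).\<close>

definition logarithmic_capacity :: "(real ^ 'n) set \<Rightarrow> ennreal" where
  "logarithmic_capacity E =
     (case (INF \<mu>\<in>compact_prob_measures E. log_energy \<mu>) of
        ereal v \<Rightarrow> ennreal (exp (- v))
      | PInfty \<Rightarrow> 0
      | MInfty \<Rightarrow> \<infinity>)"

text \<open>The kernel is $|x-y|^{2-n}$ with $n$ the dimension, equal to \<open>\<infinity>\<close> on the diagonal
  (in \<^typ>\<open>ennreal\<close>, \<open>inverse 0 = \<infinity>\<close> and \<open>inverse \<infinity> = 0\<close>); meaningful for $n \ge 3$.\<close>

definition newtonian_energy :: "(real ^ 'n) measure \<Rightarrow> ennreal" where
  "newtonian_energy \<mu> =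
     (\<integral>\<^sup>+ x. (\<integral>\<^sup>+ y. inverse (ennreal (dist x y ^ (CARD('n) - 2))) \<partial>\<mu>) \<partial>\<mu>)"

definition newtonian_capacity :: "(real ^ 'n) set \<Rightarrow> ennreal" where
  "newtonian_capacity E = inverse (INF \<mu>\<in>compact_prob_measures E. newtonian_energy \<mu>)"

definition capacity_density_condition :: "(real ^ 'n) set \<Rightarrow> bool" where
  "capacity_density_condition \<Omega> \<longleftrightarrow>
     (\<exists>\<beta>>0. \<forall>x\<in>frontier \<Omega>. \<forall>r. 0 < r \<and> r \<le> diameter \<Omega> \<longrightarrow>
        (if CARD('n) = 2
         then logarithmic_capacity (ball x r - \<Omega>) \<ge> ennreal (\<beta> * r)
         else newtonian_capacity (ball x r - \<Omega>) \<ge> ennreal (\<beta> * r ^ (CARD('n) - 2))))"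

text \<open>$C^2$ functions with vanishing Laplacian; \<open>g\<close> is the gradient and \<open>H\<close> the Hessian.\<close>

definition harmonic_on :: "(real ^ 'n) set \<Rightarrow> (real ^ 'n \<Rightarrow> real) \<Rightarrow> bool" where
  "harmonic_on \<Omega> u \<longleftrightarrow>
     (\<exists>(g :: real ^ 'n \<Rightarrow> real ^ 'n) (H :: real ^ 'n \<Rightarrow> real ^ 'n ^ 'n).
        (\<forall>x\<in>\<Omega>. (u has_derivative (\<lambda>h. g x \<bullet> h)) (at x)) \<and>
        (\<forall>x\<in>\<Omega>. (g has_derivative (\<lambda>h. H x *v h)) (at x)) \<and>
        continuous_on \<Omega> H \<and>
        (\<forall>x\<in>\<Omega>. trace (H x) = 0))"

definition is_harmonic_measure :: "(real ^ 'n) set \<Rightarrow> real ^ 'n \<Rightarrow> (real ^ 'n) measure \<Rightarrow> bool" where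
  "is_harmonic_measure \<Omega> p \<mu> \<longleftrightarrow>
     prob_space \<mu> \<and> sets \<mu> = sets (restrict_space borel (frontier \<Omega>)) \<and>
     (\<forall>u. continuous_on (closure \<Omega>) u \<and> harmonic_on \<Omega> u \<longrightarrow> u p = (\<integral>x. u x \<partial>\<mu>))"

text \<open>Under the capacity density condition all boundary points are regular, so for \<open>p \<in> \<Omega>\<close> there is
  exactly one such measure and the choice operator selects it.\<close>

definition harmonic_measure :: "(real ^ 'n) set \<Rightarrow> real ^ 'n \<Rightarrow> (real ^ 'n) measure" where
  "harmonic_measure \<Omega> p = (SOME \<mu>. is_harmonic_measure \<Omega> p \<mu>)"

text \<open>The families $(p_j)$, $(E_j)$ may be finite or countably infinite, whence the index set \<open>J\<close>.\<close>

definition packing_property :: "(real ^ 'n) set \<Rightarrow> bool" where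
  "packing_property \<Omega> \<longleftrightarrow>
     (\<exists>\<epsilon>\<^sub>0>0. \<forall>\<epsilon>. 0 < \<epsilon> \<and> \<epsilon> < \<epsilon>\<^sub>0 \<longrightarrow>
        (\<exists>C. \<forall>x\<in>frontier \<Omega>. \<forall>R>0. \<forall>(J :: nat set) (p :: nat \<Rightarrow> real ^ 'n) E.
           (\<forall>j\<in>J. p j \<in> \<Omega> \<inter> ball x R) \<and>
           (\<forall>j\<in>J. E j \<in> sets borel \<and> E j \<subseteq> frontier \<Omega>) \<and>
           (\<forall>j\<in>J. measure (harmonic_measure \<Omega> (p j)) (E j) \<ge> 1 - \<epsilon>) \<and>
           (\<forall>j\<in>J. \<forall>k\<in>J. k \<noteq> j \<longrightarrow> E j \<inter> E k = {}) \<longrightarrow>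
           (\<lambda>j. infdist (p j) (frontier \<Omega>) ^ (CARD('n) - 1)) summable_on J \<and>
           (\<Sum>\<^sub>\<infinity>j\<in>J. infdist (p j) (frontier \<Omega>) ^ (CARD('n) - 1)) \<le> C * R ^ (CARD('n) - 1)))"

text \<open>In the next definitions \<open>F\<close> is $\partial\Omega$ and \<open>t\<close> is $\tau 2^{-Nj}$. The distance to the empty
  set is infinite by convention, whereas \<open>infdist y {} = 0\<close>; hence the nonemptiness conditions, which
  matter when \<open>S = F\<close>.\<close>

definition boundary_layer :: "(real ^ 'n) set \<Rightarrow> (real ^ 'n) set \<Rightarrow> real \<Rightarrow> (real ^ 'n) set" where
  "boundary_layer F S t =
     {y \<in> S. F - S \<noteq> {} \<and> infdist y (F - S) < t} \<union>
     {y \<in> F - S. S \<noteq> {} \<and> infdist y S < t}"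

definition grid_cubes :: "real \<Rightarrow> (real ^ 'n) set set" where
  "grid_cubes t =
     {K. \<exists>k :: 'n \<Rightarrow> int. K = {x. \<forall>i. of_int (k i) * t \<le> x $ i \<and> x $ i \<le> (of_int (k i) + 1) * t}}"

text \<open>The set counted is finite for bounded \<open>F\<close>, \<open>S \<subseteq> F\<close> and \<open>t > 0\<close>.\<close>

definition boundary_cube_count :: "(real ^ 'n) set \<Rightarrow> (real ^ 'n) set \<Rightarrow> real \<Rightarrow> nat" where
  "boundary_cube_count F S t = card {K \<in> grid_cubes t. K \<inter> boundary_layer F S t \<noteq> {}}"

definition gen_length :: "nat \<Rightarrow> nat \<Rightarrow> real" where
  "gen_length N j = 2 powr (- (real N * real j))"

end

theory Submission
  imports Defs
begin

text \<open>
Write $F = \partial\Omega$. Two properties of $F$ carry the theorem.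

The first is a covering bound (\<open>frontier_covering_bound\<close>): an $r$-separated subset of $F$ that
lies in a ball of radius $R$ has at most $C (R/r)^d$ points. Next to each of these points the
corkscrew condition provides a point $p$ of $\Omega$ at depth comparable to $r$. By the capacity
density condition the harmonic measure at $p$ of the surrounding boundary ball of radius at most
$r/2$ is almost $1$ (\<open>harmonic_measure_ball_lower\<close>). These boundary balls are disjoint, so the
packing property bounds their number. The second property is that $F$ is uniformly perfect
(\<open>frontier_uniformly_perfect\<close>): an annulus about a boundary point that misses $F$ would either
surround all of $\Omega$ or leave the complement of $\Omega$ near the point inside a ball of too
small a capacity. Uniform perfectness bounds the diameters of the cubes from below.

The cubes are built from nested nets in the manner of Christ (\<open>cubes_with_small_boundary\<close>). The
usual proof of the small boundary property compares measures, and there is no doubling measure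
at hand here; with a counting bound alone, porosity of the boundary layers gives nothing, since
a porous subset of $F$ can have covering numbers as large as those of $F$. Therefore smallness
is built into the construction. A point of a finer net is assigned to its parent by means of
balls whose radii are chosen by the pigeonhole principle so that, up to a constant factor, only
the fraction $2^{-N}$ of the finer net lies close to their spheres. If $N$ is large, each cube
has at most $2^{N(d-1/2)}$ children near its boundary. A point close to the boundary of a cube
is close to the boundary of all the smaller cubes that contain it, down to the scale of its
distance, so these bounds multiply along the generations and give
$N_\tau(S) \le C \tau^{1/2-d}$. Only one scale per generation has to be controlled.

The estimate of harmonic measure can use nothing but the defining identity
$u(p) = \int u\,d\omega$ for continuous $u$ that are harmonic in $\Omega$. The test functions
are potentials of measures that live outside $\Omega$. The capacity density condition supplies
measures of bounded energy, and each of them has a restriction of comparable mass whose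
potential is continuous everywhere (\<open>continuous_potential\<close>). In dimension at least $3$ the
barrier is a sum of normalized potentials at the scales $\lambda^k r$: near the boundary point
it grows in proportion to the number of scales, it exceeds its value at $p$ by at most a
constant, and outside the ball of radius $r$ it stays below a constant. In the plane the
logarithmic potential of a single measure does the same.

Since harmonic measure is defined by a choice, its existence has to be shown. It is the law of
the limit of a random walk that jumps from $x$ to a random point of the ball about $x$ of radius
half the distance to $F$ (\<open>harmonic_measure_exists\<close>). By the mean value property the expectation
of $u$ along the walk is constant. The walk is a bounded martingale, so it converges in $L^2$,
and the growth of its second moments forces the limit to lie on $F$.
\<close>

section \<open>Separated sets and thin shells\<close>

definition separated :: "real \<Rightarrow> 'a::metric_space set \<Rightarrow> bool" where
  "separated r A \<longleftrightarrow> (\<forall>a\<in>A. \<forall>b\<in>A. a \<noteq> b \<longrightarrow> r \<le> dist a b)"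

lemma separated_subset: "separated r A \<Longrightarrow> B \<subseteq> A \<Longrightarrow> separated r B"
  by (auto simp: separated_def)

lemma separated_mono: "separated r A \<Longrightarrow> s \<le> r \<Longrightarrow> separated s A"
  by (force simp: separated_def)

text \<open>Among the separated sets that contain \<open>Y\<close> there is one of largest cardinality, because of
  the bound \<open>b\<close>; a point at distance at least \<open>r\<close> from it could be added, against the choice.\<close>

lemma extend_to_maximal_separated:
  assumes bound: "\<And>A. finite A \<Longrightarrow> A \<subseteq> E \<Longrightarrow> separated r A \<Longrightarrow> card A \<le> b"
    and Y: "finite Y" "Y \<subseteq> E" "separated r Y" and r: "0 < r"
  obtains A where "finite A" "Y \<subseteq> A" "A \<subseteq> E" "separated r A" "\<And>z. z \<in> E \<Longrightarrow> \<exists>x\<in>A. dist z x < r"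
proof -
  let ?P = "\<lambda>A. finite A \<and> Y \<subseteq> A \<and> A \<subseteq> E \<and> separated r A"
  have "\<exists>A. ?P A \<and> (\<forall>B. ?P B \<longrightarrow> card B \<le> card A)"
    by (rule ex_has_greatest_nat[where b = "Suc b" and k = Y]) (use Y bound in \<open>auto simp: le_imp_less_Suc\<close>)
  then obtain A where A: "finite A" "Y \<subseteq> A" "A \<subseteq> E" "separated r A" and max: "\<And>B. ?P B \<Longrightarrow> card B \<le> card A"
    by blast
  have "\<exists>x\<in>A. dist z x < r" if z: "z \<in> E" for z
  proof (rule ccontr)
    assume no: "\<not> ?thesis"
    then have "z \<notin> A" using r by force
    moreover have "separated r (insert z A)"
      using A(4) no unfolding separated_def by (auto simp: not_less dist_commute)
    ultimately show False using max[of "insert z A"] A z by auto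
  qed
  then show thesis using that A by blast
qed

lemma sum_card_disjoint_shells_le:
  fixes f :: "'a \<Rightarrow> real"
  assumes "finite Y" "2 * h < \<delta>"
  shows "(\<Sum>i<m. card {y \<in> Y. \<bar>f y - (s + real i * \<delta>)\<bar> \<le> h}) \<le> card Y"
proof -
  have "(\<Sum>i<m. card {y \<in> Y. \<bar>f y - (s + real i * \<delta>)\<bar> \<le> h}) = card (\<Union>i<m. {y \<in> Y. \<bar>f y - (s + real i * \<delta>)\<bar> \<le> h})"
  proof (rule card_UN_disjoint[symmetric])
    show "\<forall>i\<in>{..<m}. \<forall>j\<in>{..<m}. i \<noteq> j \<longrightarrow>
      {y \<in> Y. \<bar>f y - (s + real i * \<delta>)\<bar> \<le> h} \<inter> {y \<in> Y. \<bar>f y - (s + real j * \<delta>)\<bar> \<le> h} = {}"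
    proof (intro ballI impI)
      fix i j :: nat assume ij: "i \<noteq> j"
      show "{y \<in> Y. \<bar>f y - (s + real i * \<delta>)\<bar> \<le> h} \<inter> {y \<in> Y. \<bar>f y - (s + real j * \<delta>)\<bar> \<le> h} = {}"
      proof (rule ccontr)
        assume "\<not> ?thesis"
        then obtain y where y: "\<bar>f y - (s + real i * \<delta>)\<bar> \<le> h" "\<bar>f y - (s + real j * \<delta>)\<bar> \<le> h" by auto
        then have "\<bar>(real i - real j) * \<delta>\<bar> \<le> 2 * h" by (auto simp: left_diff_distrib)
        moreover have "h \<ge> 0" using y by linarith
        then have "\<delta> > 0" using assms(2) by linarith
        moreover have "1 \<le> \<bar>real i - real j\<bar>" using ij by linarith
        then have "1 * \<delta> \<le> \<bar>real i - real j\<bar> * \<delta>" using \<open>\<delta> > 0\<close> by (intro mult_right_mono) auto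
        ultimately show False using assms(2) by (simp add: abs_mult)
      qed
    qed
  qed (use assms in auto)
  also have "\<dots> \<le> card Y" using assms by (intro card_mono) auto
  finally show ?thesis .
qed

text \<open>Shells that belong to different shifts are disjoint, so on average over the \<open>m\<close> shifts a
  pair of shells holds at most \<open>2 card Y / m\<close> points. Two families move by the same shift
  because each center below carries two concentric spheres.\<close>

lemma radius_with_thin_shells:
  fixes f :: "'a \<Rightarrow> real"
  assumes Y: "finite Y" and h: "2 * h < \<delta>" and m: "0 < m"
  obtains i where "i < m"
    "real (card {y \<in> Y. \<bar>f y - (s + real i * \<delta>)\<bar> \<le> h} + card {y \<in> Y. \<bar>f y - (s' + real i * \<delta>)\<bar> \<le> h}) \<le> 2 * real (card Y) / real m"
proof (rule ccontr)
  let ?c = "\<lambda>i. card {y \<in> Y. \<bar>f y - (s + real i * \<delta>)\<bar> \<le> h} + card {y \<in> Y. \<bar>f y - (s' + real i * \<delta>)\<bar> \<le> h}"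
  assume "\<not> thesis"
  then have "2 * real (card Y) / real m < real (?c i)" if "i < m" for i
    using that \<open>\<And>i. \<lbrakk>i < m; _\<rbrakk> \<Longrightarrow> thesis\<close> by force
  then have "(\<Sum>i<m. 2 * real (card Y) / real m) < (\<Sum>i<m. real (?c i))"
    using m by (intro sum_strict_mono) auto
  also have "\<dots> = real (\<Sum>i<m. ?c i)" by simp
  also have "(\<Sum>i<m. ?c i) \<le> 2 * card Y"
    using sum_card_disjoint_shells_le[OF Y h, where m = m and f = f and s = s]
      sum_card_disjoint_shells_le[OF Y h, where m = m and f = f and s = s']
    by (simp add: sum.distrib)
  finally show False using m by simp
qed

text \<open>Quantitatively, and at scales up to 1, the Assouad dimension of \<open>F\<close> is at most \<open>d\<close>.\<close>

locale covering_bound =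
  fixes F :: "(real ^ 'n) set" and d :: nat and C0 :: real
  assumes compact_F: "compact F" and d: "1 \<le> d" and C0: "0 \<le> C0"
    and card_separated: "\<And>x r R A. x \<in> F \<Longrightarrow> 0 < r \<Longrightarrow> r \<le> 1 \<Longrightarrow> r \<le> R \<Longrightarrow> finite A \<Longrightarrow> A \<subseteq> F \<inter> ball x R \<Longrightarrow>
      separated r A \<Longrightarrow> real (card A) \<le> C0 * (R / r) ^ d"
begin

lemma separated_card_bounded:
  assumes r: "0 < r" "r \<le> 1"
  obtains b where "\<And>A. finite A \<Longrightarrow> A \<subseteq> F \<Longrightarrow> separated r A \<Longrightarrow> card A \<le> b"
proof (cases "F = {}")
  case True then show ?thesis using that[of 0] by auto
next
  case False
  then obtain x where x: "x \<in> F" by blast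
  obtain R where R: "F \<subseteq> ball x R" "r \<le> R"
  proof -
    obtain e where "\<And>y. y \<in> F \<Longrightarrow> dist x y \<le> e" using compact_imp_bounded[OF compact_F] by (auto simp: bounded_any_center[where a = x])
    then have "F \<subseteq> ball x (max r (e + 1))" by force
    then show ?thesis using that by auto
  qed
  show ?thesis
  proof (rule that)
    fix A assume A: "finite A" "A \<subseteq> F" "separated r A"
    then have "real (card A) \<le> C0 * (R / r) ^ d" using R by (intro card_separated[OF x r R(2)]) auto
    then show "card A \<le> nat \<lceil>C0 * (R / r) ^ d\<rceil>" by linarith
  qed
qed

lemma finite_net_extension:
  assumes r: "0 < r" "r \<le> 1" and Y: "finite Y" "Y \<subseteq> E" "separated r Y" and E: "E \<subseteq> F"
  obtains A where "finite A" "Y \<subseteq> A" "A \<subseteq> E" "separated r A" "\<And>z. z \<in> E \<Longrightarrow> \<exists>x\<in>A. dist z x < r"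
proof -
  obtain b where b: "\<And>A. finite A \<Longrightarrow> A \<subseteq> F \<Longrightarrow> separated r A \<Longrightarrow> card A \<le> b" using separated_card_bounded[OF r] by blast
  show ?thesis by (rule extend_to_maximal_separated[OF _ Y r(1)]) (use b E in \<open>auto intro: that\<close>)
qed

text \<open>A grid cube that meets \<open>E\<close> has a point within \<open>t\<close> of some \<open>a\<close> in a maximal separated
  subset of \<open>E\<close>. Given \<open>a\<close>, this leaves four integers for each coordinate of the index of the
  cube.\<close>

lemma grid_cubes_count:
  assumes y: "y \<in> F" and t: "0 < t" "t \<le> 1" "t \<le> R" and E: "E \<subseteq> F \<inter> ball y R"
  shows "finite {K \<in> grid_cubes t. K \<inter> E \<noteq> {}}"
    and "real (card {K \<in> grid_cubes t. K \<inter> E \<noteq> {}}) \<le> 4 ^ CARD('n) * (C0 * (R / t) ^ d)"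
proof -
  obtain A where A: "finite A" "A \<subseteq> E" "separated t A" and cov: "\<And>z. z \<in> E \<Longrightarrow> \<exists>x\<in>A. dist z x < t"
    by (rule finite_net_extension[OF t(1,2), of "{}" E]) (use E in \<open>auto simp: separated_def\<close>)
  define cube where "cube = (\<lambda>k :: 'n \<Rightarrow> int. {x :: real ^ 'n. \<forall>i. of_int (k i) * t \<le> x $ i \<and> x $ i \<le> (of_int (k i) + 1) * t})"
  define B where "B = (\<lambda>a :: real ^ 'n. PiE UNIV (\<lambda>i. {\<lfloor>a $ i / t\<rfloor> - 2 .. \<lfloor>a $ i / t\<rfloor> + 1}))"
  have sub: "{K \<in> grid_cubes t. K \<inter> E \<noteq> {}} \<subseteq> (\<Union>a\<in>A. cube ` B a)"
  proof
    fix K assume "K \<in> {K \<in> grid_cubes t. K \<inter> E \<noteq> {}}"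
    then obtain k e where K: "K = cube k" and e: "e \<in> K" "e \<in> E" by (auto simp: grid_cubes_def cube_def)
    obtain a where a: "a \<in> A" "dist e a < t" using cov[OF e(2)] by blast
    have "k \<in> B a"
      unfolding B_def
    proof (rule PiE_I)
      fix i :: 'n
      have "\<bar>e $ i - a $ i\<bar> < t"
        using a(2) component_le_norm_cart[of "e - a" i] by (simp add: dist_norm)
      moreover have "of_int (k i) * t \<le> e $ i" "e $ i \<le> (of_int (k i) + 1) * t"
        using e(1) unfolding K cube_def by auto
      ultimately have "of_int (k i) * t < a $ i + t" "a $ i - t < (of_int (k i) + 1) * t" by linarith+
      then have "of_int (k i) < a $ i / t + 1" "a $ i / t - 2 < of_int (k i)"
        using t by (auto simp: field_simps)
      then show "k i \<in> {\<lfloor>a $ i / t\<rfloor> - 2 .. \<lfloor>a $ i / t\<rfloor> + 1}" by (simp, linarith)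
    qed simp
    then show "K \<in> (\<Union>a\<in>A. cube ` B a)" using a K by blast
  qed
  have finB: "finite (B a)" for a unfolding B_def by (intro finite_PiE) auto
  have cardB: "card (B a) = 4 ^ CARD('n)" for a unfolding B_def by (subst card_PiE) auto
  have fin: "finite (\<Union>a\<in>A. cube ` B a)" using A(1) finB by blast
  then show "finite {K \<in> grid_cubes t. K \<inter> E \<noteq> {}}" using sub by (rule rev_finite_subset)
  have "card {K \<in> grid_cubes t. K \<inter> E \<noteq> {}} \<le> card (\<Union>a\<in>A. cube ` B a)" by (rule card_mono[OF fin sub])
  also have "\<dots> \<le> (\<Sum>a\<in>A. card (cube ` B a))" by (rule card_UN_le[OF A(1)])
  also have "\<dots> \<le> (\<Sum>a\<in>A. 4 ^ CARD('n))"
    by (rule sum_mono) (rule order_trans[OF card_image_le[OF finB] eq_refl[OF cardB]])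
  also have "\<dots> = 4 ^ CARD('n) * card A" by simp
  finally have "real (card {K \<in> grid_cubes t. K \<inter> E \<noteq> {}}) \<le> real (4 ^ CARD('n) * card A)" by (rule of_nat_mono)
  also have "\<dots> = 4 ^ CARD('n) * real (card A)" by simp
  also have "\<dots> \<le> 4 ^ CARD('n) * (C0 * (R / t) ^ d)"
    using A E by (intro mult_left_mono card_separated[OF y t]) auto
  finally show "real (card {K \<in> grid_cubes t. K \<inter> E \<noteq> {}}) \<le> 4 ^ CARD('n) * (C0 * (R / t) ^ d)" .
qed

end

section \<open>Cubes with small boundary\<close>

lemma gen_length_eq: "gen_length N k = (1 / 2 ^ N) ^ k"
  unfolding gen_length_def
  by (simp add: powr_minus powr_realpow[symmetric] powr_powr power_one_over inverse_eq_divide)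

lemma gen_length_0 [simp]: "gen_length N 0 = 1"
  and gen_length_Suc: "gen_length N (Suc k) = gen_length N k / 2 ^ N"
  and gen_length_add: "gen_length N (j + m) = gen_length N j / (2 ^ N) ^ m"
  and gen_length_pos: "0 < gen_length N k"
  and gen_length_le_1: "gen_length N k \<le> 1"
  by (simp_all add: gen_length_eq power_one_over power_add divide_simps one_le_power)

lemma closure_finite_UN: "finite I \<Longrightarrow> closure (\<Union>i\<in>I. A i) = (\<Union>i\<in>I. closure (A i))"
  by (induction I rule: finite_induct) auto

context covering_bound
begin

text \<open>Nestedness matters later: it makes every center its own child, so that the set of all
  descendants of a center is the union of those of its children, without an exceptional point.\<close>

lemma nested_nets_exist:
  "\<exists>X. \<forall>k. finite (X k) \<and> X k \<subseteq> F \<and> separated (gen_length N k) (X k) \<and>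
    (\<forall>z\<in>F. \<exists>x\<in>X k. dist z x < gen_length N k) \<and> X k \<subseteq> X (Suc k)"
proof -
  let ?P = "\<lambda>k A. finite A \<and> A \<subseteq> F \<and> separated (gen_length N k) A \<and> (\<forall>z\<in>F. \<exists>x\<in>A. dist z x < gen_length N k)"
  have "\<exists>X. \<forall>k. ?P k (X k) \<and> X k \<subseteq> X (Suc k)"
  proof (rule dependent_nat_choice)
    obtain A where A: "finite A" "A \<subseteq> F" "separated (gen_length N 0) A" "\<And>z. z \<in> F \<Longrightarrow> \<exists>x\<in>A. dist z x < gen_length N 0"
      by (rule finite_net_extension[OF gen_length_pos gen_length_le_1, of "{}" F N 0]) (auto simp: separated_def)
    then show "\<exists>A. ?P 0 A" by (intro exI[of _ A] conjI ballI)
  next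
    fix A k assume A: "?P k A"
    have "gen_length N (Suc k) \<le> gen_length N k"
      using gen_length_pos[of N k] by (simp add: gen_length_Suc divide_le_eq mult_le_cancel_left1)
    then have "separated (gen_length N (Suc k)) A" using A separated_mono by blast
    then obtain B where B: "finite B" "A \<subseteq> B" "B \<subseteq> F" "separated (gen_length N (Suc k)) B"
      "\<And>z. z \<in> F \<Longrightarrow> \<exists>x\<in>B. dist z x < gen_length N (Suc k)"
      using finite_net_extension[OF gen_length_pos gen_length_le_1, of A F N "Suc k"] A by blast
    then show "\<exists>B. ?P (Suc k) B \<and> A \<subseteq> B" by (intro exI[of _ B] conjI ballI)
  qed
  then show ?thesis by blast
qed

text \<open>Let \<open>l\<close> and \<open>l'\<close> be the lengths of generations \<open>k\<close> and \<open>k + 1\<close>. The shifts \<open>16 l' i\<close> with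
  \<open>i < 2 ^ (N - 7)\<close> fill the range up to \<open>l / 8\<close>, and consecutive ones differ by more than the
  width \<open>10 l'\<close> of a shell. There are about \<open>2 ^ N\<close> of them, which gains this factor over the
  number of all net points near \<open>x\<close>.\<close>

lemma thin_shell_shift_exists:
  assumes N: "7 \<le> N" and Y: "finite Y" "Y \<subseteq> F" "separated (gen_length N (Suc k)) Y" and x: "x \<in> F"
  shows "\<exists>t. 0 \<le> t \<and> t \<le> gen_length N k / 8 \<and>
    real (card {y \<in> Y \<inter> ball x (2 * gen_length N k). \<bar>dist y x - (gen_length N k / 8 + t)\<bar> \<le> 5 * gen_length N (Suc k)} +
      card {y \<in> Y \<inter> ball x (2 * gen_length N k). \<bar>dist y x - (gen_length N k + t)\<bar> \<le> 5 * gen_length N (Suc k)})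
    \<le> 256 * 2 ^ d * C0 * ((2 ^ N) ^ d / 2 ^ N)"
proof -
  let ?l = "gen_length N k" and ?l' = "gen_length N (Suc k)"
  let ?Y = "Y \<inter> ball x (2 * ?l)"
  define m :: nat where "m = 2 ^ (N - 7)"
  have q: "(2 :: real) ^ N = 128 * real m"
  proof -
    have "(2 :: real) ^ N = 2 ^ (7 + (N - 7))" using N by simp
    then show ?thesis unfolding power_add m_def by simp
  qed
  have m: "0 < m" by (simp add: m_def)
  have l': "0 < ?l'" "?l = 128 * real m * ?l'"
    using gen_length_pos[of N "Suc k"] m by (auto simp: gen_length_Suc q)
  have fin: "finite ?Y" using Y by blast
  obtain i where i: "i < m"
    "real (card {y \<in> ?Y. \<bar>dist y x - (?l / 8 + real i * (16 * ?l'))\<bar> \<le> 5 * ?l'} +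
      card {y \<in> ?Y. \<bar>dist y x - (?l + real i * (16 * ?l'))\<bar> \<le> 5 * ?l'}) \<le> 2 * real (card ?Y) / real m"
    by (rule radius_with_thin_shells[OF fin _ m, of "5 * ?l'" "16 * ?l'" "\<lambda>y. dist y x" "?l / 8" ?l]) (use l' in auto)
  have "real (card ?Y) \<le> C0 * (2 * ?l / ?l') ^ d"
  proof (rule card_separated[OF x l'(1) gen_length_le_1 _ fin])
    have "1 \<le> real m" using m by simp
    then have "?l' * 1 \<le> ?l' * (256 * real m)" using l'(1) by (intro mult_left_mono) auto
    then show "?l' \<le> 2 * ?l" unfolding l'(2) by (simp add: mult_ac)
    show "separated ?l' ?Y" using Y(3) by (rule separated_subset) auto
  qed (use Y in auto)
  also have "2 * ?l / ?l' = 2 * 2 ^ N" using gen_length_pos[of N k] by (simp add: gen_length_Suc)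
  finally have "2 * real (card ?Y) / real m \<le> 2 * (C0 * (2 * 2 ^ N) ^ d) / real m"
    using m by (intro divide_right_mono) auto
  also have "\<dots> = 256 * 2 ^ d * C0 * ((2 ^ N) ^ d / 2 ^ N)"
  proof -
    have "1 / real m = 128 / 2 ^ N" using m by (simp add: q)
    then have "2 * (C0 * (2 ^ d * (2 ^ N) ^ d)) * (1 / real m) = 2 * (C0 * (2 ^ d * (2 ^ N) ^ d)) * (128 / 2 ^ N)" by (rule arg_cong)
    then show ?thesis unfolding power_mult_distrib by simp
  qed
  finally have "2 * real (card ?Y) / real m \<le> 256 * 2 ^ d * C0 * ((2 ^ N) ^ d / 2 ^ N)" .
  moreover have "real i * (16 * ?l') \<le> ?l / 8"
  proof -
    have "real i * (16 * ?l') \<le> real m * (16 * ?l')" using i(1) l' by (intro mult_right_mono) auto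
    then show ?thesis using l'(2) by simp
  qed
  ultimately show ?thesis using i(2) l' by (intro exI[of _ "real i * (16 * ?l')"]) auto
qed

end

text \<open>A center \<open>x\<close> of generation \<open>k\<close> carries the spheres of radii \<open>l / 8 + shift k x\<close> and
  \<open>l + shift k x\<close> with \<open>l = gen_length N k\<close>. Few points of the next net are close to these
  spheres; the half-width \<open>5 gen_length N (Suc k)\<close> bounds the distance of the next net points
  that approximate two nearby points of \<open>F\<close>.\<close>

locale cube_tree = covering_bound F d C0 for F :: "(real ^ 'n) set" and d C0 +
  fixes N :: nat and X :: "nat \<Rightarrow> (real ^ 'n) set" and shift :: "nat \<Rightarrow> real ^ 'n \<Rightarrow> real"
  assumes N: "7 \<le> N"
    and finite_X: "finite (X k)" and X_sub: "X k \<subseteq> F" and X_sep: "separated (gen_length N k) (X k)"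
    and X_cov: "z \<in> F \<Longrightarrow> \<exists>x\<in>X k. dist z x < gen_length N k" and X_mono: "X k \<subseteq> X (Suc k)"
    and shift: "x \<in> X k \<Longrightarrow> 0 \<le> shift k x" "x \<in> X k \<Longrightarrow> shift k x \<le> gen_length N k / 8"
    and thin: "x \<in> X k \<Longrightarrow>
      real (card {y \<in> X (Suc k) \<inter> ball x (2 * gen_length N k). \<bar>dist y x - (gen_length N k / 8 + shift k x)\<bar> \<le> 5 * gen_length N (Suc k)} +
        card {y \<in> X (Suc k) \<inter> ball x (2 * gen_length N k). \<bar>dist y x - (gen_length N k + shift k x)\<bar> \<le> 5 * gen_length N (Suc k)})
      \<le> 256 * 2 ^ d * C0 * ((2 ^ N) ^ d / 2 ^ N)"

lemma (in covering_bound) cube_tree_exists: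
  assumes N: "7 \<le> N"
  shows "\<exists>X shift. cube_tree F d C0 N X shift"
proof -
  obtain X where *: "\<forall>k. finite (X k) \<and> X k \<subseteq> F \<and> separated (gen_length N k) (X k) \<and>
    (\<forall>z\<in>F. \<exists>x\<in>X k. dist z x < gen_length N k) \<and> X k \<subseteq> X (Suc k)"
    using nested_nets_exist[of N] by (rule exE)
  have X: "finite (X k)" "X k \<subseteq> F" "separated (gen_length N k) (X k)"
    "\<forall>z\<in>F. \<exists>x\<in>X k. dist z x < gen_length N k" "X k \<subseteq> X (Suc k)" for k
    using spec[OF *, of k] by - (elim conjE, assumption)+
  let ?thin = "\<lambda>k x t. 0 \<le> t \<and> t \<le> gen_length N k / 8 \<and>
    real (card {y \<in> X (Suc k) \<inter> ball x (2 * gen_length N k). \<bar>dist y x - (gen_length N k / 8 + t)\<bar> \<le> 5 * gen_length N (Suc k)} +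
      card {y \<in> X (Suc k) \<inter> ball x (2 * gen_length N k). \<bar>dist y x - (gen_length N k + t)\<bar> \<le> 5 * gen_length N (Suc k)})
    \<le> 256 * 2 ^ d * C0 * ((2 ^ N) ^ d / 2 ^ N)"
  define shift where "shift = (\<lambda>k x. SOME t. ?thin k x t)"
  have s: "?thin k x (shift k x)" if "x \<in> X k" for k x
  proof -
    have "x \<in> F" using X(2)[of k] that by blast
    from someI_ex[OF thin_shell_shift_exists[OF N X(1,2,3) this]]
    show ?thesis unfolding shift_def .
  qed
  have "cube_tree F d C0 N X shift"
  proof unfold_locales
    show "7 \<le> N" by fact
    show "finite (X k)" "X k \<subseteq> F" "separated (gen_length N k) (X k)" "X k \<subseteq> X (Suc k)" for k by (rule X)+
    show "\<exists>x\<in>X k. dist z x < gen_length N k" if "z \<in> F" for k z by (rule bspec[OF X(4) that])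
  qed (use s in blast)+
  then show ?thesis by blast
qed

context cube_tree
begin

abbreviation "l \<equiv> gen_length N"

lemma l_pos: "0 < l k" by (rule gen_length_pos)

lemma l_Suc: "128 * l (Suc k) \<le> l k"
proof -
  have "(2 :: real) ^ 7 \<le> 2 ^ N" using N by (intro power_increasing) auto
  then have "128 * l k \<le> 2 ^ N * l k" using l_pos[of k] by (intro mult_right_mono) auto
  then show ?thesis by (simp add: gen_length_Suc divide_le_eq mult_ac)
qed

definition core :: "nat \<Rightarrow> real ^ 'n \<Rightarrow> (real ^ 'n) set" where
  "core k y = {x \<in> X k. dist y x < l k / 8 + shift k x}"

definition reach :: "nat \<Rightarrow> real ^ 'n \<Rightarrow> (real ^ 'n) set" where
  "reach k y = {x \<in> X k. dist y x < l k + shift k x}"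

text \<open>A center whose core contains \<open>y\<close> has priority, which keeps a whole ball around each center
  in its cube. The choice is made from a set of centers and not from \<open>y\<close>, so two points with the
  same core and the same reach have the same parent.\<close>

definition parent :: "nat \<Rightarrow> real ^ 'n \<Rightarrow> real ^ 'n" where
  "parent k y = (SOME x. x \<in> (if core k y = {} then reach k y else core k y))"

lemma parent_in:
  assumes "y \<in> F"
  shows "parent k y \<in> reach k y"
proof -
  obtain x where "x \<in> X k" "dist y x < l k" using X_cov[OF assms] by blast
  then have "x \<in> reach k y" using shift(1)[of x k] by (simp add: reach_def)
  then have "(if core k y = {} then reach k y else core k y) \<noteq> {}" by auto
  then have "parent k y \<in> (if core k y = {} then reach k y else core k y)"
    unfolding parent_def some_in_eq .
  moreover have "core k y \<subseteq> reach k y" using l_pos[of k] by (auto simp: core_def reach_def)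
  ultimately show ?thesis by (auto split: if_splits)
qed

lemma parent_X: "y \<in> F \<Longrightarrow> parent k y \<in> X k"
  and dist_parent: "y \<in> F \<Longrightarrow> dist y (parent k y) < 9 / 8 * l k"
  using parent_in[of y k] shift(2)[of "parent k y" k] by (auto simp: reach_def)

text \<open>The cores are disjoint, as their radii are at most a quarter of the separation of the
  centers.\<close>

lemma parent_unique:
  assumes x: "x \<in> X k" and y: "dist y x < l k / 8"
  shows "parent k y = x"
proof -
  have xin: "x \<in> core k y" using assms shift(1)[OF x] by (simp add: core_def)
  have "x' = x" if "x' \<in> core k y" for x'
  proof (rule ccontr)
    assume "x' \<noteq> x"
    then have "l k \<le> dist x' x" using X_sep[of k] that x by (auto simp: separated_def core_def)
    moreover have "dist y x' < l k / 4" using that shift(2)[of x' k] by (auto simp: core_def)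
    ultimately show False using dist_triangle[of x' x y] y l_pos[of k] by (simp add: dist_commute)
  qed
  then have "core k y = {x}" using xin by blast
  then show ?thesis by (simp add: parent_def)
qed

lemma parent_self: "x \<in> X k \<Longrightarrow> parent k x = x"
  by (rule parent_unique) (use l_pos[of k] in auto)

definition near_boundary :: "nat \<Rightarrow> real ^ 'n \<Rightarrow> bool" where
  "near_boundary k y \<longleftrightarrow> (\<exists>x\<in>X k. \<bar>dist y x - (l k / 8 + shift k x)\<bar> \<le> 5 * l (Suc k) \<or> \<bar>dist y x - (l k + shift k x)\<bar> \<le> 5 * l (Suc k))"

text \<open>If no sphere passes near \<open>y\<close>, then \<open>y\<close> and \<open>y'\<close> are on the same side of every sphere.\<close>

lemma near_boundary_if_parents_differ:
  assumes "dist y y' \<le> 5 * l (Suc k)" "parent k y \<noteq> parent k y'"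
  shows "near_boundary k y"
proof (rule ccontr)
  assume no: "\<not> ?thesis"
  have d: "\<bar>dist y x - dist y' x\<bar> \<le> 5 * l (Suc k)" for x
    using assms(1) dist_triangle[of y x y'] dist_triangle[of y' x y] by (simp add: dist_commute abs_le_iff)
  have "dist y x < l k / 8 + shift k x \<longleftrightarrow> dist y' x < l k / 8 + shift k x"
    "dist y x < l k + shift k x \<longleftrightarrow> dist y' x < l k + shift k x" if "x \<in> X k" for x
    using no d[of x] that unfolding near_boundary_def by (smt (verit))+
  then have "core k y = core k y'" "reach k y = reach k y'" by (auto simp: core_def reach_def)
  then have "parent k y = parent k y'" unfolding parent_def by (simp only:)
  then show False using assms(2) by contradiction
qed

definition bad_children :: "nat \<Rightarrow> real ^ 'n \<Rightarrow> (real ^ 'n) set" where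
  "bad_children k x = {y \<in> X (Suc k). parent k y = x \<and> near_boundary k y}"

text \<open>A child of \<open>x0\<close> is within \<open>9/8 l k\<close> of \<open>x0\<close>, and a sphere near this child belongs to a
  center within \<open>4 l k\<close> of \<open>x0\<close>; there are at most \<open>C0 4 ^ d\<close> such centers.\<close>

lemma card_bad_children:
  assumes x0: "x0 \<in> X k"
  shows "real (card (bad_children k x0)) \<le> C0 * 4 ^ d * (256 * 2 ^ d * C0) * ((2 ^ N) ^ d / 2 ^ N)"
proof -
  define shell where "shell = (\<lambda>x s. {y \<in> X (Suc k) \<inter> ball x (2 * l k). \<bar>dist y x - (s + shift k x)\<bar> \<le> 5 * l (Suc k)})"
  define Z where "Z = X k \<inter> ball x0 (4 * l k)"
  have finZ: "finite Z" using finite_X by (simp add: Z_def)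
  have fins: "finite (shell x s)" for x s using finite_X by (simp add: shell_def)
  have sub: "bad_children k x0 \<subseteq> (\<Union>x\<in>Z. shell x (l k / 8) \<union> shell x (l k))"
  proof
    fix y assume "y \<in> bad_children k x0"
    then have y: "y \<in> X (Suc k)" "parent k y = x0" "near_boundary k y" by (auto simp: bad_children_def)
    have yF: "y \<in> F" using y(1) X_sub by blast
    have d0: "dist y x0 < 9 / 8 * l k" using dist_parent[OF yF, of k] y(2) by simp
    obtain x where x: "x \<in> X k" and
      b: "\<bar>dist y x - (l k / 8 + shift k x)\<bar> \<le> 5 * l (Suc k) \<or> \<bar>dist y x - (l k + shift k x)\<bar> \<le> 5 * l (Suc k)"
      using y(3) unfolding near_boundary_def by blast
    have dx: "dist y x < 2 * l k" using b shift[OF x] l_Suc[of k] l_pos[of k] by (auto simp: abs_le_iff)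
    have "dist x0 x < 4 * l k" using dist_triangle[of x0 x y] d0 dx l_pos[of k] by (simp add: dist_commute)
    then have "x \<in> Z" using x by (simp add: Z_def)
    moreover have "y \<in> shell x (l k / 8) \<union> shell x (l k)" using b y(1) dx by (auto simp: shell_def dist_commute)
    ultimately show "y \<in> (\<Union>x\<in>Z. shell x (l k / 8) \<union> shell x (l k))" by blast
  qed
  have cZ: "real (card Z) \<le> C0 * 4 ^ d"
  proof -
    have "real (card Z) \<le> C0 * (4 * l k / l k) ^ d"
    proof (rule card_separated)
      show "x0 \<in> F" using x0 X_sub by blast
      show "separated (l k) Z" using X_sep by (rule separated_subset) (auto simp: Z_def)
    qed (use l_pos[of k] finZ X_sub gen_length_le_1[of N k] in \<open>auto simp: Z_def\<close>)
    then show ?thesis using l_pos[of k] by simp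
  qed
  have "card (bad_children k x0) \<le> card (\<Union>x\<in>Z. shell x (l k / 8) \<union> shell x (l k))"
    by (rule card_mono[OF _ sub]) (use finZ fins in auto)
  also have "\<dots> \<le> (\<Sum>x\<in>Z. card (shell x (l k / 8) \<union> shell x (l k)))" by (rule card_UN_le[OF finZ])
  also have "\<dots> \<le> (\<Sum>x\<in>Z. card (shell x (l k / 8)) + card (shell x (l k)))" by (intro sum_mono card_Un_le)
  finally have "real (card (bad_children k x0)) \<le> (\<Sum>x\<in>Z. real (card (shell x (l k / 8)) + card (shell x (l k))))"
    by (simp only: of_nat_sum[symmetric] of_nat_le_iff)
  also have "\<dots> \<le> (\<Sum>x\<in>Z. 256 * 2 ^ d * C0 * ((2 ^ N) ^ d / 2 ^ N))"
    by (rule sum_mono) (use thin in \<open>auto simp: Z_def shell_def\<close>)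
  also have "\<dots> = real (card Z) * (256 * 2 ^ d * C0 * ((2 ^ N) ^ d / 2 ^ N))" by simp
  also have "\<dots> \<le> C0 * 4 ^ d * (256 * 2 ^ d * C0 * ((2 ^ N) ^ d / 2 ^ N))"
    using cZ C0 by (intro mult_right_mono) auto
  finally show ?thesis by (simp only: mult.assoc)
qed

primrec descendants :: "nat \<Rightarrow> nat \<Rightarrow> real ^ 'n \<Rightarrow> (real ^ 'n) set" where
  "descendants 0 k x = {x}"
| "descendants (Suc m) k x = (\<Union>x'\<in>{x' \<in> X (Suc k). parent k x' = x}. descendants m (Suc k) x')"

definition all_descendants :: "nat \<Rightarrow> real ^ 'n \<Rightarrow> (real ^ 'n) set" where
  "all_descendants k x = (\<Union>m. descendants m k x)"

text \<open>The closed cubes of one generation cover \<open>F\<close> but overlap; the addresses below select a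
  single one for each point.\<close>

definition closed_cube :: "nat \<Rightarrow> real ^ 'n \<Rightarrow> (real ^ 'n) set" where
  "closed_cube k x = closure (all_descendants k x)"

lemma dist_descendants:
  "x \<in> X k \<Longrightarrow> y \<in> descendants m k x \<Longrightarrow> dist y x \<le> 2 * l k"
proof (induction m arbitrary: k x)
  case 0
  then show ?case using l_pos[of k] by simp
next
  case (Suc m)
  then obtain x' where x': "x' \<in> X (Suc k)" "parent k x' = x" "y \<in> descendants m (Suc k) x'" by auto
  have "dist y x' \<le> 2 * l (Suc k)" by (rule Suc.IH[OF x'(1,3)])
  moreover have "dist x' x < 9 / 8 * l k" using dist_parent[of x' k] x' X_sub by blast
  ultimately show ?case using dist_triangle[of y x x'] l_Suc[of k] l_pos[of k] by linarith
qed

lemma all_descendants_children: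
  assumes x: "x \<in> X k"
  shows "all_descendants k x = (\<Union>x'\<in>{x' \<in> X (Suc k). parent k x' = x}. all_descendants (Suc k) x')" (is "_ = ?R")
proof
  show "all_descendants k x \<subseteq> ?R"
  proof
    fix y assume "y \<in> all_descendants k x"
    then obtain m where m: "y \<in> descendants m k x" by (auto simp: all_descendants_def)
    show "y \<in> ?R"
    proof (cases m)
      case 0
      have "x \<in> X (Suc k)" "parent k x = x" using x X_mono parent_self by auto
      moreover have "y \<in> all_descendants (Suc k) x" using m 0 unfolding all_descendants_def by (intro UN_I[of 0]) auto
      ultimately show ?thesis by blast
    next
      case (Suc m')
      then show ?thesis using m by (auto simp: all_descendants_def)
    qed
  qed
  show "?R \<subseteq> all_descendants k x"
  proof
    fix y assume "y \<in> ?R"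
    then obtain x' m where "x' \<in> X (Suc k)" "parent k x' = x" "y \<in> descendants m (Suc k) x'" by (auto simp: all_descendants_def)
    then have "y \<in> descendants (Suc m) k x" by auto
    then show "y \<in> all_descendants k x" unfolding all_descendants_def by blast
  qed
qed

lemma closed_cube_children:
  assumes x: "x \<in> X k"
  shows "closed_cube k x = (\<Union>x'\<in>{x' \<in> X (Suc k). parent k x' = x}. closed_cube (Suc k) x')"
  unfolding closed_cube_def all_descendants_children[OF x] using finite_X by (intro closure_finite_UN) simp

lemma closed_cube_sub_cball: "x \<in> X k \<Longrightarrow> closed_cube k x \<subseteq> cball x (2 * l k)"
  unfolding closed_cube_def all_descendants_def by (intro closure_minimal) (auto, metis dist_commute dist_descendants)

lemma closed_cube_closed [simp]: "closed (closed_cube k x)"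
  by (simp add: closed_cube_def)

lemma descendants_cover: "y \<in> X (k + m) \<Longrightarrow> \<exists>x\<in>X k. y \<in> descendants m k x"
proof (induction m arbitrary: k)
  case (Suc m)
  then obtain x' where x': "x' \<in> X (Suc k)" "y \<in> descendants m (Suc k) x'" by (metis add_Suc_shift)
  then have "parent k x' \<in> X k" using parent_X X_sub by blast
  then show ?case using x' by (intro bexI[of _ "parent k x'"]) auto
qed simp

lemma gen_length_tendsto_0: "l \<longlonglongrightarrow> 0"
  unfolding gen_length_eq[abs_def] using N by (intro LIMSEQ_realpow_zero) auto

lemma closed_cubes_cover: "F \<subseteq> (\<Union>x\<in>X 0. closed_cube 0 x)"
proof
  fix z assume z: "z \<in> F"
  let ?U = "\<Union>x\<in>X 0. closed_cube 0 x"
  have "closed ?U" using finite_X by (intro closed_UN) auto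
  moreover have "z \<in> closure ?U"
    unfolding closure_approachable
  proof (intro allI impI)
    fix e :: real assume "0 < e"
    then have "\<forall>\<^sub>F m in sequentially. l m < e" using gen_length_tendsto_0 by (simp add: order_tendstoD(2))
    then obtain m where m: "l m < e" by (auto simp: eventually_sequentially)
    obtain y where y: "y \<in> X m" "dist z y < l m" using X_cov[OF z] by blast
    then obtain x where x: "x \<in> X 0" "y \<in> descendants m 0 x" using descendants_cover[of y 0 m] by auto
    then have "y \<in> all_descendants 0 x" unfolding all_descendants_def by blast
    then have "y \<in> closed_cube 0 x" unfolding closed_cube_def by (rule subsetD[OF closure_subset])
    then have "y \<in> ?U" using x(1) by blast
    then show "\<exists>y\<in>?U. dist y z < e" using y m by (intro bexI[of _ y]) (auto simp: dist_commute)
  qed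
  ultimately show "z \<in> ?U" by (simp add: closure_closed)
qed

text \<open>Ties between closed cubes are broken from the coarse generations to the fine ones, so that
  the chosen cubes are nested. As with \<open>parent\<close>, a choice depends on \<open>z\<close> only through a finite
  set of candidates; this makes the final cubes Borel sets.\<close>

primrec address :: "nat \<Rightarrow> real ^ 'n \<Rightarrow> real ^ 'n" where
  "address 0 z = (SOME x. x \<in> {x \<in> X 0. z \<in> closed_cube 0 x})"
| "address (Suc k) z = (SOME x. x \<in> {x \<in> X (Suc k). z \<in> closed_cube (Suc k) x} \<and> parent k x = address k z)"

lemma address_mem:
  assumes z: "z \<in> F"
  shows "address k z \<in> X k \<and> z \<in> closed_cube k (address k z)"
    and "parent k (address (Suc k) z) = address k z"
proof -
  have step: "address (Suc k) z \<in> {x \<in> X (Suc k). z \<in> closed_cube (Suc k) x} \<and> parent k (address (Suc k) z) = address k z"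
    if "address k z \<in> X k \<and> z \<in> closed_cube k (address k z)" for k
  proof -
    have "z \<in> (\<Union>x'\<in>{x' \<in> X (Suc k). parent k x' = address k z}. closed_cube (Suc k) x')"
      using that closed_cube_children[of "address k z" k] by simp
    then have "\<exists>x. x \<in> {x \<in> X (Suc k). z \<in> closed_cube (Suc k) x} \<and> parent k x = address k z" by blast
    from someI_ex[OF this] show ?thesis by simp
  qed
  have main: "address k z \<in> X k \<and> z \<in> closed_cube k (address k z)" for k
  proof (induction k)
    case 0
    have "address 0 z \<in> {x \<in> X 0. z \<in> closed_cube 0 x}"
    proof -
      have "\<exists>x. x \<in> {x \<in> X 0. z \<in> closed_cube 0 x}" using z closed_cubes_cover by blast
      from someI_ex[OF this] show ?thesis by simp
    qed
    then show ?case by simp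
  next
    case (Suc k)
    then show ?case using step by blast
  qed
  show "address k z \<in> X k \<and> z \<in> closed_cube k (address k z)" by (rule main)
  show "parent k (address (Suc k) z) = address k z" using step[OF main] by blast
qed

lemma dist_address: "z \<in> F \<Longrightarrow> dist z (address k z) \<le> 2 * l k"
  using address_mem(1)[of z k] closed_cube_sub_cball[of "address k z" k] by (auto simp: dist_commute)

text \<open>The next address of \<open>z\<close> is within \<open>2 l (Suc k)\<close> of \<open>z\<close>, hence in the core of \<open>x\<close>.\<close>

lemma address_near_center:
  assumes z: "z \<in> F" and x: "x \<in> X k" and d: "dist z x < l k / 16"
  shows "address k z = x"
proof -
  let ?y = "address (Suc k) z"
  have "dist z ?y \<le> 2 * l (Suc k)" by (rule dist_address[OF z])
  then have "dist ?y x < l k / 8"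
    using d l_Suc[of k] l_pos[of k] dist_triangle[of ?y x z] by (simp add: dist_commute)
  then have "parent k ?y = x" by (rule parent_unique[OF x])
  then show ?thesis using address_mem(2)[OF z, of k] by simp
qed

definition cube :: "nat \<Rightarrow> real ^ 'n \<Rightarrow> (real ^ 'n) set" where
  "cube k x = {z \<in> F. address k z = x}"

lemma borel_F: "F \<in> sets borel"
  using compact_F by (simp add: compact_imp_closed)

lemma borel_signature:
  assumes "T \<subseteq> X k"
  shows "{z \<in> F. {x \<in> X k. z \<in> closed_cube k x} = T} \<in> sets borel"
proof -
  have "{z \<in> F. {x \<in> X k. z \<in> closed_cube k x} = T} = F \<inter> (\<Inter>x\<in>X k. if x \<in> T then closed_cube k x else - closed_cube k x)"
    using assms by (auto split: if_splits)
  moreover have "F \<inter> (\<Inter>x\<in>X k. if x \<in> T then closed_cube k x else - closed_cube k x) \<in> sets borel"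
  proof (cases "X k = {}")
    case True then show ?thesis using borel_F by simp
  next
    case False
    then show ?thesis using finite_X borel_F by (intro sets.Int sets.finite_INT) auto
  qed
  ultimately show ?thesis by simp
qed

text \<open>There are finitely many sets of candidates, and each of them is the candidate set of \<open>z\<close>
  on a Borel set of points \<open>z\<close>.\<close>

lemma borel_cube: "cube k x \<in> sets borel"
proof (induction k arbitrary: x)
  case 0
  have "cube 0 x = (\<Union>T\<in>{T \<in> Pow (X 0). (SOME x. x \<in> T) = x}. {z \<in> F. {x \<in> X 0. z \<in> closed_cube 0 x} = T})"
    by (auto simp: cube_def)
  then show ?case using finite_X by (auto intro!: sets.finite_UN borel_signature)
next
  case (Suc k)
  have "cube (Suc k) x = (\<Union>p\<in>{p \<in> X k \<times> Pow (X (Suc k)). (SOME x. x \<in> snd p \<and> parent k x = fst p) = x}.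
      cube k (fst p) \<inter> {z \<in> F. {x \<in> X (Suc k). z \<in> closed_cube (Suc k) x} = snd p})"
  proof (intro equalityI subsetI)
    fix z assume z: "z \<in> cube (Suc k) x"
    then have zF: "z \<in> F" by (simp add: cube_def)
    let ?p = "(address k z, {x \<in> X (Suc k). z \<in> closed_cube (Suc k) x})"
    have "?p \<in> {p \<in> X k \<times> Pow (X (Suc k)). (SOME x. x \<in> snd p \<and> parent k x = fst p) = x}"
      using z address_mem(1)[OF zF, of k] by (auto simp: cube_def)
    moreover have "z \<in> cube k (fst ?p) \<inter> {z \<in> F. {x \<in> X (Suc k). z \<in> closed_cube (Suc k) x} = snd ?p}"
      using zF by (simp add: cube_def)
    ultimately show "z \<in> (\<Union>p\<in>{p \<in> X k \<times> Pow (X (Suc k)). (SOME x. x \<in> snd p \<and> parent k x = fst p) = x}.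
      cube k (fst p) \<inter> {z \<in> F. {x \<in> X (Suc k). z \<in> closed_cube (Suc k) x} = snd p})" by blast
  qed (auto simp: cube_def)
  then show ?case
    using finite_X Suc by (auto intro!: sets.finite_UN sets.Int borel_signature)
qed

end

lemma infdist_lessE:
  assumes "A \<noteq> {}" "infdist z A < t"
  obtains w where "w \<in> A" "dist z w < t"
proof -
  have "bdd_below (dist z ` A)" by (intro bdd_belowI[of _ 0]) auto
  then show ?thesis using assms that by (auto simp: infdist_notempty cINF_less_iff)
qed

context cube_tree
begin

declare address.simps [simp del]

primrec bad_descendants :: "nat \<Rightarrow> nat \<Rightarrow> real ^ 'n \<Rightarrow> (real ^ 'n) set" where
  "bad_descendants 0 k x = {x}"
| "bad_descendants (Suc m) k x = (\<Union>x'\<in>bad_children k x. bad_descendants m (Suc k) x')"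

lemma finite_bad_children: "finite (bad_children k x)"
  and bad_children_sub: "bad_children k x \<subseteq> X (Suc k)"
  using finite_X by (auto simp: bad_children_def)

lemma finite_bad_descendants: "finite (bad_descendants m k x)"
  by (induction m arbitrary: k x) (auto simp: finite_bad_children)

lemma bad_descendants_sub: "x \<in> X k \<Longrightarrow> bad_descendants m k x \<subseteq> X (k + m)"
proof (induction m arbitrary: k x)
  case (Suc m)
  have "bad_descendants m (Suc k) x' \<subseteq> X (Suc k + m)" if "x' \<in> bad_children k x" for x'
    using that bad_children_sub by (intro Suc.IH) auto
  then show ?case by auto
qed simp

lemma card_bad_descendants:
  assumes B: "C0 * 4 ^ d * (256 * 2 ^ d * C0) * ((2 ^ N) ^ d / 2 ^ N) \<le> B"
  shows "x \<in> X k \<Longrightarrow> real (card (bad_descendants m k x)) \<le> B ^ m"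
proof (induction m arbitrary: k x)
  case (Suc m)
  have cB: "real (card (bad_children k x)) \<le> B" using card_bad_children[OF Suc.prems] B by linarith
  then have B0: "0 \<le> B" by linarith
  have "card (bad_descendants (Suc m) k x) \<le> (\<Sum>x'\<in>bad_children k x. card (bad_descendants m (Suc k) x'))"
    using card_UN_le[OF finite_bad_children] by simp
  then have "real (card (bad_descendants (Suc m) k x)) \<le> (\<Sum>x'\<in>bad_children k x. real (card (bad_descendants m (Suc k) x')))"
    by (simp only: of_nat_sum[symmetric] of_nat_le_iff)
  also have "\<dots> \<le> (\<Sum>x'\<in>bad_children k x. B ^ m)"
    using bad_children_sub by (intro sum_mono Suc.IH) auto
  also have "\<dots> = real (card (bad_children k x)) * B ^ m" by simp
  also have "\<dots> \<le> B * B ^ m" using cB B0 by (intro mult_right_mono) auto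
  finally show ?case by simp
qed simp

lemma address_bad_descendants:
  assumes z: "z \<in> F"
  shows "(\<And>k. j \<le> k \<Longrightarrow> k < j + m \<Longrightarrow> near_boundary k (address (Suc k) z)) \<Longrightarrow> address (j + m) z \<in> bad_descendants m j (address j z)"
proof (induction m arbitrary: j)
  case (Suc m)
  have "address (Suc j) z \<in> bad_children j (address j z)"
    using address_mem[OF z] Suc.prems[of j] by (auto simp: bad_children_def)
  moreover have "address (Suc j + m) z \<in> bad_descendants m (Suc j) (address (Suc j) z)"
    by (rule Suc.IH) (use Suc.prems in auto)
  ultimately show ?case by auto
qed simp

lemma address_eq_up:
  assumes "z \<in> F" "w \<in> F" and "j \<le> k" and "address k z = address k w"
  shows "address j z = address j w"
  using assms(3,4)
proof (induction rule: inc_induct)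
  case base then show ?case .
next
  case (step n)
  then have "parent n (address (Suc n) z) = parent n (address (Suc n) w)" by simp
  then show ?case using address_mem(2)[OF assms(1)] address_mem(2)[OF assms(2)] by simp
qed

lemma l_antimono: "j \<le> k \<Longrightarrow> l k \<le> l j"
proof (induction rule: dec_induct)
  case (step n)
  then show ?case using l_Suc[of n] l_pos[of "Suc n"] by linarith
qed simp

lemma cube_sub: "cube k x \<subseteq> F"
  by (auto simp: cube_def)

text \<open>A point \<open>z\<close> of the layer gives \<open>s\<close> in the cube and \<open>w\<close> outside at distance less than \<open>t\<close>.
  Their addresses differ from generation \<open>j\<close> on, although those of generations \<open>j + 1\<close> to
  \<open>j + m\<close> are as close as the mesh. So every address of \<open>s\<close> in these generations is near the
  boundary of its parent.\<close>

lemma boundary_layer_near_bad_descendants: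
  assumes t: "t \<le> l (j + m)" and z: "z \<in> boundary_layer F (cube j x) t"
  shows "\<exists>y\<in>bad_descendants m j x. dist y z < 3 * l (j + m)"
proof -
  obtain s w where sw: "s \<in> cube j x" "w \<in> F - cube j x" "dist s w < t" "z = s \<or> z = w"
  proof (cases "z \<in> cube j x")
    case True
    then have "F - cube j x \<noteq> {}" "infdist z (F - cube j x) < t" using z by (auto simp: boundary_layer_def)
    then obtain w where "w \<in> F - cube j x" "dist z w < t" by (rule infdist_lessE)
    then show ?thesis using that True by blast
  next
    case False
    then have "cube j x \<noteq> {}" "infdist z (cube j x) < t" "z \<in> F - cube j x" using z by (auto simp: boundary_layer_def)
    moreover from this(1,2) obtain s where "s \<in> cube j x" "dist z s < t" by (rule infdist_lessE)
    ultimately show ?thesis using that[of s z] by (auto simp: dist_commute)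
  qed
  have sF: "s \<in> F" and wF: "w \<in> F" using sw cube_sub by auto
  have sx: "address j s = x" and wx: "address j w \<noteq> x" using sw by (auto simp: cube_def)
  have "near_boundary k (address (Suc k) s)" if k: "j \<le> k" "k < j + m" for k
  proof (rule near_boundary_if_parents_differ)
    have "t \<le> l (Suc k)" using t l_antimono[of "Suc k" "j + m"] k by simp
    then have "dist s w \<le> l (Suc k)" using sw(3) by linarith
    then show "dist (address (Suc k) s) (address (Suc k) w) \<le> 5 * l (Suc k)"
      using dist_address[OF sF, of "Suc k"] dist_address[OF wF, of "Suc k"]
        dist_triangle[of "address (Suc k) s" "address (Suc k) w" s] dist_triangle[of s "address (Suc k) w" w]
      by (simp add: dist_commute)
    show "parent k (address (Suc k) s) \<noteq> parent k (address (Suc k) w)"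
      using address_eq_up[OF sF wF k(1)] sx wx address_mem(2)[OF sF, of k] address_mem(2)[OF wF, of k] by auto
  qed
  then have mem: "address (j + m) s \<in> bad_descendants m j x" using address_bad_descendants[OF sF, of j m] sx by simp
  have "dist z s < l (j + m)" using sw(3,4) t l_pos[of "j + m"] by (auto simp: dist_commute)
  then have "dist (address (j + m) s) z < 3 * l (j + m)"
    using dist_address[OF sF, of "j + m"] dist_triangle[of "address (j + m) s" z s] by (simp add: dist_commute)
  then show ?thesis using mem by blast
qed

lemma boundary_cube_count_le:
  assumes B: "C0 * 4 ^ d * (256 * 2 ^ d * C0) * ((2 ^ N) ^ d / 2 ^ N) \<le> B"
    and t: "0 < t" "t \<le> l (j + m)" "l (Suc (j + m)) \<le> t" and x: "x \<in> X j"
  shows "real (boundary_cube_count F (cube j x) t) \<le> B ^ m * (4 ^ CARD('n) * (C0 * (3 * 2 ^ N) ^ d))"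
proof -
  let ?l = "l (j + m)"
  let ?K = "\<lambda>E. {K \<in> grid_cubes t. K \<inter> E \<noteq> {}}"
  let ?E = "\<lambda>y. F \<inter> ball y (3 * ?l)"
  have t1: "t \<le> 1" using t(2) gen_length_le_1[of N "j + m"] by linarith
  have tl: "t \<le> 3 * ?l" using t(2) l_pos[of "j + m"] by linarith
  have yF: "y \<in> F" if "y \<in> bad_descendants m j x" for y using that bad_descendants_sub[OF x, of m] X_sub by blast
  have K0: "0 \<le> 4 ^ CARD('n) * (C0 * (3 * 2 ^ N) ^ d)" using C0 by simp
  have "boundary_layer F (cube j x) t \<subseteq> F" using cube_sub[of j x] by (auto simp: boundary_layer_def)
  then have "boundary_layer F (cube j x) t \<subseteq> (\<Union>y\<in>bad_descendants m j x. ?E y)"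
    using boundary_layer_near_bad_descendants[OF t(2)] by fastforce
  then have sub: "?K (boundary_layer F (cube j x) t) \<subseteq> (\<Union>y\<in>bad_descendants m j x. ?K (?E y))" by blast
  have fin: "finite (?K (?E y))" if "y \<in> bad_descendants m j x" for y
    by (rule grid_cubes_count(1)[OF yF[OF that] t(1) t1 tl]) simp
  have count: "real (card (?K (?E y))) \<le> 4 ^ CARD('n) * (C0 * (3 * 2 ^ N) ^ d)" if "y \<in> bad_descendants m j x" for y
  proof -
    have "real (card (?K (?E y))) \<le> 4 ^ CARD('n) * (C0 * (3 * ?l / t) ^ d)"
      by (rule grid_cubes_count(2)[OF yF[OF that] t(1) t1 tl]) simp
    also have "\<dots> \<le> 4 ^ CARD('n) * (C0 * (3 * 2 ^ N) ^ d)"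
    proof (intro mult_left_mono power_mono C0)
      have "?l \<le> 2 ^ N * t" using t(3) by (simp add: gen_length_Suc divide_le_eq mult.commute)
      then show "3 * ?l / t \<le> 3 * 2 ^ N" using t(1) by (simp add: divide_le_eq)
      show "0 \<le> 3 * ?l / t" using t(1) l_pos[of "j + m"] by simp
    qed simp
    finally show ?thesis .
  qed
  have "boundary_cube_count F (cube j x) t \<le> card (\<Union>y\<in>bad_descendants m j x. ?K (?E y))"
    unfolding boundary_cube_count_def using sub finite_bad_descendants fin by (intro card_mono) auto
  also have "\<dots> \<le> (\<Sum>y\<in>bad_descendants m j x. card (?K (?E y)))" by (rule card_UN_le[OF finite_bad_descendants])
  finally have "real (boundary_cube_count F (cube j x) t) \<le> (\<Sum>y\<in>bad_descendants m j x. real (card (?K (?E y))))"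
    by (simp only: of_nat_sum[symmetric] of_nat_le_iff)
  also have "\<dots> \<le> (\<Sum>y\<in>bad_descendants m j x. 4 ^ CARD('n) * (C0 * (3 * 2 ^ N) ^ d))" by (intro sum_mono count)
  also have "\<dots> = real (card (bad_descendants m j x)) * (4 ^ CARD('n) * (C0 * (3 * 2 ^ N) ^ d))" by simp
  also have "\<dots> \<le> B ^ m * (4 ^ CARD('n) * (C0 * (3 * 2 ^ N) ^ d))"
    by (intro mult_right_mono card_bad_descendants[OF B x] K0)
  finally show ?thesis .
qed

text \<open>The assumption on \<open>N\<close> turns the bound for bad children into \<open>2 ^ (N (d - 1/2))\<close>. The
  number \<open>m\<close> of generations is chosen such that \<open>\<tau>\<close> lies between \<open>2 ^ (- N (m + 1))\<close> and
  \<open>2 ^ (- N m)\<close>.\<close>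

lemma small_boundary:
  assumes N_large: "C0 * 4 ^ d * (256 * 2 ^ d * C0) \<le> sqrt (2 ^ N)"
    and \<tau>: "0 < \<tau>" "\<tau> < 1" and x: "x \<in> X j"
  shows "real (boundary_cube_count F (cube j x) (\<tau> * l j)) \<le> 4 ^ CARD('n) * (C0 * (3 * 2 ^ N) ^ d) * \<tau> powr (1 / 2 - real d)"
proof -
  define q where "q = (2 :: real) ^ N"
  have q1: "1 < q" using N by (simp add: q_def)
  have q0: "0 < q" using q1 by linarith
  define B where "B = q ^ d / sqrt q"
  have B: "C0 * 4 ^ d * (256 * 2 ^ d * C0) * ((2 ^ N) ^ d / 2 ^ N) \<le> B"
  proof -
    have "C0 * 4 ^ d * (256 * 2 ^ d * C0) * (q ^ d / q) \<le> sqrt q * (q ^ d / q)"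
      using N_large q0 by (intro mult_right_mono) (auto simp: q_def)
    also have "\<dots> = q ^ d * (sqrt q / q)" by simp
    also have "sqrt q / q = 1 / sqrt q"
    proof -
      have "sqrt q / (sqrt q * sqrt q) = 1 / sqrt q" using q0 by (simp del: real_sqrt_mult_self)
      then show ?thesis using q0 by simp
    qed
    finally show ?thesis by (simp add: B_def q_def)
  qed
  have "\<exists>m. (1 / q) ^ Suc m \<le> \<tau>"
  proof -
    have "(\<lambda>m. (1 / q) ^ Suc m) \<longlonglongrightarrow> 0" using q1 by (intro LIMSEQ_Suc LIMSEQ_realpow_zero) auto
    then have "\<forall>\<^sub>F m in sequentially. (1 / q) ^ Suc m < \<tau>" using \<tau>(1) by (rule order_tendstoD(2))
    then show ?thesis by (auto simp: eventually_sequentially intro: less_imp_le)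
  qed
  then obtain m where m: "(1 / q) ^ Suc m \<le> \<tau>" "\<And>i. i < m \<Longrightarrow> \<not> (1 / q) ^ Suc i \<le> \<tau>"
    using exists_least_iff[of "\<lambda>m. (1 / q) ^ Suc m \<le> \<tau>"] by auto
  have m2: "\<tau> < (1 / q) ^ m"
  proof (cases m)
    case 0 then show ?thesis using \<tau> by simp
  next
    case (Suc i) then show ?thesis using m(2)[of i] by simp
  qed
  have lm: "l (j + m) = (1 / q) ^ m * l j" by (simp add: gen_length_add q_def power_one_over)
  have lm': "l (Suc (j + m)) = (1 / q) ^ Suc m * l j" by (simp add: gen_length_Suc gen_length_add q_def power_one_over)
  have "real (boundary_cube_count F (cube j x) (\<tau> * l j)) \<le> B ^ m * (4 ^ CARD('n) * (C0 * (3 * 2 ^ N) ^ d))"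
  proof (rule boundary_cube_count_le[OF B _ _ _ x])
    show "0 < \<tau> * l j" using \<tau> l_pos[of j] by simp
    show "\<tau> * l j \<le> l (j + m)" unfolding lm using m2 l_pos[of j] by (intro mult_right_mono) auto
    show "l (Suc (j + m)) \<le> \<tau> * l j" unfolding lm' using m(1) l_pos[of j] by (intro mult_right_mono) auto
  qed
  moreover have "B ^ m \<le> \<tau> powr (1 / 2 - real d)"
  proof -
    have "B = q powr (real d - 1 / 2)"
      using q0 by (simp add: B_def powr_diff powr_realpow powr_half_sqrt)
    then have "B ^ m = (q ^ m) powr (real d - 1 / 2)"
      using q0 by (simp add: powr_realpow[symmetric] powr_powr mult.commute)
    also have "\<dots> \<le> (1 / \<tau>) powr (real d - 1 / 2)"
    proof (rule powr_mono2)
      show "0 \<le> real d - 1 / 2" using d by simp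
      show "q ^ m \<le> 1 / \<tau>" using m2 \<tau> q0 by (simp add: power_one_over field_simps)
    qed (use q0 in auto)
    also have "\<dots> = \<tau> powr (1 / 2 - real d)"
      using \<tau>(1) by (simp add: powr_divide powr_minus_divide[symmetric])
    finally show ?thesis .
  qed
  then have "B ^ m * (4 ^ CARD('n) * (C0 * (3 * 2 ^ N) ^ d)) \<le> \<tau> powr (1 / 2 - real d) * (4 ^ CARD('n) * (C0 * (3 * 2 ^ N) ^ d))"
    using C0 by (intro mult_right_mono) auto
  ultimately show ?thesis by (simp only: mult.commute[of "\<tau> powr _"])
qed

end

text \<open>Uniform perfectness gives the lower bound for the diameters: a cube contains the part of
  \<open>F\<close> in a ball about its center. The constant \<open>2\<close> inside the final \<open>C\<close> keeps \<open>1 / C\<close> below the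
  exponent \<open>1 / 2\<close> that the construction gains.\<close>

theorem (in covering_bound) cubes_with_small_boundary:
  assumes c1: "0 < c1" and perfect: "\<And>x r. x \<in> F \<Longrightarrow> 0 < r \<Longrightarrow> r \<le> 1 \<Longrightarrow> \<exists>z\<in>F. c1 * r \<le> dist z x \<and> dist z x < r"
  shows "\<exists>(N :: nat) (\<S> :: nat \<Rightarrow> (real ^ 'n) set set). N > 0 \<and>
    (\<forall>j. \<forall>S\<in>\<S> j. S \<in> sets borel \<and> S \<subseteq> F) \<and>
    (\<exists>a>0. \<exists>b>0. \<forall>j. \<forall>S\<in>\<S> j. a * gen_length N j \<le> diameter S \<and> diameter S \<le> b * gen_length N j) \<and>
    (\<forall>j. F = \<Union> (\<S> j)) \<and>
    (\<forall>j. \<forall>S\<in>\<S> j. \<forall>S'\<in>\<S> j. S' \<noteq> S \<longrightarrow> S \<inter> S' = {}) \<and>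
    (\<forall>j k. j < k \<longrightarrow> (\<forall>S\<in>\<S> j. \<forall>S'\<in>\<S> k. S' \<subseteq> S \<or> S' \<inter> S = {})) \<and>
    (\<exists>c\<^sub>0>0. \<forall>j. \<forall>S\<in>\<S> j. \<exists>x\<in>S. ball x (c\<^sub>0 * gen_length N j) \<inter> F \<subseteq> S) \<and>
    (\<exists>C>0. \<forall>\<tau>. 0 < \<tau> \<and> \<tau> < 1 \<longrightarrow> (\<forall>j. \<forall>S\<in>\<S> j.
       real (boundary_cube_count F S (\<tau> * gen_length N j)) \<le> C * \<tau> powr (1 / C - real d)))"
proof -
  let ?K = "C0 * 4 ^ d * (256 * 2 ^ d * C0)"
  obtain N0 :: nat where N0: "?K\<^sup>2 < 2 ^ N0" using real_arch_pow[of 2 "?K\<^sup>2"] by auto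
  define N where "N = max 7 N0"
  have N: "7 \<le> N" by (simp add: N_def)
  have "(2 :: real) ^ N0 \<le> 2 ^ N" by (intro power_increasing) (auto simp: N_def)
  then have N_large: "?K \<le> sqrt (2 ^ N)" using N0 by (intro real_le_rsqrt) linarith
  obtain X shift where "cube_tree F d C0 N X shift" using cube_tree_exists[OF N] by blast
  then interpret cube_tree F d C0 N X shift .
  define \<S> where "\<S> = (\<lambda>k. cube k ` X k)"
  have center: "ball x (1 / 16 * l k) \<inter> F \<subseteq> cube k x" if "x \<in> X k" for x k
    using address_near_center[OF _ that] by (auto simp: cube_def dist_commute)
  have center_in: "x \<in> cube k x" if "x \<in> X k" for x k
  proof -
    have "x \<in> ball x (1 / 16 * l k) \<inter> F" using that X_sub[of k] l_pos[of k] by auto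
    then show ?thesis using center[OF that] by blast
  qed
  define K where "K = 4 ^ CARD('n) * (C0 * (3 * 2 ^ N) ^ d)"
  define C where "C = max 2 K"
  show ?thesis
  proof (intro exI[of _ N] exI[of _ \<S>] conjI)
    show "N > 0" using N by simp
    show "\<forall>j. \<forall>S\<in>\<S> j. S \<in> sets borel \<and> S \<subseteq> F"
      using borel_cube cube_sub by (auto simp: \<S>_def)
    show "\<exists>a>0. \<exists>b>0. \<forall>j. \<forall>S\<in>\<S> j. a * l j \<le> diameter S \<and> diameter S \<le> b * l j"
    proof (rule exI[of _ "c1 / 16"], rule conjI, use c1 in simp, rule exI[of _ 4], intro conjI allI ballI)
      fix j S assume "S \<in> \<S> j"
      then obtain x where x: "x \<in> X j" "S = cube j x" by (auto simp: \<S>_def)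
      have bnd: "dist z x \<le> 2 * l j" if "z \<in> S" for z
        using that dist_address[of z j] by (auto simp: x(2) cube_def)
      then have "bounded S" by (auto simp: bounded_any_center[where a = x] dist_commute)
      obtain z where z: "z \<in> F" "c1 * (l j / 16) \<le> dist z x" "dist z x < l j / 16"
        using perfect[of x "l j / 16"] x(1) X_sub l_pos[of j] gen_length_le_1[of N j] by auto
      have "z \<in> S" "x \<in> S" using center[OF x(1)] z center_in[OF x(1)] by (auto simp: x(2) dist_commute)
      then show "c1 / 16 * l j \<le> diameter S"
        using diameter_bounded_bound[OF \<open>bounded S\<close>, of z x] z(2) by simp
      show "diameter S \<le> 4 * l j"
      proof (rule diameter_le)
        fix y z assume "y \<in> S" "z \<in> S"
        then show "norm (y - z) \<le> 4 * l j"
          using bnd[of y] bnd[of z] dist_triangle2[of y z x] by (simp add: dist_norm)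
      qed (use l_pos[of j] in simp)
    qed simp
    show "\<forall>j. F = \<Union> (\<S> j)"
    proof
      fix j
      show "F = \<Union> (\<S> j)" using address_mem(1)[of _ j] cube_sub by (auto simp: \<S>_def cube_def)
    qed
    show "\<forall>j. \<forall>S\<in>\<S> j. \<forall>S'\<in>\<S> j. S' \<noteq> S \<longrightarrow> S \<inter> S' = {}"
      by (auto simp: \<S>_def cube_def)
    show "\<forall>j k. j < k \<longrightarrow> (\<forall>S\<in>\<S> j. \<forall>S'\<in>\<S> k. S' \<subseteq> S \<or> S' \<inter> S = {})"
    proof (intro allI impI ballI)
      fix j k S S' assume jk: "j < k" and S: "S \<in> \<S> j" "S' \<in> \<S> k"
      then obtain x y where xy: "S = cube j x" "S' = cube k y" by (auto simp: \<S>_def)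
      have "address j z = address j w" if "z \<in> S'" "w \<in> S'" for z w
        using that jk by (intro address_eq_up[of z w j k]) (auto simp: xy cube_def)
      then show "S' \<subseteq> S \<or> S' \<inter> S = {}" by (auto simp: xy cube_def)
    qed
    show "\<exists>c\<^sub>0>0. \<forall>j. \<forall>S\<in>\<S> j. \<exists>x\<in>S. ball x (c\<^sub>0 * l j) \<inter> F \<subseteq> S"
    proof (intro exI[of _ "1 / 16"] conjI allI ballI)
      fix j S assume "S \<in> \<S> j"
      then obtain x where x: "x \<in> X j" "S = cube j x" by (auto simp: \<S>_def)
      show "\<exists>x\<in>S. ball x (1 / 16 * l j) \<inter> F \<subseteq> S"
        using center[OF x(1)] center_in[OF x(1)] unfolding x(2) by (rule rev_bexI[rotated])
    qed simp
    show "\<exists>C>0. \<forall>\<tau>. 0 < \<tau> \<and> \<tau> < 1 \<longrightarrow> (\<forall>j. \<forall>S\<in>\<S> j.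
       real (boundary_cube_count F S (\<tau> * l j)) \<le> C * \<tau> powr (1 / C - real d))"
    proof (intro exI[of _ C] conjI allI impI ballI)
      show "0 < C" by (simp add: C_def)
      fix \<tau> :: real and j S assume \<tau>: "0 < \<tau> \<and> \<tau> < 1" and "S \<in> \<S> j"
      then obtain x where x: "x \<in> X j" "S = cube j x" by (auto simp: \<S>_def)
      have "real (boundary_cube_count F S (\<tau> * l j)) \<le> K * \<tau> powr (1 / 2 - real d)"
        unfolding x(2) K_def using small_boundary[OF N_large _ _ x(1)] \<tau> by blast
      also have "\<dots> \<le> C * \<tau> powr (1 / C - real d)"
      proof (rule mult_mono)
        have "1 / C \<le> 1 / 2" by (rule divide_left_mono) (auto simp: C_def)
        then show "\<tau> powr (1 / 2 - real d) \<le> \<tau> powr (1 / C - real d)"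
          using \<tau> by (intro powr_mono') auto
      qed (auto simp: C_def)
      finally show "real (boundary_cube_count F S (\<tau> * l j)) \<le> C * \<tau> powr (1 / C - real d)" .
    qed
  qed
qed

section \<open>Derivatives of integrals\<close>

lemma tendsto_integral_at:
  fixes f :: "'a::metric_space \<Rightarrow> 'b \<Rightarrow> 'c::{banach,second_countable_topology}"
  assumes "finite_measure M" and "e > 0"
    and meas: "\<And>y. y \<in> S \<Longrightarrow> dist y y0 < e \<Longrightarrow> f y \<in> borel_measurable M"
    and measl: "l \<in> borel_measurable M"
    and lim: "AE z in M. ((\<lambda>y. f y z) \<longlongrightarrow> l z) (at y0 within S)"
    and bound: "AE z in M. \<forall>y\<in>S. dist y y0 < e \<longrightarrow> y \<noteq> y0 \<longrightarrow> norm (f y z) \<le> C"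
  shows "((\<lambda>y. integral\<^sup>L M (f y)) \<longlongrightarrow> integral\<^sup>L M l) (at y0 within S)"
  unfolding tendsto_at_iff_sequentially comp_def
proof (intro allI impI)
  interpret finite_measure M by fact
  fix X assume X: "\<forall>i. X i \<in> S - {y0}" "X \<longlonglongrightarrow> y0"
  then have "eventually (\<lambda>i. dist (X i) y0 < e) sequentially"
    using \<open>e > 0\<close> by (simp add: tendstoD)
  then obtain N where N: "\<And>i. i \<ge> N \<Longrightarrow> dist (X i) y0 < e"
    by (auto simp: eventually_sequentially)
  have "(\<lambda>i. integral\<^sup>L M (f (X (i + N)))) \<longlonglongrightarrow> integral\<^sup>L M l"
  proof (rule integral_dominated_convergence[where w = "\<lambda>_. C"])
    show "AE z in M. (\<lambda>i. f (X (i + N)) z) \<longlonglongrightarrow> l z"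
      using lim
    proof eventually_elim
      case (elim z)
      have "(\<lambda>i. f (X i) z) \<longlonglongrightarrow> l z"
        using elim X unfolding tendsto_at_iff_sequentially comp_def by blast
      then show ?case by (rule LIMSEQ_ignore_initial_segment)
    qed
    show "AE z in M. norm (f (X (i + N)) z) \<le> C" for i
      using bound by eventually_elim (use X N in auto)
  qed (use measl X N in \<open>auto intro: meas\<close>)
  then show "(\<lambda>i. integral\<^sup>L M (f (X i))) \<longlonglongrightarrow> integral\<^sup>L M l"
    by (rule LIMSEQ_offset)
qed

text \<open>The bound on the derivative dominates the difference quotients, by the mean value
  inequality on the ball.\<close>

lemma has_derivative_integral:
  fixes f :: "'a::real_normed_vector \<Rightarrow> 'b \<Rightarrow> 'c::{banach,second_countable_topology}"
  assumes fin: "finite_measure M" and "e > 0"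
    and int: "\<And>y. dist y y0 < e \<Longrightarrow> integrable M (f y)"
    and meas: "\<And>h. (\<lambda>z. f' y0 z h) \<in> borel_measurable M"
    and der: "AE z in M. \<forall>y. dist y y0 < e \<longrightarrow>
      ((\<lambda>y. f y z) has_derivative f' y z) (at y) \<and> (\<forall>h. norm (f' y z h) \<le> C * norm h)"
  shows "((\<lambda>y. \<integral>z. f y z \<partial>M) has_derivative (\<lambda>h. \<integral>z. f' y0 z h \<partial>M)) (at y0)"
proof -
  interpret finite_measure M by fact
  have der0: "AE z in M. ((\<lambda>y. f y z) has_derivative f' y0 z) (at y0) \<and> (\<forall>h. norm (f' y0 z h) \<le> C * norm h)"
    using der by eventually_elim (use \<open>e > 0\<close> in auto)
  have int': "integrable M (\<lambda>z. f' y0 z h)" for h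
    by (rule integrable_const_bound[where B = "C * norm h"]) (use der0 meas in auto)
  have bl: "AE z in M. bounded_linear (f' y0 z)"
    using der0 by eventually_elim (auto dest: has_derivative_bounded_linear)
  have lin: "bounded_linear (\<lambda>h. \<integral>z. f' y0 z h \<partial>M)"
  proof (rule bounded_linear_intro[where K = "C * measure M (space M)"])
    fix h k
    have "(\<integral>z. f' y0 z (h + k) \<partial>M) = (\<integral>z. f' y0 z h + f' y0 z k \<partial>M)"
      by (rule integral_cong_AE) (use meas bl in \<open>auto elim!: eventually_mono simp: linear_simps\<close>)
    then show "(\<integral>z. f' y0 z (h + k) \<partial>M) = (\<integral>z. f' y0 z h \<partial>M) + (\<integral>z. f' y0 z k \<partial>M)"
      using int' by simp
  next
    fix r h
    have "(\<integral>z. f' y0 z (r *\<^sub>R h) \<partial>M) = (\<integral>z. r *\<^sub>R f' y0 z h \<partial>M)"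
      by (rule integral_cong_AE) (use meas bl in \<open>auto elim!: eventually_mono simp: linear_simps\<close>)
    then show "(\<integral>z. f' y0 z (r *\<^sub>R h) \<partial>M) = r *\<^sub>R (\<integral>z. f' y0 z h \<partial>M)"
      using int' by simp
  next
    fix h
    have "norm (\<integral>z. f' y0 z h \<partial>M) \<le> (\<integral>z. norm (f' y0 z h) \<partial>M)"
      by (rule integral_norm_bound)
    also have "\<dots> \<le> (\<integral>z. C * norm h \<partial>M)"
      by (rule integral_mono_AE) (use int' der0 in auto)
    finally show "norm (\<integral>z. f' y0 z h \<partial>M) \<le> norm h * (C * measure M (space M))"
      by (simp add: mult_ac)
  qed
  define R where "R = (\<lambda>y z. (f y z - f y0 z - f' y0 z (y - y0)) /\<^sub>R norm (y - y0))"
  have "((\<lambda>y. integral\<^sup>L M (R y)) \<longlongrightarrow> integral\<^sup>L M (\<lambda>_. 0)) (at y0)"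
  proof (rule tendsto_integral_at[OF fin \<open>e > 0\<close>, where C = "2 * C"])
    show "AE z in M. ((\<lambda>y. R y z) \<longlongrightarrow> 0) (at y0)"
      using der0
    proof eventually_elim
      case (elim z)
      then have "((\<lambda>y. (f y z - f y0 z - f' y0 z (y - y0)) /\<^sub>R norm (y - y0)) \<longlongrightarrow> 0) (at y0)"
        unfolding has_derivative_at_within by auto
      then show ?case by (simp add: R_def)
    qed
    show "AE z in M. \<forall>y\<in>UNIV. dist y y0 < e \<longrightarrow> y \<noteq> y0 \<longrightarrow> norm (R y z) \<le> 2 * C"
      using der
    proof eventually_elim
      case (elim z)
      show ?case
      proof (intro ballI impI)
        fix y assume y: "dist y y0 < e" "y \<noteq> y0"
        have "0 \<le> C * norm (y - y0)"
          using elim \<open>e > 0\<close> order_trans[OF norm_ge_zero] by (metis dist_self)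
        then have C: "C \<ge> 0" using y by (simp add: zero_le_mult_iff)
        have "norm (f y z - f y0 z) \<le> C * norm (y - y0)"
        proof (rule differentiable_bound[where S = "ball y0 e" and f' = "\<lambda>y. f' y z"])
          fix x assume x: "x \<in> ball y0 e"
          then show "((\<lambda>y. f y z) has_derivative f' x z) (at x within ball y0 e)"
            using elim by (auto simp: dist_commute intro: has_derivative_at_withinI)
          show "onorm (f' x z) \<le> C"
            by (rule onorm_bound) (use elim x C in \<open>auto simp: dist_commute\<close>)
        qed (use y \<open>e > 0\<close> in \<open>auto simp: dist_commute\<close>)
        moreover have "norm (f' y0 z (y - y0)) \<le> C * norm (y - y0)"
          using elim \<open>e > 0\<close> by auto
        ultimately have "norm (f y z - f y0 z - f' y0 z (y - y0)) \<le> 2 * C * norm (y - y0)"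
          using norm_triangle_ineq4[of "f y z - f y0 z" "f' y0 z (y - y0)"] by linarith
        moreover have "norm (R y z) = norm (f y z - f y0 z - f' y0 z (y - y0)) / norm (y - y0)"
          unfolding R_def norm_scaleR by (simp add: divide_inverse mult.commute)
        ultimately show "norm (R y z) \<le> 2 * C"
          using y by (simp add: pos_divide_le_eq)
      qed
    qed
  qed (use int \<open>e > 0\<close> meas in \<open>auto simp: R_def\<close>)
  then have "((\<lambda>y. integral\<^sup>L M (R y)) \<longlongrightarrow> 0) (at y0)" by simp
  moreover have "eventually (\<lambda>y. integral\<^sup>L M (R y) = ((\<integral>z. f y z \<partial>M) - (\<integral>z. f y0 z \<partial>M) - (\<integral>z. f' y0 z (y - y0) \<partial>M)) /\<^sub>R norm (y - y0)) (at y0)"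
    unfolding eventually_at
  proof (intro exI[of _ e] conjI ballI impI)
    fix y assume "y \<noteq> y0 \<and> dist y y0 < e"
    then show "integral\<^sup>L M (R y) = ((\<integral>z. f y z \<partial>M) - (\<integral>z. f y0 z \<partial>M) - (\<integral>z. f' y0 z (y - y0) \<partial>M)) /\<^sub>R norm (y - y0)"
      unfolding R_def using int[of y] int[of y0] int' \<open>e > 0\<close>
      by simp
  qed fact
  ultimately show ?thesis
    unfolding has_derivative_at_within using lin by (auto intro: Lim_transform_eventually)
qed

text \<open>Lebesgue measure is translation invariant, so all difference quotients in the direction
  \<open>e\<close> have integral 0. This is the divergence theorem for functions of compact support.\<close>

lemma integral_partial_derivative_eq_0:
  fixes f :: "'a::euclidean_space \<Rightarrow> real"
  assumes der: "\<And>y. (f has_derivative f' y) (at y)"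
    and bd: "\<And>y. \<bar>f' y e\<bar> \<le> C"
    and supp: "\<And>y. norm y > r \<Longrightarrow> f y = 0"
    and meas: "(\<lambda>y. f' y e) \<in> borel_measurable borel"
  shows "(\<integral>y. f' y e \<partial>lborel) = 0"
proof -
  have cont: "continuous_on UNIV f"
    using der by (meson continuous_at_imp_continuous_on has_derivative_continuous)
  define g where "g = (\<lambda>n y. (f (y + (1 / real (Suc n)) *\<^sub>R e) - f y) * real (Suc n))"
  have [measurable]: "f \<in> borel_measurable borel"
    using cont by (rule borel_measurable_continuous_onI)
  have intf: "integrable lborel f"
  proof -
    have "integrable lborel (\<lambda>x. indicator (cball 0 r) x *\<^sub>R f x)"
      using borel_integrable_compact[of "cball 0 r" f] cont continuous_on_subset
      by (auto simp: set_integrable_def)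
    moreover have "(\<lambda>x. indicator (cball 0 r) x *\<^sub>R f x) = f"
      using supp by (fastforce simp: indicator_def)
    ultimately show ?thesis by simp
  qed
  have shift: "integrable lborel (\<lambda>y. f (y + c))" "(\<integral>y. f (y + c) \<partial>lborel) = (\<integral>y. f y \<partial>lborel)" for c
  proof -
    have d: "lborel = distr lborel borel (\<lambda>y. c + y)" by (simp add: lborel_distr_plus)
    show "integrable lborel (\<lambda>y. f (y + c))"
      using intf by (subst (asm) d) (simp add: integrable_distr_eq add.commute)
    show "(\<integral>y. f (y + c) \<partial>lborel) = (\<integral>y. f y \<partial>lborel)"
      by (subst (2) d) (simp add: integral_distr add.commute)
  qed
  have "(\<integral>y. g n y \<partial>lborel) = 0" for n
    unfolding g_def using shift intf by simp
  moreover have "(\<lambda>n. \<integral>y. g n y \<partial>lborel) \<longlonglongrightarrow> (\<integral>y. f' y e \<partial>lborel)"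
  proof (rule integral_dominated_convergence[where w = "\<lambda>y. C * indicator (cball 0 (r + norm e)) y"])
    show "integrable lborel (\<lambda>y::'a. C * indicator (cball 0 (r + norm e)) y)"
      using emeasure_lborel_cball_finite[of 0 "r + norm e"]
      by (intro integrable_mult_right integrable_real_indicator) auto
    have sc: "((\<lambda>t. f (y + t *\<^sub>R e)) has_derivative (\<lambda>t. f' (y + s *\<^sub>R e) (t *\<^sub>R e))) (at s within A)" for y s A
      by (rule has_derivative_compose[where f = "\<lambda>t. y + t *\<^sub>R e" and g = f, OF _ der])
         (auto intro!: derivative_eq_intros)
    have sc': "((\<lambda>t. f (y + t *\<^sub>R e)) has_real_derivative f' (y + s *\<^sub>R e) e) (at s within A)" for y s A
    proof -
      have "(\<lambda>t. f' (y + s *\<^sub>R e) (t *\<^sub>R e)) = (*) (f' (y + s *\<^sub>R e) e)"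
        using has_derivative_linear[OF der, of "y + s *\<^sub>R e"] by (auto simp: linear_scale mult.commute)
      then show ?thesis using sc[of y s A] by (simp add: has_field_derivative_def)
    qed
    show "AE y in lborel. (\<lambda>n. g n y) \<longlonglongrightarrow> f' y e"
    proof (rule AE_I2)
      fix y
      have "((\<lambda>h. (f (y + h *\<^sub>R e) - f y) / h) \<longlongrightarrow> f' y e) (at 0)"
        using sc'[of y 0 UNIV] by (simp add: DERIV_def)
      moreover have "filterlim (\<lambda>n. 1 / real (Suc n)) (at 0) sequentially"
        unfolding filterlim_at using LIMSEQ_inverse_real_of_nat by (simp add: inverse_eq_divide)
      ultimately have "(\<lambda>n. (f (y + (1 / real (Suc n)) *\<^sub>R e) - f y) / (1 / real (Suc n))) \<longlonglongrightarrow> f' y e"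
        by (rule filterlim_compose)
      then show "(\<lambda>n. g n y) \<longlonglongrightarrow> f' y e" by (simp add: g_def)
    qed
    show "AE y in lborel. norm (g n y) \<le> C * indicator (cball 0 (r + norm e)) y" for n
    proof (rule AE_I2)
      fix y
      let ?h = "1 / real (Suc n)"
      have h: "0 < ?h" "?h \<le> 1" by auto
      have C: "C \<ge> 0" using bd[of 0] by linarith
      have *: "norm (f (y + ?h *\<^sub>R e) - f (y + 0 *\<^sub>R e)) \<le> C * norm (?h - 0)"
        by (rule field_differentiable_bound[where S = UNIV, OF _ sc']) (auto simp: bd)
      have "norm (g n y) = norm (f (y + ?h *\<^sub>R e) - f y) * real (Suc n)"
        by (simp add: g_def abs_mult)
      also have "\<dots> \<le> C * ?h * real (Suc n)"
        using * by (intro mult_right_mono) auto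
      finally have 1: "norm (g n y) \<le> C" by simp
      show "norm (g n y) \<le> C * indicator (cball 0 (r + norm e)) y"
      proof (cases "norm y \<le> r + norm e")
        case False
        have "norm (?h *\<^sub>R e) \<le> norm e" using h by (simp add: mult_left_le_one_le field_simps)
        moreover have "norm y \<le> norm (y + ?h *\<^sub>R e) + norm (?h *\<^sub>R e)"
          by (metis add_diff_cancel norm_triangle_ineq4)
        ultimately have "norm (y + ?h *\<^sub>R e) > r" using False by linarith
        moreover have "norm y > r" using False by (smt (verit) norm_ge_zero)
        ultimately show ?thesis using supp C by (simp add: g_def)
      qed (use 1 in auto)
    qed
  qed (use meas in \<open>auto simp: g_def\<close>)
  ultimately show ?thesis
    by (simp add: LIMSEQ_const_iff)
qed

section \<open>The mean value property\<close>

text \<open>This weight is preferred to a constant one since \<open>ball_weight y *\<^sub>R y\<close> is the gradient of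
  the function \<open>- (ball_weight y)\<^sup>2 / 4\<close>, which is differentiable everywhere and vanishes
  outside the unit ball. So no boundary terms arise in integrations by parts.\<close>

definition ball_weight :: "real ^ 'n \<Rightarrow> real" where
  "ball_weight y = max 0 (1 - (norm y)\<^sup>2)"

definition ball_law :: "(real ^ 'n) measure" where
  "ball_law = density lborel (\<lambda>y. ennreal (ball_weight y / (\<integral>y. ball_weight (y :: real ^ 'n) \<partial>lborel)))"

lemma borel_measurable_ball_weight [measurable]: "ball_weight \<in> borel_measurable borel"
  unfolding ball_weight_def[abs_def] by measurable

lemma ball_weight_nonneg: "0 \<le> ball_weight y"
  and ball_weight_le_1: "ball_weight y \<le> 1"
  and ball_weight_eq_0: "norm y \<ge> 1 \<Longrightarrow> ball_weight y = 0"
  by (auto simp: ball_weight_def abs_square_le_1)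

lemma integrable_bounded_support:
  fixes f :: "'a::euclidean_space \<Rightarrow> 'b::{banach, second_countable_topology}"
  assumes [measurable]: "f \<in> borel_measurable borel"
    and "\<And>y. norm (f y) \<le> C" and "\<And>y. norm y > r \<Longrightarrow> f y = 0"
  shows "integrable lborel f"
proof (rule Bochner_Integration.integrable_bound)
  show "integrable lborel (\<lambda>y::'a. C * indicator (cball 0 r) y)"
    using emeasure_lborel_cball_finite[of 0 "r"]
    by (intro integrable_mult_right integrable_real_indicator) auto
  show "AE y in lborel. norm (f y) \<le> norm (C * indicator (cball 0 r) y)"
    using assms(2,3) order_trans[OF norm_ge_zero assms(2)]
    by (auto intro!: AE_I2 simp: indicator_def)
qed auto

lemma integrable_ball_weight: "integrable lborel (ball_weight :: real ^ 'n \<Rightarrow> real)"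
  by (rule integrable_bounded_support[where C = 1 and r = 1])
     (auto simp: ball_weight_nonneg ball_weight_le_1 ball_weight_eq_0)

lemma integral_ball_weight_pos: "0 < (\<integral>y. ball_weight (y :: real ^ 'n) \<partial>lborel)"
proof -
  have "0 < measure lborel (ball (0 :: real ^ 'n) (1/2)) * (3 / 4)"
    using content_ball_pos[of "1/2" "0 :: real ^ 'n"] by simp
  also have "\<dots> = (\<integral>y. (3 / 4) * indicator (ball (0 :: real ^ 'n) (1/2)) y \<partial>lborel)"
    by simp
  also have "\<dots> \<le> (\<integral>y. ball_weight (y :: real ^ 'n) \<partial>lborel)"
  proof (rule integral_mono)
    show "integrable lborel (\<lambda>y. (3 / 4) * indicator (ball (0 :: real ^ 'n) (1/2)) y :: real)"
      using emeasure_lborel_ball_finite[of "0 :: real ^ 'n" "1 / 2"]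
      by (intro integrable_mult_right integrable_real_indicator) auto
    fix y :: "real ^ 'n"
    show "(3 / 4) * indicator (ball 0 (1/2)) y \<le> ball_weight y"
      using power_mono[of "norm y" "1/2" 2]
      by (auto simp: ball_weight_def indicator_def power2_eq_square)
  qed (rule integrable_ball_weight)
  finally show ?thesis .
qed

lemma sets_ball_law [measurable_cong, simp]: "sets ball_law = sets borel"
  by (simp add: ball_law_def)

lemma space_ball_law [simp]: "space ball_law = UNIV"
  by (simp add: ball_law_def)

lemma prob_space_ball_law: "prob_space (ball_law :: (real ^ 'n) measure)"
proof
  let ?c = "\<integral>y. ball_weight (y :: real ^ 'n) \<partial>lborel"
  have "emeasure ball_law (space ball_law :: (real ^ 'n) set) = (\<integral>\<^sup>+ y. ennreal (ball_weight (y :: real ^ 'n) / ?c) \<partial>lborel)"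
    unfolding ball_law_def by (subst emeasure_density) auto
  also have "\<dots> = ennreal (\<integral>y. ball_weight (y :: real ^ 'n) / ?c \<partial>lborel)"
    using integral_ball_weight_pos[where 'n = 'n] integrable_ball_weight[where 'n = 'n]
    by (intro nn_integral_eq_integral) (auto simp: ball_weight_nonneg)
  also have "\<dots> = 1"
    using integral_ball_weight_pos[where 'n = 'n] by simp
  finally show "emeasure ball_law (space ball_law :: (real ^ 'n) set) = 1" .
qed

lemma AE_ball_law: "AE y in (ball_law :: (real ^ 'n) measure). norm y < 1"
  unfolding ball_law_def
  by (subst AE_density) (auto intro!: AE_I2 simp: ball_weight_eq_0 not_less[symmetric] elim: contrapos_pp)

lemma integral_ball_law:
  fixes f :: "real ^ 'n \<Rightarrow> real"
  assumes [measurable]: "f \<in> borel_measurable borel"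
  shows "(\<integral>y. f y \<partial>ball_law) = (\<integral>y. ball_weight y * f y \<partial>lborel) / (\<integral>y. ball_weight (y :: real ^ 'n) \<partial>lborel)"
  unfolding ball_law_def
  using integral_ball_weight_pos[where 'n = 'n]
  by (subst integral_density) (auto simp: ball_weight_nonneg)

lemma has_real_derivative_max_0_square:
  "((\<lambda>s. (max 0 s)\<^sup>2) has_real_derivative 2 * max 0 s) (at (s :: real))"
proof -
  consider "s > 0" | "s < 0" | "s = 0" by linarith
  then show ?thesis
  proof cases
    case 1
    have "((\<lambda>s. s\<^sup>2) has_real_derivative 2 * max 0 s) (at s)"
      using 1 by (auto intro!: derivative_eq_intros)
    then show ?thesis
      by (rule DERIV_cong_ev[THEN iffD1, rotated -1])
         (use 1 eventually_nhds_in_open[of "{0<..}" s] in \<open>auto elim!: eventually_mono\<close>)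
  next
    case 2
    have "((\<lambda>s. 0) has_real_derivative 2 * max 0 s) (at s)"
      using 2 by (auto intro!: derivative_eq_intros)
    then show ?thesis
      by (rule DERIV_cong_ev[THEN iffD1, rotated -1])
         (use 2 eventually_nhds_in_open[of "{..<0}" s] in \<open>auto elim!: eventually_mono\<close>)
  next
    case 3
    have "((\<lambda>h. (max 0 h)\<^sup>2 / h) \<longlongrightarrow> 0) (at (0 :: real))"
    proof (rule tendsto_0_le[where K = 1])
      show "((\<lambda>h::real. h) \<longlongrightarrow> 0) (at 0)" by simp
      show "\<forall>\<^sub>F h in at (0::real). norm ((max 0 h)\<^sup>2 / h) \<le> norm h * 1"
        by (auto intro!: always_eventually simp: max_def power2_eq_square)
    qed
    then show ?thesis using 3 by (simp add: DERIV_def)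
  qed
qed

lemma has_derivative_ball_weight_square:
  fixes y :: "real ^ 'n"
  shows "((\<lambda>y. - (ball_weight y)\<^sup>2 / 4) has_derivative (\<lambda>h. ball_weight y * (y \<bullet> h))) (at y)"
proof -
  have "((\<lambda>y. 1 - (norm y)\<^sup>2) has_derivative (\<lambda>h. - 2 * (y \<bullet> h))) (at y)"
    unfolding power2_norm_eq_inner
    by (auto intro!: derivative_eq_intros simp: inner_commute)
  from DERIV_compose_FDERIV[OF has_real_derivative_max_0_square this]
  have "((\<lambda>y. (ball_weight y)\<^sup>2) has_derivative (\<lambda>h. (- 2 * (y \<bullet> h)) * (2 * ball_weight y))) (at y)"
    by (simp add: ball_weight_def[abs_def])
  then have "((\<lambda>y. (-1/4) * (ball_weight y)\<^sup>2) has_derivative (\<lambda>h. (-1/4) * ((- 2 * (y \<bullet> h)) * (2 * ball_weight y)))) (at y)"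
    by (rule has_derivative_mult_right)
  then show ?thesis by (simp add: mult_ac)
qed

lemma borel_measurable_vec_component [measurable (raw)]:
  fixes f :: "'a \<Rightarrow> 'b::real_normed_vector ^ 'n"
  shows "f \<in> borel_measurable M \<Longrightarrow> (\<lambda>x. f x $ i) \<in> borel_measurable M"
  by (erule measurable_compose) (intro borel_measurable_continuous_onI continuous_intros)

lemma borel_measurable_if_open:
  fixes f :: "'a::topological_space \<Rightarrow> 'b::{real_normed_vector}"
  assumes "A \<in> sets borel" "continuous_on A f"
  shows "(\<lambda>x. if x \<in> A then f x else 0) \<in> borel_measurable borel"
proof -
  have "(\<lambda>x. indicator A x *\<^sub>R f x) \<in> borel_measurable borel"
    using assms by (intro borel_measurable_continuous_on_indicator) 
  moreover have "(\<lambda>x. indicator A x *\<^sub>R f x) = (\<lambda>x. if x \<in> A then f x else 0)"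
    by (auto simp: indicator_def)
  ultimately show ?thesis by simp
qed

text \<open>Let \<open>W = - ball_weight\<^sup>2 / 4\<close>. The partial derivative of \<open>g\<^sub>i (x + t y) W(y)\<close> in the
  \<open>i\<close>-th direction has integral 0. In the sum over \<open>i\<close> the terms with \<open>W\<close> combine to a multiple
  of the Laplacian, and the terms with the gradient of \<open>W\<close> are the integrand of the claim.\<close>

lemma harmonic_radial_derivative_eq_0:
  fixes g :: "real ^ 'n \<Rightarrow> real ^ 'n" and H :: "real ^ 'n \<Rightarrow> real ^ 'n ^ 'n"
  assumes "open \<Omega>" and sub: "cball x r \<subseteq> \<Omega>" and t: "\<bar>t\<bar> \<le> r"
    and dg: "\<And>x. x \<in> \<Omega> \<Longrightarrow> (g has_derivative (\<lambda>h. H x *v h)) (at x)"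
    and cH: "continuous_on \<Omega> H" and tr: "\<And>x. x \<in> \<Omega> \<Longrightarrow> trace (H x) = 0"
  shows "(\<integral>y. (if x + t *\<^sub>R y \<in> \<Omega> then g (x + t *\<^sub>R y) else 0) \<bullet> y \<partial>ball_law) = 0"
proof -
  have cg: "continuous_on \<Omega> g"
    using dg by (meson continuous_at_imp_continuous_on has_derivative_continuous)
  define gv where "gv = (\<lambda>x. if x \<in> \<Omega> then g x else 0)"
  define Hv where "Hv = (\<lambda>x. if x \<in> \<Omega> then H x else 0)"
  have [measurable]: "gv \<in> borel_measurable borel" "Hv \<in> borel_measurable borel"
    unfolding gv_def Hv_def using \<open>open \<Omega>\<close> cg cH by (auto intro!: borel_measurable_if_open)
  have inO: "x + t *\<^sub>R y \<in> cball x r" if "norm y \<le> 1" for y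
  proof -
    have "\<bar>t\<bar> * norm y \<le> r * 1" using t that by (intro mult_mono) auto
    then show ?thesis by (simp add: dist_norm)
  qed
  define W where "W = (\<lambda>y :: real ^ 'n. - (ball_weight y)\<^sup>2 / 4)"
  have [measurable]: "W \<in> borel_measurable borel" unfolding W_def by measurable
  have W0: "W y = 0" if "norm y \<ge> 1" for y using that by (simp add: W_def ball_weight_eq_0)
  have W1: "\<bar>W y\<bar> \<le> 1" for y
    using power_mono[OF ball_weight_le_1 ball_weight_nonneg, of y 2] by (simp add: W_def)
  define f where "f = (\<lambda>i y. gv (x + t *\<^sub>R y) $ i * W y)"
  define f' where "f' = (\<lambda>i y h. (Hv (x + t *\<^sub>R y) *v (t *\<^sub>R h)) $ i * W y + gv (x + t *\<^sub>R y) $ i * (ball_weight y * (y \<bullet> h)))"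
  define e where "e = (\<lambda>i::'n. axis i (1::real))"
  have f'e: "f' i y (e i) = t * (Hv (x + t *\<^sub>R y) $ i $ i) * W y + gv (x + t *\<^sub>R y) $ i * ball_weight y * (y $ i)" for i y
    by (simp add: f'_def e_def matrix_vector_mult_basis column_def matrix_vector_mult_scaleR inner_axis)
  obtain G where G: "\<And>z. z \<in> cball x r \<Longrightarrow> norm (gv z) \<le> G"
  proof -
    have "bounded (g ` cball x r)"
      using cg sub by (intro compact_imp_bounded compact_continuous_image) (auto intro: continuous_on_subset)
    then show ?thesis using that sub by (force simp: bounded_iff gv_def)
  qed
  obtain K where K: "\<And>z. z \<in> cball x r \<Longrightarrow> norm (Hv z) \<le> K"
  proof -
    have "bounded (H ` cball x r)"
      using cH sub by (intro compact_imp_bounded compact_continuous_image) (auto intro: continuous_on_subset)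
    then show ?thesis using that sub by (force simp: bounded_iff Hv_def)
  qed
  have bnd: "\<bar>f' i y (e i)\<bar> \<le> r * K + G" for i y
  proof (cases "norm y \<le> 1")
    case True
    have xr: "x + t *\<^sub>R y \<in> cball x r" by (rule inO[OF True])
    have "\<bar>Hv (x + t *\<^sub>R y) $ i $ i\<bar> \<le> norm (Hv (x + t *\<^sub>R y))"
      by (meson component_le_norm_cart Finite_Cartesian_Product.norm_nth_le order_trans)
    then have h: "\<bar>Hv (x + t *\<^sub>R y) $ i $ i\<bar> \<le> K" using K[OF xr] by linarith
    have g: "\<bar>gv (x + t *\<^sub>R y) $ i\<bar> \<le> G"
      using G[OF xr] component_le_norm_cart order_trans by blast
    have y: "\<bar>y $ i\<bar> \<le> 1" using True component_le_norm_cart order_trans by blast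
    have "\<bar>t * (Hv (x + t *\<^sub>R y) $ i $ i) * W y\<bar> \<le> r * K * 1"
      unfolding abs_mult using t h W1[of y] by (intro mult_mono) auto
    moreover have "\<bar>gv (x + t *\<^sub>R y) $ i * ball_weight y * (y $ i)\<bar> \<le> G * 1 * 1"
      unfolding abs_mult using g y ball_weight_le_1[of y] ball_weight_nonneg[of y] by (intro mult_mono) auto
    ultimately show ?thesis unfolding f'e by linarith
  next
    case False
    have "x \<in> cball x r" using t by simp
    then have "G \<ge> 0" "K \<ge> 0" using G K norm_ge_zero order_trans by blast+
    then show ?thesis using False t by (simp add: f'e W0 ball_weight_eq_0)
  qed
  have der: "(f i has_derivative f' i y) (at y)" for i y
  proof (cases "norm y \<le> 1")
    case True
    have xO: "x + t *\<^sub>R y \<in> \<Omega>" using inO[OF True] sub by auto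
    have "(gv has_derivative (\<lambda>h. H (x + t *\<^sub>R y) *v h)) (at (x + t *\<^sub>R y))"
      by (rule has_derivative_transform_within_open[OF dg[OF xO] \<open>open \<Omega>\<close> xO]) (simp add: gv_def)
    moreover have "((\<lambda>y. x + t *\<^sub>R y) has_derivative (\<lambda>h. t *\<^sub>R h)) (at y)"
      by (auto intro!: derivative_eq_intros)
    ultimately have "((\<lambda>y. gv (x + t *\<^sub>R y)) has_derivative (\<lambda>h. H (x + t *\<^sub>R y) *v (t *\<^sub>R h))) (at y)"
      using has_derivative_compose by blast
    then have "((\<lambda>y. gv (x + t *\<^sub>R y) $ i) has_derivative (\<lambda>h. (H (x + t *\<^sub>R y) *v (t *\<^sub>R h)) $ i)) (at y)"
      by (rule bounded_linear.has_derivative[OF bounded_linear_vec_nth])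
    from has_derivative_mult[OF this has_derivative_ball_weight_square]
    have "((\<lambda>y. gv (x + t *\<^sub>R y) $ i * W y) has_derivative
        (\<lambda>h. gv (x + t *\<^sub>R y) $ i * (ball_weight y * (y \<bullet> h)) + (H (x + t *\<^sub>R y) *v (t *\<^sub>R h)) $ i * W y)) (at y)"
      by (simp add: W_def)
    then show ?thesis using xO by (simp add: f_def f'_def Hv_def add.commute)
  next
    case False
    have "((\<lambda>_. 0) has_derivative (\<lambda>_. 0 :: real)) (at y)" by simp
    then have "(f i has_derivative (\<lambda>_. 0)) (at y)"
      by (rule has_derivative_transform_within_open[OF _ open_Compl[OF closed_cball[of 0 1]]])
         (use False in \<open>auto simp: f_def W0\<close>)
    moreover have "f' i y = (\<lambda>_. 0)" using False by (auto simp: f'_def W0 ball_weight_eq_0)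
    ultimately show ?thesis by simp
  qed
  have meas: "(\<lambda>y. f' i y (e i)) \<in> borel_measurable borel" for i
    unfolding f'e by measurable
  have "(\<integral>y. f' i y (e i) \<partial>lborel) = 0" for i
    by (rule integral_partial_derivative_eq_0[OF der bnd, where r = 1])
       (use meas in \<open>auto simp: f_def W0\<close>)
  moreover have "integrable lborel (\<lambda>y. f' i y (e i))" for i
    by (rule integrable_bounded_support[where C = "r * K + G" and r = 1])
       (use meas bnd in \<open>auto simp: f'e W0 ball_weight_eq_0\<close>)
  ultimately have "(\<integral>y. (\<Sum>i\<in>UNIV. f' i y (e i)) \<partial>lborel) = 0"
    by (subst Bochner_Integration.integral_sum) auto
  moreover have "(\<Sum>i\<in>UNIV. f' i y (e i)) = ball_weight y * (gv (x + t *\<^sub>R y) \<bullet> y)" for y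
  proof -
    have "(\<Sum>i\<in>UNIV. f' i y (e i)) = t * trace (Hv (x + t *\<^sub>R y)) * W y + ball_weight y * (gv (x + t *\<^sub>R y) \<bullet> y)"
      unfolding f'e sum.distrib trace_def inner_vec_def
      by (simp add: sum_distrib_left sum_distrib_right mult_ac)
    moreover have "trace (Hv (x + t *\<^sub>R y)) = 0"
      using tr by (auto simp: Hv_def trace_def)
    ultimately show ?thesis by simp
  qed
  ultimately have "(\<integral>y. ball_weight y * (gv (x + t *\<^sub>R y) \<bullet> y) \<partial>lborel) = 0" by simp
  moreover have "(\<lambda>y. gv (x + t *\<^sub>R y) \<bullet> y) \<in> borel_measurable borel" by measurable
  ultimately show ?thesis
    by (subst integral_ball_law) (auto simp: gv_def)
qed

text \<open>The average does not depend on the radius, since its derivative is the integral that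
  vanishes by the preceding lemma; at radius 0 it is \<open>u x\<close>.\<close>

lemma harmonic_mean_value:
  fixes \<Omega> :: "(real ^ 'n) set"
  assumes "open \<Omega>" and "harmonic_on \<Omega> u" and r': "cball x r' \<subseteq> \<Omega>" "r < r'" and "0 \<le> r"
  shows "(\<integral>y. (if x + r *\<^sub>R y \<in> \<Omega> then u (x + r *\<^sub>R y) else 0) \<partial>ball_law) = u x"
proof -
  interpret B: prob_space "ball_law :: (real ^ 'n) measure" by (rule prob_space_ball_law)
  obtain g H where du: "\<And>x. x \<in> \<Omega> \<Longrightarrow> (u has_derivative (\<lambda>h. g x \<bullet> h)) (at x)"
    and dg: "\<And>x. x \<in> \<Omega> \<Longrightarrow> (g has_derivative (\<lambda>h. H x *v h)) (at x)"
    and cH: "continuous_on \<Omega> H" and tr: "\<And>x. x \<in> \<Omega> \<Longrightarrow> trace (H x) = 0"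
    using assms(2) unfolding harmonic_on_def by blast
  have cg: "continuous_on \<Omega> g"
    using dg by (meson continuous_at_imp_continuous_on has_derivative_continuous)
  have cu: "continuous_on \<Omega> u"
    using du by (meson continuous_at_imp_continuous_on has_derivative_continuous)
  define gv where "gv = (\<lambda>x. if x \<in> \<Omega> then g x else 0)"
  define uv where "uv = (\<lambda>x. if x \<in> \<Omega> then u x else 0)"
  have [measurable]: "gv \<in> borel_measurable borel" "uv \<in> borel_measurable borel"
    unfolding gv_def uv_def using \<open>open \<Omega>\<close> cg cu by (auto intro!: borel_measurable_if_open)
  define \<phi> where "\<phi> = (\<lambda>t. \<integral>y. uv (x + t *\<^sub>R y) \<partial>ball_law)"
  obtain G where G: "\<And>z. z \<in> cball x r' \<Longrightarrow> norm (gv z) \<le> G"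
  proof -
    have "bounded (g ` cball x r')"
      using cg r' by (intro compact_imp_bounded compact_continuous_image) (auto intro: continuous_on_subset)
    then show ?thesis using that r' by (force simp: bounded_iff gv_def)
  qed
  obtain K where K: "\<And>z. z \<in> cball x r' \<Longrightarrow> norm (uv z) \<le> K"
  proof -
    have "bounded (u ` cball x r')"
      using cu r' by (intro compact_imp_bounded compact_continuous_image) (auto intro: continuous_on_subset)
    then show ?thesis using that r' by (force simp: bounded_iff uv_def)
  qed
  have inO: "x + t *\<^sub>R y \<in> cball x r'" if "norm y < 1" "\<bar>t\<bar> < r'" for y t
  proof -
    have "\<bar>t\<bar> * norm y \<le> r' * 1" using that by (intro mult_mono) auto
    then show ?thesis by (simp add: dist_norm)
  qed
  have d0: "(\<phi> has_real_derivative 0) (at t)" if t: "\<bar>t\<bar> < r'" for t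
  proof -
    have "(\<phi> has_derivative (\<lambda>h. \<integral>y. h * (gv (x + t *\<^sub>R y) \<bullet> y) \<partial>ball_law)) (at t)"
      unfolding \<phi>_def
    proof (rule has_derivative_integral[where e = "r' - \<bar>t\<bar>" and C = G and f' = "\<lambda>t y h. h * (gv (x + t *\<^sub>R y) \<bullet> y)"])
      fix s assume "dist s t < r' - \<bar>t\<bar>"
      then have s: "\<bar>s\<bar> < r'" by (auto simp: dist_real_def)
      show "integrable ball_law (\<lambda>y. uv (x + s *\<^sub>R y))"
      proof (rule B.integrable_const_bound[where B = K])
        show "AE y in ball_law. norm (uv (x + s *\<^sub>R y)) \<le> K"
          using AE_ball_law by eventually_elim (rule K[OF inO[OF _ s]])
      qed simp
    next
      show "AE y in ball_law. \<forall>s. dist s t < r' - \<bar>t\<bar> \<longrightarrow>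
          ((\<lambda>s. uv (x + s *\<^sub>R y)) has_derivative (\<lambda>h. h * (gv (x + s *\<^sub>R y) \<bullet> y))) (at s) \<and>
          (\<forall>h. norm (h * (gv (x + s *\<^sub>R y) \<bullet> y)) \<le> G * norm h)"
        using AE_ball_law
      proof (eventually_elim, intro allI impI conjI)
        fix y :: "real ^ 'n" and s :: real assume y: "norm y < 1" and "dist s t < r' - \<bar>t\<bar>"
        then have s: "\<bar>s\<bar> < r'" by (auto simp: dist_real_def)
        note xr = inO[OF y s]
        then have xO: "x + s *\<^sub>R y \<in> \<Omega>" using r' by auto
        have "(uv has_derivative (\<lambda>h. g (x + s *\<^sub>R y) \<bullet> h)) (at (x + s *\<^sub>R y))"
          by (rule has_derivative_transform_within_open[OF du[OF xO] \<open>open \<Omega>\<close> xO]) (simp add: uv_def)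
        moreover have "((\<lambda>s. x + s *\<^sub>R y) has_derivative (\<lambda>h. h *\<^sub>R y)) (at s)"
          by (auto intro!: derivative_eq_intros)
        ultimately have "((\<lambda>s. uv (x + s *\<^sub>R y)) has_derivative (\<lambda>h. g (x + s *\<^sub>R y) \<bullet> (h *\<^sub>R y))) (at s)"
          using has_derivative_compose by blast
        then show "((\<lambda>s. uv (x + s *\<^sub>R y)) has_derivative (\<lambda>h. h * (gv (x + s *\<^sub>R y) \<bullet> y))) (at s)"
          using xO by (simp add: gv_def)
        fix h
        have "\<bar>gv (x + s *\<^sub>R y) \<bullet> y\<bar> \<le> norm (gv (x + s *\<^sub>R y)) * norm y"
          by (rule Cauchy_Schwarz_ineq2)
        also have "\<dots> \<le> G * 1"
          using G[OF xr] y by (intro mult_mono) (auto intro: order_trans[OF norm_ge_zero])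
        finally show "norm (h * (gv (x + s *\<^sub>R y) \<bullet> y)) \<le> G * norm h"
          using mult_left_mono[of "\<bar>gv (x + s *\<^sub>R y) \<bullet> y\<bar>" G "\<bar>h\<bar>"] by (simp add: abs_mult mult.commute[of G])
      qed
    qed (use t B.finite_measure_axioms in auto)
    moreover have "(\<integral>y. gv (x + t *\<^sub>R y) \<bullet> y \<partial>ball_law) = 0"
      unfolding gv_def using harmonic_radial_derivative_eq_0[OF \<open>open \<Omega>\<close> r'(1) _ dg cH tr, of t] t by simp
    ultimately show ?thesis
      by (simp add: has_field_derivative_def lambda_zero)
  qed
  have d: "(\<phi> has_field_derivative 0) (at t within {-r'<..<r'})" if "t \<in> {-r'<..<r'}" for t
    by (rule has_field_derivative_at_within[OF d0]) (use that in auto)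
  obtain c where c: "\<phi> t = c" if "t \<in> {-r'<..<r'}" for t
    using has_field_derivative_zero_constant[OF convex_real_interval(8) d] by blast
  have "\<phi> r = \<phi> 0" using c[of r] c[of 0] r' \<open>0 \<le> r\<close> by simp
  also have "\<phi> 0 = uv x" using B.prob_space by (simp add: \<phi>_def)
  also have "\<dots> = u x"
  proof -
    have "x \<in> \<Omega>" using r' \<open>0 \<le> r\<close> by (intro subsetD[OF r'(1)]) simp
    then show ?thesis by (simp add: uv_def)
  qed
  finally show ?thesis by (simp add: \<phi>_def uv_def)
qed

section \<open>Existence of harmonic measure\<close>

lemma ball_infdist_frontier_subset:
  fixes \<Omega> :: "'a::real_normed_vector set"
  assumes "y \<in> \<Omega>"
  shows "ball y (infdist y (frontier \<Omega>)) \<subseteq> \<Omega>"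
proof (rule ccontr)
  let ?B = "ball y (infdist y (frontier \<Omega>))"
  assume n: "\<not> ?B \<subseteq> \<Omega>"
  then have "?B \<noteq> {}" by blast
  then have "y \<in> ?B" by simp
  then have "y \<in> ?B \<inter> \<Omega>" using assms by auto
  then have "?B \<inter> frontier \<Omega> \<noteq> {}"
    using n connected_Int_frontier[OF connected_ball] by blast
  then obtain w where "w \<in> frontier \<Omega>" "dist y w < infdist y (frontier \<Omega>)" by auto
  then show False using infdist_le[of w "frontier \<Omega>" y] by linarith
qed

lemma frontier_nonempty_bounded:
  fixes \<Omega> :: "(real ^ 'n) set"
  assumes "bounded \<Omega>" "\<Omega> \<noteq> {}"
  shows "frontier \<Omega> \<noteq> {}"
  using assms frontier_eq_empty not_bounded_UNIV by blast

lemma (in prob_space) integral_stream_space: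
  fixes f :: "'a stream \<Rightarrow> real"
  assumes [measurable]: "f \<in> borel_measurable (stream_space M)" and bd: "\<And>\<omega>. \<bar>f \<omega>\<bar> \<le> K"
  shows "(\<integral>\<omega>. f \<omega> \<partial>stream_space M) = (\<integral>x. (\<integral>\<omega>. f (x ## \<omega>) \<partial>stream_space M) \<partial>M)"
proof -
  interpret S: prob_space "stream_space M" by (rule prob_space_stream_space)
  interpret P: pair_prob_space M "stream_space M" ..
  have d: "distr (M \<Otimes>\<^sub>M stream_space M) (stream_space M) (\<lambda>(x, \<omega>). x ## \<omega>) = stream_space M"
  proof (rule measure_eqI)
    fix A assume "A \<in> sets (distr (M \<Otimes>\<^sub>M stream_space M) (stream_space M) (\<lambda>(x, \<omega>). x ## \<omega>))"
    then have [measurable]: "A \<in> sets (stream_space M)" by simp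
    have "emeasure (distr (M \<Otimes>\<^sub>M stream_space M) (stream_space M) (\<lambda>(x, \<omega>). x ## \<omega>)) A =
      (\<integral>\<^sup>+ \<omega>. indicator A \<omega> \<partial>distr (M \<Otimes>\<^sub>M stream_space M) (stream_space M) (\<lambda>(x, \<omega>). x ## \<omega>))"
      by (subst nn_integral_indicator) auto
    also have "\<dots> = (\<integral>\<^sup>+ p. indicator A (fst p ## snd p) \<partial>(M \<Otimes>\<^sub>M stream_space M))"
      by (subst nn_integral_distr) (auto simp: split_beta')
    also have "\<dots> = (\<integral>\<^sup>+ x. \<integral>\<^sup>+ \<omega>. indicator A (x ## \<omega>) \<partial>stream_space M \<partial>M)"
      by (subst S.nn_integral_fst[symmetric]) auto
    also have "\<dots> = (\<integral>\<^sup>+ \<omega>. indicator A \<omega> \<partial>stream_space M)"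
      by (subst nn_integral_stream_space) auto
    also have "\<dots> = emeasure (stream_space M) A" by simp
    finally show "emeasure (distr (M \<Otimes>\<^sub>M stream_space M) (stream_space M) (\<lambda>(x, \<omega>). x ## \<omega>)) A = emeasure (stream_space M) A" .
  qed simp
  have "(\<integral>\<omega>. f \<omega> \<partial>stream_space M) = (\<integral>p. f (fst p ## snd p) \<partial>(M \<Otimes>\<^sub>M stream_space M))"
    by (subst d[symmetric], subst integral_distr) (auto simp: split_beta')
  also have "\<dots> = (\<integral>x. (\<integral>\<omega>. f (x ## \<omega>) \<partial>stream_space M) \<partial>M)"
    by (subst P.integral_fst'[symmetric]) (auto intro!: P.P.integrable_const_bound[where B = K] bd)
  finally show ?thesis .
qed

text \<open>The jump is \<open>z\<close> times half the distance to the boundary. Points \<open>z\<close> outside the unit ball,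
  a null set for the law of \<open>z\<close>, are replaced by 0, so that the walk cannot leave \<open>\<Omega>\<close> on any
  sample path.\<close>

definition walk_step :: "(real ^ 'n) set \<Rightarrow> real ^ 'n \<Rightarrow> real ^ 'n \<Rightarrow> real ^ 'n" where
  "walk_step \<Omega> y z = y + (infdist y (frontier \<Omega>) / 2) *\<^sub>R (if norm z < 1 then z else 0)"

text \<open>The first entry of the stream is used for the first jump. Statements on \<open>Suc n\<close> steps then
  follow by integrating over the first jump.\<close>

primrec walk :: "(real ^ 'n) set \<Rightarrow> nat \<Rightarrow> real ^ 'n \<Rightarrow> (real ^ 'n) stream \<Rightarrow> real ^ 'n" where
  "walk \<Omega> 0 y \<omega> = y"
| "walk \<Omega> (Suc n) y \<omega> = walk \<Omega> n (walk_step \<Omega> y (shd \<omega>)) (stl \<omega>)"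

abbreviation walk_space :: "(real ^ 'n) stream measure" where
  "walk_space \<equiv> stream_space ball_law"

lemma borel_measurable_infdist_compose [measurable (raw)]:
  "f \<in> borel_measurable M \<Longrightarrow> (\<lambda>x. infdist (f x) A) \<in> borel_measurable M"
  by (erule measurable_compose) (intro borel_measurable_continuous_onI continuous_intros)

lemma measurable_walk_step [measurable (raw)]:
  assumes [measurable]: "f \<in> borel_measurable M" "g \<in> borel_measurable M"
  shows "(\<lambda>x. walk_step \<Omega> (f x) (g x)) \<in> borel_measurable M"
  unfolding walk_step_def by measurable

lemma measurable_walk [measurable (raw)]:
  "f \<in> borel_measurable M \<Longrightarrow> g \<in> measurable M walk_space \<Longrightarrow> (\<lambda>x. walk \<Omega> n (f x) (g x)) \<in> borel_measurable M"
proof (induction n arbitrary: f g)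
  case (Suc n)
  note [measurable] = Suc.prems
  have "(\<lambda>x. walk_step \<Omega> (f x) (shd (g x))) \<in> borel_measurable M"
  proof (rule measurable_walk_step)
    have "(\<lambda>x. shd (g x)) \<in> measurable M ball_law" by measurable
    then show "(\<lambda>x. shd (g x)) \<in> borel_measurable M" by (simp cong: measurable_cong_sets)
  qed fact
  moreover have "(\<lambda>x. stl (g x)) \<in> measurable M walk_space" by measurable
  ultimately show ?case by (simp add: Suc.IH)
qed simp

context
  fixes \<Omega> :: "(real ^ 'n) set"
  assumes open_\<Omega>: "open \<Omega>" and bounded_\<Omega>: "bounded \<Omega>"
begin

lemma infdist_frontier_pos:
  assumes "y \<in> \<Omega>"
  shows "0 < infdist y (frontier \<Omega>)"
proof -
  have "y \<notin> frontier \<Omega>" using assms open_\<Omega> by (simp add: frontier_def interior_open)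
  then show ?thesis
    using assms infdist_pos_not_in_closed[of "frontier \<Omega>" y] frontier_nonempty_bounded[OF bounded_\<Omega>] by auto
qed

lemma walk_step_in: "y \<in> \<Omega> \<Longrightarrow> walk_step \<Omega> y z \<in> \<Omega>"
proof -
  assume y: "y \<in> \<Omega>"
  have "norm ((infdist y (frontier \<Omega>) / 2) *\<^sub>R (if norm z < 1 then z else 0)) \<le> infdist y (frontier \<Omega>) / 2 * 1"
    unfolding norm_scaleR using infdist_frontier_pos[OF y] by (intro mult_mono) auto
  then have "walk_step \<Omega> y z \<in> ball y (infdist y (frontier \<Omega>))"
    using infdist_frontier_pos[OF y] by (simp add: walk_step_def dist_norm)
  then show ?thesis using ball_infdist_frontier_subset[OF y] by auto
qed

lemma walk_in: "y \<in> \<Omega> \<Longrightarrow> walk \<Omega> n y \<omega> \<in> \<Omega>"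
  by (induction n arbitrary: y \<omega>) (auto simp: walk_step_in)

lemma integral_walk_harmonic:
  assumes u: "harmonic_on \<Omega> u" and [measurable]: "v \<in> borel_measurable borel"
    and bd: "\<And>x. \<bar>v x\<bar> \<le> K" and uv: "\<And>x. x \<in> \<Omega> \<Longrightarrow> v x = u x"
    and "y \<in> \<Omega>"
  shows "(\<integral>\<omega>. v (walk \<Omega> n y \<omega>) \<partial>walk_space) = u y"
  using \<open>y \<in> \<Omega>\<close>
proof (induction n arbitrary: y)
  case 0
  interpret B: prob_space "ball_law :: (real ^ 'n) measure" by (rule prob_space_ball_law)
  interpret S: prob_space "walk_space :: (real ^ 'n) stream measure" by (rule B.prob_space_stream_space)
  show ?case using 0 by (simp add: uv S.prob_space)
next
  case (Suc n)
  interpret B: prob_space "ball_law :: (real ^ 'n) measure" by (rule prob_space_ball_law)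
  let ?r = "infdist y (frontier \<Omega>)"
  note r = infdist_frontier_pos[OF \<open>y \<in> \<Omega>\<close>]
  have "(\<integral>\<omega>. v (walk \<Omega> (Suc n) y \<omega>) \<partial>walk_space) =
      (\<integral>z. (\<integral>\<omega>. v (walk \<Omega> (Suc n) y (z ## \<omega>)) \<partial>walk_space) \<partial>ball_law)"
    by (rule B.integral_stream_space[where K = K]) (auto intro: bd)
  also have "\<dots> = (\<integral>z. v (walk_step \<Omega> y z) \<partial>ball_law)"
    by (simp add: Suc.IH walk_step_in Suc.prems uv)
  also have "\<dots> = (\<integral>z. (if y + (?r / 2) *\<^sub>R z \<in> \<Omega> then u (y + (?r / 2) *\<^sub>R z) else 0) \<partial>ball_law)"
  proof (rule integral_cong_AE)
    show "(\<lambda>z. if y + (?r / 2) *\<^sub>R z \<in> \<Omega> then u (y + (?r / 2) *\<^sub>R z) else 0) \<in> borel_measurable ball_law"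
    proof -
      have [measurable]: "\<Omega> \<in> sets borel" using open_\<Omega> by auto
      have "(\<lambda>z. if y + (?r / 2) *\<^sub>R z \<in> \<Omega> then v (y + (?r / 2) *\<^sub>R z) else 0) \<in> borel_measurable ball_law"
        by measurable
      then show ?thesis by (simp add: uv cong: if_cong)
    qed
    show "AE z in ball_law. v (walk_step \<Omega> y z) = (if y + (?r / 2) *\<^sub>R z \<in> \<Omega> then u (y + (?r / 2) *\<^sub>R z) else 0)"
      using AE_ball_law
    proof eventually_elim
      case (elim z)
      then have "walk_step \<Omega> y z = y + (?r / 2) *\<^sub>R z" by (simp add: walk_step_def)
      then show ?case using walk_step_in[OF \<open>y \<in> \<Omega>\<close>, of z] by (simp add: uv)
    qed
  qed measurable
  also have "\<dots> = u y"
  proof (rule harmonic_mean_value[OF open_\<Omega> u, where r' = "?r * (3/4)"])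
    have "cball y (?r * (3/4)) \<subseteq> ball y ?r" using r by auto
    then show "cball y (?r * (3/4)) \<subseteq> \<Omega>" using ball_infdist_frontier_subset[OF \<open>y \<in> \<Omega>\<close>] by blast
  qed (use r in auto)
  finally show ?case .
qed

lemma nn_integral_walk_Markov:
  assumes [measurable]: "case_prod f \<in> borel_measurable (borel \<Otimes>\<^sub>M borel)"
  shows "(\<integral>\<^sup>+\<omega>. f (walk \<Omega> n y \<omega>) (walk \<Omega> (n + m) y \<omega>) \<partial>walk_space) =
    (\<integral>\<^sup>+\<omega>. (\<integral>\<^sup>+\<omega>'. f (walk \<Omega> n y \<omega>) (walk \<Omega> m (walk \<Omega> n y \<omega>) \<omega>') \<partial>walk_space) \<partial>walk_space)"
proof (induction n arbitrary: y)
  case 0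
  interpret B: prob_space "ball_law :: (real ^ 'n) measure" by (rule prob_space_ball_law)
  interpret S: prob_space "walk_space :: (real ^ 'n) stream measure" by (rule B.prob_space_stream_space)
  show ?case by (simp add: S.emeasure_space_1)
next
  case (Suc n)
  interpret B: prob_space "ball_law :: (real ^ 'n) measure" by (rule prob_space_ball_law)
  interpret S: prob_space "walk_space :: (real ^ 'n) stream measure" by (rule B.prob_space_stream_space)
  show ?case
    by (subst (1 2) B.nn_integral_stream_space) (auto simp: Suc.IH)
qed

text \<open>Linear functions are harmonic, so the expectation of the walk is its starting point and
  the mixed term of the square vanishes.\<close>

lemma nn_integral_walk_sq:
  assumes y: "y \<in> \<Omega>"
  shows "(\<integral>\<^sup>+\<omega>. ennreal ((norm (walk \<Omega> m y \<omega>))\<^sup>2) \<partial>walk_space) =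
    ennreal ((norm y)\<^sup>2) + (\<integral>\<^sup>+\<omega>. ennreal ((norm (walk \<Omega> m y \<omega> - y))\<^sup>2) \<partial>walk_space)"
proof -
  interpret B: prob_space "ball_law :: (real ^ 'n) measure" by (rule prob_space_ball_law)
  interpret S: prob_space "walk_space :: (real ^ 'n) stream measure" by (rule B.prob_space_stream_space)
  obtain b where b: "\<And>x. x \<in> \<Omega> \<Longrightarrow> norm x \<le> b"
    using bounded_\<Omega> by (auto simp: bounded_iff)
  have [measurable]: "\<Omega> \<in> sets borel" using open_\<Omega> by auto
  let ?X = "walk \<Omega> m y"
  have iX: "integrable walk_space ?X"
    by (rule S.integrable_const_bound[where B = b]) (auto intro!: b walk_in y)
  have iX2: "integrable walk_space (\<lambda>\<omega>. (norm (?X \<omega>))\<^sup>2)"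
    by (rule S.integrable_const_bound[where B = "b\<^sup>2"]) (auto intro!: AE_I2 power_mono b walk_in y)
  have harm: "harmonic_on \<Omega> (\<lambda>x. x \<bullet> y)"
    unfolding harmonic_on_def
    by (rule exI[of _ "\<lambda>_. y"], rule exI[of _ "\<lambda>_. 0"])
       (auto intro!: derivative_eq_intros simp: inner_commute trace_def)
  have "(\<integral>\<omega>. (if ?X \<omega> \<in> \<Omega> then ?X \<omega> \<bullet> y else 0) \<partial>walk_space) = y \<bullet> y"
  proof (rule integral_walk_harmonic[where v = "\<lambda>x. if x \<in> \<Omega> then x \<bullet> y else 0", OF harm])
    show "\<bar>if x \<in> \<Omega> then x \<bullet> y else 0\<bar> \<le> b * norm y" for x
      using Cauchy_Schwarz_ineq2[of x y] mult_right_mono[OF b norm_ge_zero, of x y] 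
        order_trans[OF norm_ge_zero b[OF y]] by auto
  qed (use y in auto)
  then have m: "(\<integral>\<omega>. ?X \<omega> \<bullet> y \<partial>walk_space) = y \<bullet> y" by (simp add: walk_in y)
  have eq: "(norm (?X \<omega> - y))\<^sup>2 = (norm (?X \<omega>))\<^sup>2 - 2 * (?X \<omega> \<bullet> y) + y \<bullet> y" for \<omega>
    by (simp add: power2_norm_eq_inner algebra_simps inner_commute)
  have iD: "integrable walk_space (\<lambda>\<omega>. (norm (?X \<omega> - y))\<^sup>2)"
    unfolding eq using iX iX2 by (intro Bochner_Integration.integrable_add Bochner_Integration.integrable_diff integrable_mult_right integrable_inner_left) auto
  have "(\<integral>\<omega>. (norm (?X \<omega> - y))\<^sup>2 \<partial>walk_space) = (\<integral>\<omega>. (norm (?X \<omega>))\<^sup>2 \<partial>walk_space) - y \<bullet> y"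
    unfolding eq using iX iX2 m by (simp add: S.prob_space)
  then have "(\<integral>\<omega>. (norm (?X \<omega>))\<^sup>2 \<partial>walk_space) = (norm y)\<^sup>2 + (\<integral>\<omega>. (norm (?X \<omega> - y))\<^sup>2 \<partial>walk_space)"
    by (simp add: power2_norm_eq_inner)
  then show ?thesis
    using nn_integral_eq_integral[OF iX2] nn_integral_eq_integral[OF iD] by simp
qed

text \<open>The increment after time \<open>n\<close> is orthogonal to the position at time \<open>n\<close>, by the Markov
  property and the previous lemma.\<close>

lemma nn_integral_walk_increment:
  assumes y: "y \<in> \<Omega>"
  shows "(\<integral>\<^sup>+\<omega>. ennreal ((norm (walk \<Omega> (n + m) y \<omega>))\<^sup>2) \<partial>walk_space) =
    (\<integral>\<^sup>+\<omega>. ennreal ((norm (walk \<Omega> n y \<omega>))\<^sup>2) \<partial>walk_space) +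
    (\<integral>\<^sup>+\<omega>. ennreal ((norm (walk \<Omega> (n + m) y \<omega> - walk \<Omega> n y \<omega>))\<^sup>2) \<partial>walk_space)"
proof -
  interpret B: prob_space "ball_law :: (real ^ 'n) measure" by (rule prob_space_ball_law)
  interpret S: prob_space "walk_space :: (real ^ 'n) stream measure" by (rule B.prob_space_stream_space)
  have "(\<integral>\<^sup>+\<omega>. ennreal ((norm (walk \<Omega> (n + m) y \<omega>))\<^sup>2) \<partial>walk_space) =
    (\<integral>\<^sup>+\<omega>. (\<integral>\<^sup>+\<omega>'. ennreal ((norm (walk \<Omega> m (walk \<Omega> n y \<omega>) \<omega>'))\<^sup>2) \<partial>walk_space) \<partial>walk_space)"
    by (rule nn_integral_walk_Markov[where f = "\<lambda>_ x. ennreal ((norm x)\<^sup>2)"]) measurable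
  also have "\<dots> = (\<integral>\<^sup>+\<omega>. (ennreal ((norm (walk \<Omega> n y \<omega>))\<^sup>2) +
      (\<integral>\<^sup>+\<omega>'. ennreal ((norm (walk \<Omega> m (walk \<Omega> n y \<omega>) \<omega>' - walk \<Omega> n y \<omega>))\<^sup>2) \<partial>walk_space)) \<partial>walk_space)"
    by (simp add: nn_integral_walk_sq walk_in y)
  also have "\<dots> = (\<integral>\<^sup>+\<omega>. ennreal ((norm (walk \<Omega> n y \<omega>))\<^sup>2) \<partial>walk_space) +
      (\<integral>\<^sup>+\<omega>. (\<integral>\<^sup>+\<omega>'. ennreal ((norm (walk \<Omega> m (walk \<Omega> n y \<omega>) \<omega>' - walk \<Omega> n y \<omega>))\<^sup>2) \<partial>walk_space) \<partial>walk_space)"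
    by (rule nn_integral_add) measurable
  also have "(\<integral>\<^sup>+\<omega>. (\<integral>\<^sup>+\<omega>'. ennreal ((norm (walk \<Omega> m (walk \<Omega> n y \<omega>) \<omega>' - walk \<Omega> n y \<omega>))\<^sup>2) \<partial>walk_space) \<partial>walk_space)
    = (\<integral>\<^sup>+\<omega>. ennreal ((norm (walk \<Omega> (n + m) y \<omega> - walk \<Omega> n y \<omega>))\<^sup>2) \<partial>walk_space)"
    by (rule nn_integral_walk_Markov[where f = "\<lambda>x' x. ennreal ((norm (x - x'))\<^sup>2)", symmetric]) measurable
  finally show ?thesis .
qed

end

lemma AE_ball_law_neq: "AE z in (ball_law :: (real ^ 'n) measure). z \<noteq> 0"
  unfolding ball_law_def
  by (subst AE_density) (use AE_lborel_singleton[of "0 :: real ^ 'n"] in \<open>auto elim!: eventually_mono\<close>)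

lemma nn_integral_ball_law_sq_pos:
  "0 < (\<integral>\<^sup>+z. ennreal ((norm (if norm z < 1 then z else (0 :: real ^ 'n)))\<^sup>2) \<partial>ball_law)"
proof (rule ccontr)
  interpret B: prob_space "ball_law :: (real ^ 'n) measure" by (rule prob_space_ball_law)
  assume "\<not> ?thesis"
  then have "(\<integral>\<^sup>+z. ennreal ((norm (if norm z < 1 then z else (0 :: real ^ 'n)))\<^sup>2) \<partial>ball_law) = 0"
    by (simp add: not_less)
  then have "AE z in (ball_law :: (real ^ 'n) measure). ennreal ((norm (if norm z < 1 then z else 0))\<^sup>2) = 0"
    by (subst (asm) nn_integral_0_iff_AE) auto
  with AE_ball_law AE_ball_law_neq have "AE z in (ball_law :: (real ^ 'n) measure). False"
    by eventually_elim auto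
  then show False by (simp add: B.AE_False)
qed

lemma summable_of_nn_integral_suminf:
  fixes f :: "nat \<Rightarrow> 'a \<Rightarrow> real"
  assumes [measurable]: "\<And>k. f k \<in> borel_measurable M" and nn: "\<And>k x. 0 \<le> f k x"
    and le: "\<And>k. (\<integral>\<^sup>+x. ennreal (f k x) \<partial>M) \<le> ennreal (c k)" and c: "summable c" "\<And>k. 0 \<le> c k"
  shows "AE x in M. summable (\<lambda>k. f k x)"
proof -
  have "(\<integral>\<^sup>+x. (\<Sum>k. ennreal (f k x)) \<partial>M) = (\<Sum>k. \<integral>\<^sup>+x. ennreal (f k x) \<partial>M)"
    by (rule nn_integral_suminf) auto
  also have "\<dots> \<le> (\<Sum>k. ennreal (c k))"
    by (rule suminf_le) (auto intro: le)
  also have "\<dots> = ennreal (\<Sum>k. c k)" by (rule suminf_ennreal2) (use c in auto)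
  finally have "(\<integral>\<^sup>+x. (\<Sum>k. ennreal (f k x)) \<partial>M) \<noteq> \<infinity>"
    by (auto simp: top_unique)
  then have "AE x in M. (\<Sum>k. ennreal (f k x)) \<noteq> \<infinity>"
    by (intro nn_integral_PInf_AE) auto
  then show ?thesis
    by eventually_elim (auto intro!: summable_suminf_not_top nn)
qed

context
  fixes \<Omega> :: "(real ^ 'n) set"
  assumes open_\<Omega>: "open \<Omega>" and bounded_\<Omega>: "bounded \<Omega>"
begin

text \<open>The second moments increase and are bounded because \<open>\<Omega>\<close> is bounded. Their increments are
  the squared distances in $L^2$.\<close>

lemma walk_fast_subsequence:
  assumes p: "p \<in> \<Omega>"
  obtains N where "\<And>k m. (\<integral>\<^sup>+\<omega>. ennreal ((norm (walk \<Omega> (N k + m) p \<omega> - walk \<Omega> (N k) p \<omega>))\<^sup>2) \<partial>walk_space) \<le> ennreal ((1/4) ^ k)"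
    and "incseq N"
proof -
  interpret B: prob_space "ball_law :: (real ^ 'n) measure" by (rule prob_space_ball_law)
  interpret S: prob_space "walk_space :: (real ^ 'n) stream measure" by (rule B.prob_space_stream_space)
  obtain b where b: "\<And>x. x \<in> \<Omega> \<Longrightarrow> norm x \<le> b"
    using bounded_\<Omega> by (auto simp: bounded_iff)
  define Q where "Q = (\<lambda>n. \<integral>\<^sup>+\<omega>. ennreal ((norm (walk \<Omega> n p \<omega>))\<^sup>2) \<partial>walk_space)"
  define D where "D = (\<lambda>n m. \<integral>\<^sup>+\<omega>. ennreal ((norm (walk \<Omega> (n + m) p \<omega> - walk \<Omega> n p \<omega>))\<^sup>2) \<partial>walk_space)"
  have QD: "Q (n + m) = Q n + D n m" for n m
    unfolding Q_def D_def by (rule nn_integral_walk_increment[OF open_\<Omega> bounded_\<Omega> p])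
  have Qb: "Q n \<le> ennreal (b\<^sup>2)" for n
  proof -
    have "Q n \<le> (\<integral>\<^sup>+\<omega>. ennreal (b\<^sup>2) \<partial>(walk_space :: (real ^ 'n) stream measure))"
      unfolding Q_def
      by (intro nn_integral_mono ennreal_leI power_mono b walk_in[OF open_\<Omega> bounded_\<Omega>] p) auto
    then show ?thesis by (simp add: S.emeasure_space_1)
  qed
  define L where "L = (SUP n. Q n)"
  have L: "L \<le> ennreal (b\<^sup>2)" unfolding L_def by (rule SUP_least) (rule Qb)
  have "\<exists>n0. \<forall>n\<ge>n0. \<forall>m. D n m \<le> ennreal ((1/4) ^ k)" for k
  proof -
    have Lt: "L < \<top>" using L by (auto simp: less_top[symmetric] top_unique)
    have "\<exists>n. L < Q n + ennreal ((1/4) ^ k)"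
      using SUP_approx_ennreal[of "(1/4) ^ k" UNIV L Q] Lt by (metis L_def UNIV_I UNIV_not_empty infinity_ennreal_def less_irrefl zero_less_divide_1_iff zero_less_numeral zero_less_power)
    then obtain n where n: "L < Q n + ennreal ((1/4) ^ k)" by blast
    have "D n' m \<le> ennreal ((1/4) ^ k)" if "n' \<ge> n" for n' m
    proof -
      have "Q n \<le> Q n'" using QD[of n "n' - n"] that by simp
      moreover have "Q n' + D n' m \<le> L" unfolding QD[symmetric] L_def by (rule SUP_upper) simp
      ultimately have "Q n' + D n' m \<le> Q n' + ennreal ((1/4) ^ k)"
        using n by (meson add_right_mono order.strict_implies_order order_trans)
      then show ?thesis
        using Qb[of n'] by (subst (asm) ennreal_add_left_cancel_le) (auto simp: top_unique)
    qed
    then show ?thesis by blast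
  qed
  then obtain n0 where n0: "\<And>k n m. n \<ge> n0 k \<Longrightarrow> D n m \<le> ennreal ((1/4) ^ k)" by metis
  show thesis
  proof (rule that)
    show "incseq (\<lambda>k. \<Sum>i\<le>k. n0 i)" by (rule incseq_SucI) simp
    have "n0 k \<le> (\<Sum>i\<le>k. n0 i)" for k by (rule member_le_sum) auto
    then show "(\<integral>\<^sup>+\<omega>. ennreal ((norm (walk \<Omega> ((\<Sum>i\<le>k. n0 i) + m) p \<omega> - walk \<Omega> (\<Sum>i\<le>k. n0 i) p \<omega>))\<^sup>2) \<partial>walk_space) \<le> ennreal ((1/4) ^ k)" for k m
      using n0 unfolding D_def by blast
  qed
qed

text \<open>Along the subsequence the increments are summable almost surely, so the walk converges.
  One further step has mean square length proportional to the expected square of the distance to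
  the boundary; it tends to 0, so the limit is a boundary point. Bounded convergence carries the
  mean value identity over to the law of the limit.\<close>

theorem harmonic_measure_exists:
  assumes p: "p \<in> \<Omega>"
  shows "\<exists>\<mu>. is_harmonic_measure \<Omega> p \<mu>"
proof -
  interpret B: prob_space "ball_law :: (real ^ 'n) measure" by (rule prob_space_ball_law)
  interpret S: prob_space "walk_space :: (real ^ 'n) stream measure" by (rule B.prob_space_stream_space)
  let ?F = "frontier \<Omega>"
  have F0: "?F \<noteq> {}" using frontier_nonempty_bounded[OF bounded_\<Omega>] p by auto
  obtain N where N: "\<And>k m. (\<integral>\<^sup>+\<omega>. ennreal ((norm (walk \<Omega> (N k + m) p \<omega> - walk \<Omega> (N k) p \<omega>))\<^sup>2) \<partial>walk_space) \<le> ennreal ((1/4) ^ k)"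
    and "incseq N"
    using walk_fast_subsequence[OF p] by blast
  define Z where "Z = (\<lambda>k. walk \<Omega> (N k) p)"
  have [measurable]: "Z k \<in> borel_measurable walk_space" for k unfolding Z_def by measurable
  have Zin: "Z k \<omega> \<in> \<Omega>" for k \<omega> unfolding Z_def by (rule walk_in[OF open_\<Omega> bounded_\<Omega> p])
  \<comment> \<open>The mean square of the increment is at most \<open>(1/4) ^ k\<close>; the mean follows from \<open>2 a b \<le> a\<^sup>2 + b\<^sup>2\<close> with weights \<open>2 ^ k\<close>.\<close>
  have incr: "(\<integral>\<^sup>+\<omega>. ennreal (norm (Z (Suc k) \<omega> - Z k \<omega>)) \<partial>walk_space) \<le> ennreal ((1/2) ^ k)" for k
  proof -
    have Nk: "N (Suc k) = N k + (N (Suc k) - N k)" using \<open>incseq N\<close> by (simp add: incseq_SucD)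
    have "(\<integral>\<^sup>+\<omega>. ennreal (norm (Z (Suc k) \<omega> - Z k \<omega>)) \<partial>walk_space) \<le>
      (\<integral>\<^sup>+\<omega>. ennreal (2 ^ k / 2) * ennreal ((norm (Z (Suc k) \<omega> - Z k \<omega>))\<^sup>2) + ennreal ((1/2) ^ k / 2) \<partial>walk_space)"
    proof (rule nn_integral_mono)
      fix \<omega>
      let ?t = "norm (Z (Suc k) \<omega> - Z k \<omega>)"
      have "0 \<le> (2 ^ k * ?t - 1)\<^sup>2 * (1/2) ^ k / 2" by simp
      also have "\<dots> = 2 ^ k / 2 * ?t\<^sup>2 + (1/2) ^ k / 2 - ?t"
        by (simp add: power2_eq_square field_simps)
      finally have "?t \<le> 2 ^ k / 2 * ?t\<^sup>2 + (1/2) ^ k / 2" by simp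
      then show "ennreal ?t \<le> ennreal (2 ^ k / 2) * ennreal (?t\<^sup>2) + ennreal ((1/2) ^ k / 2)"
        by (simp add: ennreal_mult[symmetric] ennreal_plus[symmetric] del: ennreal_plus)
    qed
    also have "\<dots> = ennreal (2 ^ k / 2) * (\<integral>\<^sup>+\<omega>. ennreal ((norm (Z (Suc k) \<omega> - Z k \<omega>))\<^sup>2) \<partial>walk_space) + ennreal ((1/2) ^ k / 2)"
      by (subst nn_integral_add) (auto simp: nn_integral_cmult S.emeasure_space_1)
    also have "\<dots> \<le> ennreal (2 ^ k / 2) * ennreal ((1/4) ^ k) + ennreal ((1/2) ^ k / 2)"
      using N[of k "N (Suc k) - N k"] Nk unfolding Z_def by (intro add_right_mono mult_left_mono) auto
    also have "\<dots> = ennreal (2 ^ k / 2 * (1/4) ^ k + (1/2) ^ k / 2)"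
      by (simp add: ennreal_mult[symmetric] ennreal_plus[symmetric] del: ennreal_plus)
    also have "2 ^ k / 2 * (1/4) ^ k + (1/2) ^ k / 2 = (1/2 :: real) ^ k"
      by (simp add: power_mult_distrib[symmetric])
    finally show "(\<integral>\<^sup>+\<omega>. ennreal (norm (Z (Suc k) \<omega> - Z k \<omega>)) \<partial>walk_space) \<le> ennreal ((1/2) ^ k)" .
  qed
  have "AE \<omega> in walk_space. summable (\<lambda>k. norm (Z (Suc k) \<omega> - Z k \<omega>))"
    by (rule summable_of_nn_integral_suminf[OF _ _ incr]) (simp_all add: summable_geometric)
  then have conv: "AE \<omega> in walk_space. convergent (\<lambda>k. Z k \<omega>)"
  proof eventually_elim
    case (elim \<omega>)
    have "(\<lambda>n. \<Sum>k<n. Z (Suc k) \<omega> - Z k \<omega>) \<longlonglongrightarrow> (\<Sum>k. Z (Suc k) \<omega> - Z k \<omega>)"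
      by (rule summable_LIMSEQ[OF summable_norm_cancel[OF elim]])
    then have "(\<lambda>n. Z n \<omega> - Z 0 \<omega>) \<longlonglongrightarrow> (\<Sum>k. Z (Suc k) \<omega> - Z k \<omega>)"
      by (simp only: sum_lessThan_telescope[of "\<lambda>k. Z k \<omega>"])
    then have "(\<lambda>n. Z n \<omega> - Z 0 \<omega> + Z 0 \<omega>) \<longlonglongrightarrow> (\<Sum>k. Z (Suc k) \<omega> - Z k \<omega>) + Z 0 \<omega>"
      by (intro tendsto_add tendsto_const)
    then show ?case unfolding convergent_def by auto
  qed
  define c where "c = (\<integral>\<^sup>+z. ennreal ((norm (if norm z < 1 then z else (0 :: real ^ 'n)))\<^sup>2) \<partial>ball_law)"
  have c0: "c \<noteq> 0" using nn_integral_ball_law_sq_pos[where 'n = 'n] by (simp add: c_def)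
  have c1: "c \<noteq> \<infinity>"
  proof -
    have "c \<le> (\<integral>\<^sup>+z. 1 \<partial>(ball_law :: (real ^ 'n) measure))"
      unfolding c_def by (intro nn_integral_mono) (auto simp: abs_square_le_1)
    then show ?thesis using B.emeasure_space_1 by (auto simp: top_unique)
  qed
  have dist0: "(\<integral>\<^sup>+\<omega>. ennreal ((infdist (Z k \<omega>) ?F / 2)\<^sup>2) \<partial>walk_space) \<le> ennreal ((1/4) ^ k / enn2real c)" for k
  proof -
    have "(\<integral>\<^sup>+\<omega>. ennreal ((infdist (Z k \<omega>) ?F / 2)\<^sup>2) \<partial>walk_space) * c =
      (\<integral>\<^sup>+\<omega>. ennreal ((infdist (Z k \<omega>) ?F / 2)\<^sup>2) * c \<partial>walk_space)"
      by (rule nn_integral_multc[symmetric]) measurable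
    also have "\<dots> = (\<integral>\<^sup>+\<omega>. (\<integral>\<^sup>+\<omega>'. ennreal ((norm (walk \<Omega> 1 (Z k \<omega>) \<omega>' - Z k \<omega>))\<^sup>2) \<partial>walk_space) \<partial>walk_space)"
    proof (rule nn_integral_cong)
      fix \<omega>
      have "(\<integral>\<^sup>+\<omega>'. ennreal ((norm (walk \<Omega> 1 y \<omega>' - y))\<^sup>2) \<partial>walk_space) = ennreal ((infdist y ?F / 2)\<^sup>2) * c" for y
      proof -
        have "(\<integral>\<^sup>+\<omega>'. ennreal ((norm (walk \<Omega> 1 y \<omega>' - y))\<^sup>2) \<partial>walk_space) =
          (\<integral>\<^sup>+z. (\<integral>\<^sup>+\<omega>'. ennreal ((norm (walk \<Omega> 1 y (z ## \<omega>') - y))\<^sup>2) \<partial>walk_space) \<partial>ball_law)"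
          by (rule B.nn_integral_stream_space) measurable
        also have "\<dots> = (\<integral>\<^sup>+z. ennreal ((infdist y ?F / 2)\<^sup>2) * ennreal ((norm (if norm z < 1 then z else (0 :: real ^ 'n)))\<^sup>2) \<partial>ball_law)"
          by (simp add: S.emeasure_space_1 walk_step_def power_mult_distrib power_divide ennreal_mult[symmetric])
        also have "\<dots> = ennreal ((infdist y ?F / 2)\<^sup>2) * c"
          unfolding c_def by (rule nn_integral_cmult) measurable
        finally show ?thesis .
      qed
      then show "ennreal ((infdist (Z k \<omega>) ?F / 2)\<^sup>2) * c = (\<integral>\<^sup>+\<omega>'. ennreal ((norm (walk \<Omega> 1 (Z k \<omega>) \<omega>' - Z k \<omega>))\<^sup>2) \<partial>walk_space)"
        by (rule sym)
    qed
    also have "\<dots> = (\<integral>\<^sup>+\<omega>. ennreal ((norm (walk \<Omega> (N k + 1) p \<omega> - walk \<Omega> (N k) p \<omega>))\<^sup>2) \<partial>walk_space)"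
      unfolding Z_def
      by (rule nn_integral_walk_Markov[OF open_\<Omega> bounded_\<Omega>, where f = "\<lambda>x' x. ennreal ((norm (x - x'))\<^sup>2)", symmetric]) measurable
    also have "\<dots> \<le> ennreal ((1/4) ^ k)" by (rule N)
    finally have "(\<integral>\<^sup>+\<omega>. ennreal ((infdist (Z k \<omega>) ?F / 2)\<^sup>2) \<partial>walk_space) * c \<le> ennreal ((1/4) ^ k)" .
    from divide_right_mono_ennreal[OF this, of c]
    have "(\<integral>\<^sup>+\<omega>. ennreal ((infdist (Z k \<omega>) ?F / 2)\<^sup>2) \<partial>walk_space) \<le> ennreal ((1/4) ^ k) / c"
      unfolding ennreal_mult_divide_eq[OF c0 c1[unfolded infinity_ennreal_def]] .
    also have "\<dots> = ennreal ((1/4) ^ k) / ennreal (enn2real c)"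
      using c1 by (simp add: less_top)
    also have "\<dots> = ennreal ((1/4) ^ k / enn2real c)"
      by (rule divide_ennreal) (use c0 c1 in \<open>auto simp: enn2real_positive_iff less_top zero_less_iff_neq_zero\<close>)
    finally show "(\<integral>\<^sup>+\<omega>. ennreal ((infdist (Z k \<omega>) ?F / 2)\<^sup>2) \<partial>walk_space) \<le> ennreal ((1/4) ^ k / enn2real c)" .
  qed
  have "AE \<omega> in walk_space. summable (\<lambda>k. (infdist (Z k \<omega>) ?F / 2)\<^sup>2)"
    by (rule summable_of_nn_integral_suminf[OF _ _ dist0]) (simp_all add: summable_geometric summable_divide)
  with conv have lim: "AE \<omega> in walk_space. lim (\<lambda>k. Z k \<omega>) \<in> ?F \<and> (\<lambda>k. Z k \<omega>) \<longlonglongrightarrow> lim (\<lambda>k. Z k \<omega>)"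
  proof eventually_elim
    case (elim \<omega>)
    then have l: "(\<lambda>k. Z k \<omega>) \<longlonglongrightarrow> lim (\<lambda>k. Z k \<omega>)" by (simp add: convergent_LIMSEQ_iff)
    then have "(\<lambda>k. (infdist (Z k \<omega>) ?F / 2)\<^sup>2) \<longlonglongrightarrow> (infdist (lim (\<lambda>k. Z k \<omega>)) ?F / 2)\<^sup>2"
      by (intro tendsto_intros) simp_all
    moreover have "(\<lambda>k. (infdist (Z k \<omega>) ?F / 2)\<^sup>2) \<longlonglongrightarrow> 0"
      using elim(2) by (rule summable_LIMSEQ_zero)
    ultimately have "(infdist (lim (\<lambda>k. Z k \<omega>)) ?F / 2)\<^sup>2 = 0"
      using LIMSEQ_unique by blast
    then have "infdist (lim (\<lambda>k. Z k \<omega>)) ?F = 0" by simp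
    then show ?case using l F0 frontier_closed[of \<Omega>] by (simp add: in_closed_iff_infdist_zero)
  qed
  obtain f0 where f0: "f0 \<in> ?F" using F0 by blast
  define W where "W = (\<lambda>\<omega>. if lim (\<lambda>k. Z k \<omega>) \<in> ?F then lim (\<lambda>k. Z k \<omega>) else f0)"
  have [measurable]: "(\<lambda>\<omega>. lim (\<lambda>k. Z k \<omega>)) \<in> borel_measurable walk_space"
    by (rule borel_measurable_lim_metric) measurable
  have [measurable]: "?F \<in> sets borel" by (simp add: frontier_closed)
  have [measurable]: "W \<in> borel_measurable walk_space" unfolding W_def by measurable
  have WF: "W \<omega> \<in> ?F" for \<omega> using f0 by (simp add: W_def)
  have [measurable]: "W \<in> measurable walk_space (restrict_space borel ?F)"
    using WF by (intro measurable_restrict_space2) auto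
  define \<mu> where "\<mu> = distr walk_space (restrict_space borel ?F) W"
  have "is_harmonic_measure \<Omega> p \<mu>"
    unfolding is_harmonic_measure_def
  proof (intro conjI allI impI)
    show "prob_space \<mu>" unfolding \<mu>_def by (rule S.prob_space_distr) measurable
    show "sets \<mu> = sets (restrict_space borel ?F)" by (simp add: \<mu>_def)
    fix u assume u: "continuous_on (closure \<Omega>) u \<and> harmonic_on \<Omega> u"
    define v where "v = (\<lambda>x. if x \<in> closure \<Omega> then u x else 0)"
    have v_meas [measurable]: "v \<in> borel_measurable borel"
      unfolding v_def using u by (intro borel_measurable_if_open) auto
    have "bounded (u ` closure \<Omega>)"
      using u bounded_\<Omega> by (intro compact_imp_bounded compact_continuous_image) auto
    then obtain K where K: "\<And>x. x \<in> closure \<Omega> \<Longrightarrow> \<bar>u x\<bar> \<le> K" by (auto simp: bounded_iff)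
    have K0: "0 \<le> K" using K[of p] closure_subset[of \<Omega>] p by fastforce
    have vK: "\<bar>v x\<bar> \<le> K" for x using K K0 by (simp add: v_def)
    have "(\<integral>\<omega>. v (Z k \<omega>) \<partial>walk_space) = u p" for k
      unfolding Z_def
      by (rule integral_walk_harmonic[OF open_\<Omega> bounded_\<Omega> _ v_meas, where K = K])
         (use u vK p closure_subset[of \<Omega>] in \<open>auto simp: v_def\<close>)
    moreover have "(\<lambda>k. \<integral>\<omega>. v (Z k \<omega>) \<partial>walk_space) \<longlonglongrightarrow> (\<integral>\<omega>. v (W \<omega>) \<partial>walk_space)"
    proof (rule integral_dominated_convergence[where w = "\<lambda>_. K"])
      show "AE \<omega> in walk_space. (\<lambda>k. v (Z k \<omega>)) \<longlonglongrightarrow> v (W \<omega>)"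
        using lim
      proof eventually_elim
        case (elim \<omega>)
        then have W: "W \<omega> = lim (\<lambda>k. Z k \<omega>)" by (simp add: W_def)
        have Wc: "W \<omega> \<in> closure \<Omega>" using WF by (auto simp: frontier_def)
        have Zc: "Z k \<omega> \<in> closure \<Omega>" for k using Zin closure_subset[of \<Omega>] by blast
        have "(\<lambda>k. u (Z k \<omega>)) \<longlonglongrightarrow> u (W \<omega>)"
          using u elim Wc Zc unfolding W continuous_on_sequentially by (auto simp: comp_def)
        then show ?case using Wc Zc by (simp add: v_def)
      qed
    qed (use vK in auto)
    ultimately have "u p = (\<integral>\<omega>. v (W \<omega>) \<partial>walk_space)" by (simp add: LIMSEQ_const_iff)
    also have "\<dots> = (\<integral>x. v x \<partial>\<mu>)"
      unfolding \<mu>_def by (subst integral_distr) (auto intro: measurable_restrict_space1)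
    also have "\<dots> = (\<integral>x. u x \<partial>\<mu>)"
      by (rule Bochner_Integration.integral_cong) (auto simp: \<mu>_def v_def space_restrict_space frontier_def)
    finally show "u p = (\<integral>x. u x \<partial>\<mu>)" .
  qed
  then show ?thesis by blast
qed

lemma is_harmonic_measure_harmonic_measure:
  "p \<in> \<Omega> \<Longrightarrow> is_harmonic_measure \<Omega> p (harmonic_measure \<Omega> p)"
  unfolding harmonic_measure_def by (rule someI_ex) (rule harmonic_measure_exists)

end

section \<open>Potentials\<close>

text \<open>The potential of \<open>\<nu>\<close> is finite almost everywhere but may be discontinuous. As in Egorov's
  theorem there is a compact set \<open>K'\<close> of large measure on which the contributions of the near
  diagonal part of the kernel tend to 0 uniformly. For the restriction of \<open>\<nu>\<close> to \<open>K'\<close> this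
  uniformity extends to all points \<open>y\<close>: if \<open>w\<close> is a point of \<open>K'\<close> closest to \<open>y\<close>, then
  \<open>dist w z \<le> 2 dist y z\<close> on \<open>K'\<close>, so by the doubling assumption on \<open>g\<close> the kernel at \<open>y\<close> is
  controlled by that at \<open>w\<close>. The potential is thus a uniform limit of the continuous potentials
  of truncated kernels.\<close>

lemma continuous_potential:
  fixes \<nu> :: "'a::euclidean_space measure" and g :: "real \<Rightarrow> real"
  assumes "prob_space \<nu>" and sets: "sets \<nu> = sets borel"
    and K: "compact K" "emeasure \<nu> K = 1" "\<And>y z. y \<in> K \<Longrightarrow> z \<in> K \<Longrightarrow> dist y z \<le> L"
    and g_mono: "\<And>s t. 0 < s \<Longrightarrow> s \<le> t \<Longrightarrow> g t \<le> g s"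
    and g_cont: "continuous_on {0<..} g"
    and g_meas: "g \<in> borel_measurable borel"
    and g_half: "\<And>t. 0 < t \<Longrightarrow> g (t / 2) \<le> a * g t + b" and a: "1 \<le> a" and b: "0 \<le> b"
    and gL: "0 < L" "0 \<le> g L" and A: "0 < A"
    and energy: "(\<integral>\<^sup>+y. (\<integral>\<^sup>+z. (if y = z then \<infinity> else ennreal (g (dist y z))) \<partial>\<nu>) \<partial>\<nu>) \<le> ennreal A"
    and B: "B \<in> sets borel" "emeasure \<nu> B \<ge> ennreal (3 / 4)"
  obtains M K' where "finite_measure M" "sets M = sets borel" "compact K'" "K' \<subseteq> B" "K' \<subseteq> K" "K' \<noteq> {}"
    "AE z in M. z \<in> K'" "\<And>y. AE z in M. z \<noteq> y" "1 / 4 \<le> measure M UNIV" "measure M UNIV \<le> 1"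
    "\<And>y. integrable M (\<lambda>z. g (dist y z))"
    "continuous_on UNIV (\<lambda>y. \<integral>z. g (dist y z) \<partial>M)"
    "\<And>y. (\<integral>z. g (dist y z) \<partial>M) \<le> a * (8 * A) + b"
proof -
  interpret prob_space \<nu> by fact
  note [measurable_cong] = sets
  note [measurable] = g_meas B(1)
  have sp: "space \<nu> = UNIV" using sets_eq_imp_space_eq[OF sets] by simp
  have Km [measurable]: "K \<in> sets borel" using K(1) by (simp add: compact_imp_closed)
  define h where "h = (\<lambda>(m::nat) (w::'a) z. if w = z then \<infinity> else ennreal (g (dist w z) - real m))"
  define H where "H = (\<lambda>m w. \<integral>\<^sup>+z. h m w z \<partial>\<nu>)"
  have [measurable]: "(\<lambda>p. h m (fst p) (snd p)) \<in> borel_measurable (borel \<Otimes>\<^sub>M borel)" for m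
    unfolding h_def by measurable
  have [measurable]: "(\<lambda>z. h m w z) \<in> borel_measurable borel" for m w
    unfolding h_def by measurable
  have [measurable]: "H m \<in> borel_measurable borel" for m
  proof -
    have "(\<lambda>p. h m (fst p) (snd p)) \<in> borel_measurable (borel \<Otimes>\<^sub>M \<nu>)" by measurable
    then show ?thesis unfolding H_def by (intro borel_measurable_nn_integral) (simp add: split_beta')
  qed
  have H0: "(\<integral>\<^sup>+w. H 0 w \<partial>\<nu>) \<le> ennreal A" using energy by (simp add: H_def h_def cong: if_cong)
  have h_mono: "h m w z \<le> h 0 w z" for m w z by (auto simp: h_def intro!: ennreal_leI)
  have H_mono: "H m w \<le> H 0 w" for m w unfolding H_def by (intro nn_integral_mono h_mono)
  have neq: "AE z in \<nu>. z \<noteq> w" if "H 0 w < \<infinity>" for w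
  proof -
    have "AE z in \<nu>. h 0 w z \<noteq> \<infinity>" by (rule nn_integral_PInf_AE) (use that in \<open>auto simp: H_def\<close>)
    then show ?thesis by eventually_elim (auto simp: h_def)
  qed
  have Hlim: "(\<lambda>m. H m w) \<longlonglongrightarrow> 0" if w: "H 0 w < \<infinity>" for w
  proof -
    have "(\<lambda>m. \<integral>\<^sup>+z. h m w z \<partial>\<nu>) \<longlonglongrightarrow> (\<integral>\<^sup>+z. 0 \<partial>\<nu>)"
    proof (rule nn_integral_dominated_convergence[where w = "h 0 w"])
      show "AE z in \<nu>. (\<lambda>m. h m w z) \<longlonglongrightarrow> 0"
        using neq[OF w]
      proof eventually_elim
        case (elim z)
        obtain n :: nat where n: "g (dist w z) \<le> real n" using real_arch_simple by blast
        have "h m w z = 0" if "m \<ge> n" for m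
          using n that elim by (auto simp: h_def ennreal_neg)
        then show ?case by (intro tendsto_eventually) (auto simp: eventually_sequentially)
      qed
    qed (use w h_mono in \<open>auto simp: H_def\<close>)
    then show ?thesis by (simp add: H_def)
  qed
  have H0fin: "AE w in \<nu>. H 0 w < \<infinity>"
  proof -
    have "AE w in \<nu>. H 0 w \<noteq> \<infinity>" by (rule nn_integral_PInf_AE) (use H0 in \<open>auto simp: top_unique\<close>)
    then show ?thesis by eventually_elim (auto simp: less_top)
  qed
  have "(\<lambda>m. \<integral>\<^sup>+w. H m w \<partial>\<nu>) \<longlonglongrightarrow> (\<integral>\<^sup>+w. 0 \<partial>\<nu>)"
  proof (rule nn_integral_dominated_convergence[where w = "H 0"])
    show "AE w in \<nu>. (\<lambda>m. H m w) \<longlonglongrightarrow> 0" using H0fin by eventually_elim (rule Hlim)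
    show "(\<integral>\<^sup>+w. H 0 w \<partial>\<nu>) < \<infinity>" using H0 by (auto simp: order_le_less_trans)
  qed (use H_mono in auto)
  then have lim0: "(\<lambda>m. \<integral>\<^sup>+w. H m w \<partial>\<nu>) \<longlonglongrightarrow> 0" by simp
  have "\<exists>m. (\<integral>\<^sup>+w. H m w \<partial>\<nu>) < ennreal ((1/4) ^ j / 16)" for j
  proof -
    have "\<forall>\<^sub>F m in sequentially. (\<integral>\<^sup>+w. H m w \<partial>\<nu>) < ennreal ((1/4) ^ j / 16)"
      by (rule order_tendstoD(2)[OF lim0]) simp
    then show ?thesis by (meson eventually_sequentially order_refl)
  qed
  then obtain m where m: "\<And>j. (\<integral>\<^sup>+w. H (m j) w \<partial>\<nu>) < ennreal ((1/4) ^ j / 16)" by metis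
  \<comment> \<open>By Markov's inequality the sets \<open>bad j\<close> have total measure at most 1/8 and \<open>bad0\<close> at most 1/8, which leaves 1/2 of the 3/4 in \<open>B\<close>.\<close>
  define bad where "bad = (\<lambda>j. {w. 1 \<le> ennreal (2 ^ j) * H (m j) w})"
  define bad0 where "bad0 = {w. 1 \<le> ennreal (1 / (8 * A)) * H 0 w}"
  have [measurable]: "bad j \<in> sets borel" "bad0 \<in> sets borel" for j unfolding bad_def bad0_def by measurable
  have badm: "emeasure \<nu> (bad j) \<le> ennreal ((1/2) ^ j / 16)" for j
  proof -
    have "emeasure \<nu> (bad j) = emeasure \<nu> {w \<in> space \<nu>. 1 \<le> ennreal (2 ^ j) * H (m j) w}"
      by (simp add: bad_def sp)
    also have "\<dots> \<le> ennreal (2 ^ j) * (\<integral>\<^sup>+w. H (m j) w * indicator (space \<nu>) w \<partial>\<nu>)"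
      by (rule order_trans[OF _ nn_integral_Markov_inequality]) (auto intro!: emeasure_mono)
    also have "(\<integral>\<^sup>+w. H (m j) w * indicator (space \<nu>) w \<partial>\<nu>) = (\<integral>\<^sup>+w. H (m j) w \<partial>\<nu>)"
      by (rule nn_integral_cong) simp
    also have "ennreal (2 ^ j) * (\<integral>\<^sup>+w. H (m j) w \<partial>\<nu>) \<le> ennreal (2 ^ j) * ennreal ((1/4) ^ j / 16)"
      by (intro mult_left_mono less_imp_le m) auto
    also have "\<dots> = ennreal (2 ^ j * ((1/4) ^ j / 16))" by (rule ennreal_mult[symmetric]) auto
    also have "(2::real) ^ j * ((1/4) ^ j / 16) = (1/2) ^ j / 16"
      by (simp add: power_mult_distrib[symmetric])
    finally show ?thesis .
  qed
  have bad0m: "emeasure \<nu> bad0 \<le> ennreal (1 / 8)"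
  proof -
    have "emeasure \<nu> bad0 = emeasure \<nu> {w \<in> space \<nu>. 1 \<le> ennreal (1 / (8 * A)) * H 0 w}"
      by (simp add: bad0_def sp)
    also have "\<dots> \<le> ennreal (1 / (8 * A)) * (\<integral>\<^sup>+w. H 0 w * indicator (space \<nu>) w \<partial>\<nu>)"
      by (rule order_trans[OF _ nn_integral_Markov_inequality]) (auto intro!: emeasure_mono)
    also have "(\<integral>\<^sup>+w. H 0 w * indicator (space \<nu>) w \<partial>\<nu>) = (\<integral>\<^sup>+w. H 0 w \<partial>\<nu>)"
      by (rule nn_integral_cong) simp
    also have "ennreal (1 / (8 * A)) * (\<integral>\<^sup>+w. H 0 w \<partial>\<nu>) \<le> ennreal (1 / (8 * A)) * ennreal A"
      by (intro mult_left_mono H0) auto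
    also have "\<dots> = ennreal (1 / 8)" using A by (simp add: ennreal_mult[symmetric])
    finally show ?thesis .
  qed
  define BU where "BU = (\<Union>j. bad j)"
  have [measurable]: "BU \<in> sets borel" unfolding BU_def by measurable
  have BUm: "emeasure \<nu> BU \<le> ennreal (1 / 8)"
  proof -
    have "emeasure \<nu> BU \<le> (\<Sum>j. emeasure \<nu> (bad j))"
      unfolding BU_def by (rule emeasure_subadditive_countably) auto
    also have "\<dots> \<le> (\<Sum>j. ennreal ((1/2) ^ j / 16))" by (intro suminf_le badm) auto
    also have "\<dots> = ennreal (\<Sum>j. (1/2) ^ j / 16)"
      by (rule suminf_ennreal2) (auto intro!: summable_divide summable_geometric)
    also have "(\<Sum>j. (1/2 :: real) ^ j / 16) = 1 / 8"
      using suminf_geometric[of "1/2 :: real"] by (simp add: suminf_divide[OF summable_geometric])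
    finally show ?thesis .
  qed
  define G where "G = B \<inter> K - (BU \<union> bad0)"
  have [measurable]: "G \<in> sets borel" unfolding G_def by measurable
  have "emeasure \<nu> G > ennreal (1 / 4)"
  proof -
    have "prob (UNIV - K) = 0"
      using prob_compl[of K] K(2) sp by (simp add: measure_def)
    moreover have "prob B \<ge> 3 / 4" using B(2) by (simp add: emeasure_eq_measure)
    moreover have "prob BU \<le> 1 / 8" "prob bad0 \<le> 1 / 8" using BUm bad0m by (auto simp: emeasure_eq_measure)
    moreover have "prob B \<le> prob (G \<union> ((UNIV - K) \<union> (BU \<union> bad0)))"
      by (rule finite_measure_mono) (auto simp: G_def)
    moreover have "prob (G \<union> ((UNIV - K) \<union> (BU \<union> bad0))) \<le> prob G + prob ((UNIV - K) \<union> (BU \<union> bad0))"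
      by (rule measure_Un_le) auto
    moreover have "prob ((UNIV - K) \<union> (BU \<union> bad0)) \<le> prob (UNIV - K) + prob (BU \<union> bad0)"
      by (rule measure_Un_le) auto
    moreover have "prob (BU \<union> bad0) \<le> prob BU + prob bad0"
      by (rule measure_Un_le) auto
    ultimately have "prob G > 1 / 4" by linarith
    then show ?thesis by (simp add: emeasure_eq_measure ennreal_less_iff)
  qed
  also have "emeasure \<nu> G = (SUP K \<in> {K. K \<subseteq> G \<and> compact K}. emeasure \<nu> K)"
    by (rule inner_regular) (use sets in auto)
  finally obtain K' where K': "K' \<subseteq> G" "compact K'" and K'm: "ennreal (1 / 4) < emeasure \<nu> K'"
    by (auto simp: less_SUP_iff)
  have K'0: "K' \<noteq> {}" using K'm by auto
  have [measurable]: "K' \<in> sets borel" using K'(2) by (simp add: compact_imp_closed)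
  define M where "M = density \<nu> (indicator K')"
  have setsM [measurable_cong]: "sets M = sets borel" by (simp add: M_def sets)
  have spM: "space M = UNIV" by (simp add: M_def sp)
  have MUNIV: "emeasure M UNIV = emeasure \<nu> K'"
    unfolding M_def by (subst emeasure_density) (auto simp: sp[symmetric])
  have finM: "finite_measure M" by (rule finite_measureI) (simp add: spM MUNIV)
  interpret M: finite_measure M by fact
  have AEM: "AE z in M. z \<in> K'" unfolding M_def by (subst AE_density) (auto simp: indicator_def)
  have AEM2: "AE z in M. P z" if "AE z in \<nu>. P z" for P
    unfolding M_def using that by (subst AE_density) (auto elim!: eventually_mono)
  have mass: "1 / 4 \<le> measure M UNIV" "measure M UNIV \<le> 1"
    using K'm MUNIV prob_le_1[of K'] by (auto simp: M.emeasure_eq_measure emeasure_eq_measure ennreal_less_iff)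
  have nnM: "(\<integral>\<^sup>+z. f z \<partial>M) \<le> (\<integral>\<^sup>+z. f z \<partial>\<nu>)" if [measurable]: "f \<in> borel_measurable borel" for f
    unfolding M_def by (subst nn_integral_density) (auto intro!: nn_integral_mono simp: indicator_def)
  have HK: "H (m j) w \<le> ennreal ((1/2) ^ j)" "H 0 w \<le> ennreal (8 * A)" if "w \<in> K'" for w j
  proof -
    have "w \<notin> bad j" "w \<notin> bad0" using that K'(1) by (auto simp: G_def BU_def)
    then have 1: "ennreal (2 ^ j) * H (m j) w \<le> 1" and 2: "ennreal (1 / (8 * A)) * H 0 w \<le> 1"
      by (auto simp: bad_def bad0_def)
    have "ennreal ((1/2) ^ j) * (ennreal (2 ^ j) * H (m j) w) \<le> ennreal ((1/2) ^ j) * 1"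
      by (rule mult_left_mono[OF 1]) simp
    moreover have "ennreal ((1/2) ^ j) * (ennreal (2 ^ j) * H (m j) w) = H (m j) w"
      by (simp add: mult.assoc[symmetric] ennreal_mult[symmetric] power_mult_distrib[symmetric])
    ultimately show "H (m j) w \<le> ennreal ((1/2) ^ j)" by simp
    have "ennreal (8 * A) * (ennreal (1 / (8 * A)) * H 0 w) \<le> ennreal (8 * A) * 1"
      by (rule mult_left_mono[OF 2]) simp
    moreover have "ennreal (8 * A) * (ennreal (1 / (8 * A)) * H 0 w) = H 0 w"
      using A by (simp add: mult.assoc[symmetric] ennreal_mult[symmetric])
    ultimately show "H 0 w \<le> ennreal (8 * A)" by simp
  qed
  have AEneq: "AE z in M. z \<noteq> y" for y
  proof (cases "y \<in> K'")
    case True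
    then have "H 0 y < \<infinity>" using HK(2)[OF True] by (auto simp: order_le_less_trans)
    from AEM2[OF neq[OF this]] show ?thesis .
  next
    case False with AEM show ?thesis by (auto elim!: eventually_mono)
  qed
  have K'K: "K' \<subseteq> K" "K' \<subseteq> B" using K'(1) by (auto simp: G_def)
  have gpos: "0 \<le> g (dist w z)" if "w \<in> K'" "z \<in> K'" "w \<noteq> z" for w z
  proof -
    have "w \<in> K" "z \<in> K" using that K'K(1) by auto
    then have "g L \<le> g (dist w z)" using that K(3) by (intro g_mono) auto
    then show ?thesis using gL(2) by linarith
  qed
  have iw: "integrable M (\<lambda>z. g (dist w z))" and gw: "(\<integral>z. g (dist w z) \<partial>M) \<le> 8 * A"
    and tailw: "(\<integral>z. max 0 (g (dist w z) - real (m j)) \<partial>M) \<le> (1/2) ^ j" 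
    if w: "w \<in> K'" for w j
  proof -
    have AE0: "AE z in M. 0 \<le> g (dist w z)"
      using AEM AEneq[of w] by eventually_elim (auto intro: gpos w)
    have "(\<integral>\<^sup>+z. ennreal (g (dist w z)) \<partial>M) \<le> (\<integral>\<^sup>+z. ennreal (g (dist w z)) \<partial>\<nu>)" by (rule nnM) measurable
    also have "\<dots> \<le> H 0 w" unfolding H_def by (intro nn_integral_mono) (simp add: h_def)
    also have "\<dots> \<le> ennreal (8 * A)" by (rule HK(2)[OF w])
    finally have le: "(\<integral>\<^sup>+z. ennreal (g (dist w z)) \<partial>M) \<le> ennreal (8 * A)" .
    show int: "integrable M (\<lambda>z. g (dist w z))"
      by (rule integrableI_nonneg) (use AE0 le in \<open>auto simp: order_le_less_trans\<close>)
    show "(\<integral>z. g (dist w z) \<partial>M) \<le> 8 * A"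
      using le A unfolding nn_integral_eq_integral[OF int AE0] by simp
    have int2: "integrable M (\<lambda>z. max 0 (g (dist w z) - real (m j)))"
      using int by (intro integrable_max Bochner_Integration.integrable_diff) auto
    have "ennreal (\<integral>z. max 0 (g (dist w z) - real (m j)) \<partial>M) = (\<integral>\<^sup>+z. ennreal (max 0 (g (dist w z) - real (m j))) \<partial>M)"
      by (rule nn_integral_eq_integral[symmetric, OF int2]) auto
    also have "\<dots> \<le> (\<integral>\<^sup>+z. ennreal (max 0 (g (dist w z) - real (m j))) \<partial>\<nu>)" by (rule nnM) measurable
    also have "\<dots> \<le> H (m j) w" unfolding H_def by (intro nn_integral_mono) (auto simp: h_def max_def ennreal_neg)
    also have "\<dots> \<le> ennreal ((1/2) ^ j)" by (rule HK(1)[OF w])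
    finally show "(\<integral>z. max 0 (g (dist w z) - real (m j)) \<partial>M) \<le> (1/2) ^ j" by simp
  qed
  have near: "\<exists>w\<in>K'. AE z in M. g (dist y z) \<le> a * g (dist w z) + b" for y
  proof -
    obtain w where w: "w \<in> K'" "\<And>z. z \<in> K' \<Longrightarrow> dist y w \<le> dist y z"
      using distance_attains_inf[of K' y] K' K'0 compact_imp_closed by blast
    have "AE z in M. g (dist y z) \<le> a * g (dist w z) + b"
      using AEM AEneq[of w]
    proof eventually_elim
      case (elim z)
      have "dist w z \<le> dist y w + dist y z" by (metis dist_commute dist_triangle)
      then have d: "dist w z / 2 \<le> dist y z" using w(2)[OF elim(1)] by linarith
      have "g (dist y z) \<le> g (dist w z / 2)" by (rule g_mono) (use d elim in auto)
      also have "\<dots> \<le> a * g (dist w z) + b" by (rule g_half) (use elim in auto)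
      finally show ?case .
    qed
    then show ?thesis using w(1) by blast
  qed
  have lower: "\<exists>c. \<forall>y z. dist y y0 < 1 \<longrightarrow> z \<in> K' \<longrightarrow> z \<noteq> y \<longrightarrow> - c \<le> g (dist y z)" for y0
  proof -
    obtain R where R: "\<And>z. z \<in> K' \<Longrightarrow> dist y0 z \<le> R"
      using compact_imp_bounded[OF K'(2)] by (auto simp: bounded_any_center[where a = y0])
    have "g (R + 1) \<le> g (dist y z)" if "dist y y0 < 1" "z \<in> K'" "z \<noteq> y" for y z
    proof (rule g_mono)
      show "0 < dist y z" using that by auto
      show "dist y z \<le> R + 1" using that R[of z] dist_triangle[of y z y0] by linarith
    qed
    then show ?thesis by (intro exI[of _ "- g (R + 1)"]) auto
  qed
  have int: "integrable M (\<lambda>z. g (dist y z))" for y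
  proof -
    obtain w where w: "w \<in> K'" and le: "AE z in M. g (dist y z) \<le> a * g (dist w z) + b"
      using near by blast
    obtain c where c: "\<And>z. z \<in> K' \<Longrightarrow> z \<noteq> y \<Longrightarrow> - c \<le> g (dist y z)" using lower[of y] by (metis dist_self zero_less_one)
    show ?thesis
    proof (rule Bochner_Integration.integrable_bound)
      show "integrable M (\<lambda>z. \<bar>c\<bar> + (a * g (dist w z) + b))" using iw[OF w] by simp
      show "AE z in M. norm (g (dist y z)) \<le> norm (\<bar>c\<bar> + (a * g (dist w z) + b))"
        using le AEM AEneq[of y] AEneq[of w]
      proof eventually_elim
        case (elim z)
        have "0 \<le> a * g (dist w z)" using gpos[OF w elim(2)] elim a by auto
        then show ?case using elim(1) c[OF elim(2,3)] b by auto
      qed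
    qed measurable
  qed
  have bound: "(\<integral>z. g (dist y z) \<partial>M) \<le> a * (8 * A) + b" for y
  proof -
    obtain w where w: "w \<in> K'" and le: "AE z in M. g (dist y z) \<le> a * g (dist w z) + b"
      using near by blast
    have "(\<integral>z. g (dist y z) \<partial>M) \<le> (\<integral>z. a * g (dist w z) + b \<partial>M)"
      by (rule integral_mono_AE) (use int le in auto)
    also have "\<dots> = a * (\<integral>z. g (dist w z) \<partial>M) + b * measure M UNIV" using int spM by simp
    also have "\<dots> \<le> a * (8 * A) + b * 1"
      using gw[OF w] a b mass by (intro add_mono mult_left_mono) auto
    finally show ?thesis by simp
  qed
  \<comment> \<open>The truncation levels are those at which the tail at a nearest point \<open>w\<close> drops below \<open>(1/2) ^ j\<close>, transported by \<open>g_half\<close>.\<close>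
  define V where "V = (\<lambda>j (y::'a). \<integral>z. min (g (dist y z)) (a * real (m j) + b) \<partial>M)"
  have Vc: "continuous_on UNIV (V j)" for j
    unfolding continuous_on_eq_continuous_at[OF open_UNIV] continuous_at
  proof
    fix y0
    obtain c where c: "\<And>y z. dist y y0 < 1 \<Longrightarrow> z \<in> K' \<Longrightarrow> z \<noteq> y \<Longrightarrow> - c \<le> g (dist y z)"
      using lower[of y0] by blast
    let ?T = "a * real (m j) + b"
    have T: "0 \<le> ?T" using a b by simp
    define f where "f = (\<lambda>(y::'a) z. if z = y then ?T else min (g (dist y z)) ?T)"
    have [measurable]: "f y \<in> borel_measurable borel" for y unfolding f_def by measurable
    have Vf: "V j y = (\<integral>z. f y z \<partial>M)" for y
      unfolding V_def
    proof (rule integral_cong_AE)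
      show "AE z in M. min (g (dist y z)) ?T = f y z"
        using AEneq[of y] by eventually_elim (simp add: f_def)
    qed measurable
    have "((\<lambda>y. integral\<^sup>L M (f y)) \<longlongrightarrow> integral\<^sup>L M (f y0)) (at y0)"
    proof (rule tendsto_integral_at[OF finM zero_less_one, where C = "\<bar>c\<bar> + ?T"])
      show "AE z in M. ((\<lambda>y. f y z) \<longlongrightarrow> f y0 z) (at y0)"
        using AEneq[of y0]
      proof eventually_elim
        case (elim z)
        then have d: "0 < dist y0 z" by auto
        have gc: "isCont g (dist y0 z)"
          using g_cont d by (simp add: continuous_on_eq_continuous_at)
        have "((\<lambda>y. dist y z) \<longlongrightarrow> dist y0 z) (at y0)" by (intro tendsto_intros)
        from isCont_tendsto_compose[OF gc this]
        have "((\<lambda>y. min (g (dist y z)) ?T) \<longlongrightarrow> min (g (dist y0 z)) ?T) (at y0)"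
          by (intro tendsto_min tendsto_const)
        moreover have "\<forall>\<^sub>F y in at y0. min (g (dist y z)) ?T = f y z"
          unfolding eventually_at by (intro exI[of _ "dist y0 z"]) (use d in \<open>auto simp: f_def dist_commute\<close>)
        ultimately show ?case
          using elim by (auto simp: f_def[THEN fun_cong, THEN fun_cong, of y0] intro: Lim_transform_eventually)
      qed
      show "AE z in M. \<forall>y\<in>UNIV. dist y y0 < 1 \<longrightarrow> y \<noteq> y0 \<longrightarrow> norm (f y z) \<le> \<bar>c\<bar> + ?T"
        using AEM
      proof (eventually_elim, intro ballI impI)
        fix z y assume z: "z \<in> K'" and y: "dist y y0 < 1"
        show "norm (f y z) \<le> \<bar>c\<bar> + ?T"
        proof (cases "z = y")
          case False
          then show ?thesis using c[OF y z False] T by (auto simp: f_def min_def)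
        qed (use T in \<open>simp add: f_def\<close>)
      qed
    qed auto
    then show "(V j \<longlongrightarrow> V j y0) (at y0)" by (simp add: Vf[abs_def] Vf)
  qed
  have "uniform_limit UNIV V (\<lambda>y. \<integral>z. g (dist y z) \<partial>M) sequentially"
  proof (rule uniform_limitI)
    fix e :: real assume e: "0 < e"
    have "(\<lambda>j. a * (1/2 :: real) ^ j) \<longlonglongrightarrow> a * 0" by (intro tendsto_intros LIMSEQ_power_zero) auto
    then have "\<forall>\<^sub>F j in sequentially. a * (1/2 :: real) ^ j < e" using e by (simp add: order_tendstoD(2))
    then show "\<forall>\<^sub>F j in sequentially. \<forall>y\<in>UNIV. dist (V j y) (\<integral>z. g (dist y z) \<partial>M) < e"
    proof eventually_elim
      case (elim j)
      show ?case
      proof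
        fix y
        let ?T = "a * real (m j) + b"
        obtain w where w: "w \<in> K'" and le: "AE z in M. g (dist y z) \<le> a * g (dist w z) + b"
          using near by blast
        have imin: "integrable M (\<lambda>z. min (g (dist y z)) ?T)" using int by (intro integrable_min) auto
        have imax: "integrable M (\<lambda>z. max 0 (g (dist w z) - real (m j)))"
          using int by (intro integrable_max Bochner_Integration.integrable_diff) auto
        have "(\<integral>z. g (dist y z) \<partial>M) - V j y = (\<integral>z. g (dist y z) - min (g (dist y z)) ?T \<partial>M)"
          unfolding V_def using int imin by simp
        also have "\<dots> \<le> (\<integral>z. a * max 0 (g (dist w z) - real (m j)) \<partial>M)"
        proof (rule integral_mono_AE)
          show "AE z in M. g (dist y z) - min (g (dist y z)) ?T \<le> a * max 0 (g (dist w z) - real (m j))"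
            using le
          proof eventually_elim
            case (elim z)
            have "g (dist y z) - min (g (dist y z)) ?T \<le> max 0 (a * (g (dist w z) - real (m j)))"
              using elim by (auto simp: min_def max_def algebra_simps)
            also have "\<dots> \<le> a * max 0 (g (dist w z) - real (m j))"
              using a by (auto simp: max_def mult_nonneg_nonneg mult_le_0_iff)
            finally show ?case .
          qed
        qed (use int imin imax in auto)
        also have "\<dots> = a * (\<integral>z. max 0 (g (dist w z) - real (m j)) \<partial>M)" by simp
        also have "\<dots> \<le> a * (1/2) ^ j" using tailw[OF w] a by (intro mult_left_mono) auto
        finally have "(\<integral>z. g (dist y z) \<partial>M) - V j y < e" using elim by linarith
        moreover have "V j y \<le> (\<integral>z. g (dist y z) \<partial>M)"
          unfolding V_def by (rule integral_mono) (use int imin in auto)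
        ultimately show "dist (V j y) (\<integral>z. g (dist y z) \<partial>M) < e" by (simp add: dist_real_def)
      qed
    qed
  qed
  then have cont: "continuous_on UNIV (\<lambda>y. \<integral>z. g (dist y z) \<partial>M)"
    by (rule uniform_limit_theorem[rotated]) (auto simp: Vc)
  show thesis
    by (rule that[OF finM setsM K'(2) K'K(2,1) K'0 AEM AEneq mass int cont bound])
qed

text \<open>Up to a constant factor this is the gradient of the Newtonian kernel and, in the plane, of
  the logarithmic one; \<open>kernel_hess\<close> is its derivative.\<close>

definition kernel_grad :: "real ^ 'n \<Rightarrow> real ^ 'n" where
  "kernel_grad w = inverse (norm w ^ CARD('n)) *\<^sub>R w"

definition kernel_hess :: "real ^ 'n \<Rightarrow> real ^ 'n ^ 'n" where
  "kernel_hess w = inverse (norm w ^ CARD('n)) *\<^sub>R mat 1 -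
     (real CARD('n) * inverse (norm w ^ (CARD('n) + 2))) *\<^sub>R (\<chi> i j. w $ i * w $ j)"

lemma kernel_hess_mult:
  "kernel_hess w *v h = inverse (norm w ^ CARD('n)) *\<^sub>R h -
     (real CARD('n) * inverse (norm w ^ (CARD('n) + 2)) * (w \<bullet> h)) *\<^sub>R w"
  for w :: "real ^ 'n"
proof -
  have "(\<chi> i j. w $ i * w $ j) *v h = (w \<bullet> h) *\<^sub>R w"
    by (simp add: vec_eq_iff matrix_vector_mult_def inner_vec_def sum_distrib_left sum_distrib_right mult_ac)
  then show ?thesis
    by (simp add: kernel_hess_def matrix_vector_mult_diff_rdistrib scaleR_matrix_vector_assoc[symmetric])
qed

lemma trace_kernel_hess:
  fixes w :: "real ^ 'n"
  assumes "w \<noteq> 0"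
  shows "trace (kernel_hess w) = 0"
proof -
  have "(\<Sum>i\<in>UNIV. w $ i * w $ i) = (norm w)\<^sup>2"
    by (simp add: power2_norm_eq_inner inner_vec_def)
  then have "trace (kernel_hess w) = real CARD('n) * inverse (norm w ^ CARD('n)) -
      real CARD('n) * inverse (norm w ^ (CARD('n) + 2)) * (norm w)\<^sup>2"
    by (simp add: kernel_hess_def trace_def sum_subtractf sum_distrib_left[symmetric] mat_def)
  also have "\<dots> = 0" using assms by (simp add: field_simps power_add power2_eq_square)
  finally show ?thesis .
qed

lemma has_derivative_kernel_grad:
  fixes w :: "real ^ 'n"
  assumes "w \<noteq> 0"
  shows "(kernel_grad has_derivative (\<lambda>h. kernel_hess w *v h)) (at w)"
proof -
  let ?n = "CARD('n)"
  have n0: "0 < ?n" by simp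
  have nw: "norm w > 0" using assms by simp
  have eq: "norm w ^ (?n + 2) = norm w ^ (?n - 1) * norm w ^ 3" 
    using n0 by (simp flip: power_add)
  have eq2: "norm w ^ ?n = norm w ^ (?n - 1) * norm w" 
    by (metis n0 power_minus_mult)
  have "((\<lambda>w. inverse (norm w ^ ?n) *\<^sub>R w) has_derivative
     (\<lambda>h. inverse (norm w ^ ?n) *\<^sub>R h + (- (inverse (norm w ^ ?n) * (of_nat ?n * (h \<bullet> sgn w) * norm w ^ (?n - 1)) * inverse (norm w ^ ?n))) *\<^sub>R w)) (at w)"
    using assms by (auto intro!: derivative_eq_intros has_derivative_norm)
  moreover have "inverse (norm w ^ ?n) * (of_nat ?n * (h \<bullet> sgn w) * norm w ^ (?n - 1)) * inverse (norm w ^ ?n) =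
     real ?n * inverse (norm w ^ (?n + 2)) * (w \<bullet> h)" for h
    unfolding eq eq2 using nw
    by (simp add: sgn_div_norm inner_commute field_simps power3_eq_cube)
  ultimately show ?thesis
    unfolding kernel_grad_def[abs_def] kernel_hess_mult by (simp only: scaleR_minus_left add_uminus_conv_diff)
qed

lemma has_derivative_newton_kernel:
  fixes w :: "real ^ 'n"
  assumes "w \<noteq> 0" "CARD('n) \<ge> 3"
  shows "((\<lambda>w. inverse (norm w ^ (CARD('n) - 2))) has_derivative (\<lambda>h. - real (CARD('n) - 2) * (kernel_grad w \<bullet> h))) (at w)"
proof -
  obtain k where k: "CARD('n) = k + 3" using assms(2) by (metis add.commute le_Suc_ex)
  have nw: "norm w > 0" using assms by simp
  have "((\<lambda>w. inverse (norm w ^ Suc k)) has_derivative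
      (\<lambda>h. - (inverse (norm w ^ Suc k) * (real (Suc k) * (h \<bullet> sgn w) * norm w ^ k) * inverse (norm w ^ Suc k)))) (at w)"
    using assms by (auto intro!: derivative_eq_intros has_derivative_norm simp del: power_Suc of_nat_Suc)
  moreover have "inverse (norm w ^ Suc k) * (real (Suc k) * (h \<bullet> sgn w) * norm w ^ k) * inverse (norm w ^ Suc k) =
      real (Suc k) * (kernel_grad w \<bullet> h)" for h
    using nw by (simp add: kernel_grad_def k sgn_div_norm inner_commute field_simps power_add eval_nat_numeral)
  moreover have "CARD('n) - 2 = Suc k" using k by simp
  ultimately show ?thesis by (simp only: mult_minus_left)
qed

lemma has_derivative_log_kernel:
  fixes w :: "real ^ 'n"
  assumes "w \<noteq> 0" "CARD('n) = 2" "c > 0"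
  shows "((\<lambda>w. ln (c / norm w)) has_derivative (\<lambda>h. - 1 * (kernel_grad w \<bullet> h))) (at w)"
proof -
  have nw: "norm w > 0" using assms by simp
  have "((\<lambda>w. ln (c / norm w)) has_derivative (\<lambda>h. - (h \<bullet> sgn w) / norm w)) (at w)"
    using assms(1,3) nw
    by (auto intro!: derivative_eq_intros has_derivative_norm simp: field_simps)
  moreover have "(h \<bullet> sgn w) / norm w = kernel_grad w \<bullet> h" for h
    using nw by (simp add: kernel_grad_def assms(2) sgn_div_norm inner_commute field_simps power2_eq_square)
  ultimately show ?thesis by simp
qed

text \<open>The kernel is smooth at positive distance from its pole, with bounds that are uniform as
  long as the pole stays in \<open>K\<close> and the point near \<open>y0\<close>. So the first two derivatives pass under
  the integral, and the trace of the second one vanishes pointwise.\<close>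

lemma harmonic_potential:
  fixes M :: "(real ^ 'n) measure" and g :: "real \<Rightarrow> real"
  assumes fin: "finite_measure M" and sets: "sets M = sets borel"
    and K: "compact K" "K \<noteq> {}" "AE z in M. z \<in> K" and "K \<inter> \<Omega> = {}"
    and int: "\<And>y. integrable M (\<lambda>z. g (dist y z))"
    and dg: "\<And>w :: real ^ 'n. w \<noteq> 0 \<Longrightarrow> ((\<lambda>w. g (norm w)) has_derivative (\<lambda>h. - \<kappa> * (kernel_grad w \<bullet> h))) (at w)"
  shows "harmonic_on \<Omega> (\<lambda>y. \<integral>z. g (dist y z) \<partial>M)"
proof -
  interpret finite_measure M by fact
  note [measurable_cong] = sets
  let ?n = "CARD('n)"
  have cg: "continuous_on (- {0}) (kernel_grad :: real ^ 'n \<Rightarrow> _)"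
    unfolding kernel_grad_def[abs_def] by (auto intro!: continuous_intros)
  have couter: "continuous_on S (\<lambda>w :: real ^ 'n. (\<chi> i j. w $ i * w $ j))" for S
    by (intro continuous_intros continuous_on_vec_lambda)
  have ch: "continuous_on (- {0}) (kernel_hess :: real ^ 'n \<Rightarrow> _)"
    unfolding kernel_hess_def[abs_def] by (intro continuous_intros couter) auto
  have [measurable]: "(\<lambda>w :: real ^ 'n. (\<chi> i j. w $ i * w $ j)) \<in> borel_measurable borel"
    by (intro borel_measurable_continuous_onI couter)
  have [measurable]: "(kernel_grad :: real ^ 'n \<Rightarrow> _) \<in> borel_measurable borel"
    unfolding kernel_grad_def[abs_def] by measurable
  have [measurable]: "(kernel_hess :: real ^ 'n \<Rightarrow> _) \<in> borel_measurable borel"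
    unfolding kernel_hess_def[abs_def] by measurable
  have loc: "\<exists>e>0. \<exists>G. \<forall>y z. dist y y0 < e \<longrightarrow> z \<in> K \<longrightarrow>
      y \<noteq> z \<and> norm (kernel_grad (y - z)) \<le> G \<and> norm (kernel_hess (y - z)) \<le> G \<and>
      (\<forall>h. norm (kernel_hess (y - z) *v h) \<le> G * norm h)" if y0: "y0 \<in> \<Omega>" for y0
  proof -
    have "y0 \<notin> K" using assms(6) y0 by auto
    then have d: "infdist y0 K > 0" using K by (simp add: infdist_pos_not_in_closed compact_imp_closed)
    define e where "e = infdist y0 K / 2"
    have e: "e > 0" using d by (simp add: e_def)
    define S where "S = {y - z | y z. y \<in> cball y0 e \<and> z \<in> K}"
    have far: "norm (y - z) \<ge> e" if "y \<in> cball y0 e" "z \<in> K" for y z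
      using that infdist_le[OF that(2), of y0] dist_triangle[of y0 z y]
      by (auto simp: e_def dist_norm)
    have "compact S" unfolding S_def using K(1) by (intro compact_differences) auto
    moreover have S0: "S \<subseteq> - {0}" using far e unfolding S_def by force
    ultimately have "bounded (kernel_grad ` S)" "bounded (kernel_hess ` S)"
      by (auto intro!: compact_imp_bounded compact_continuous_image intro: continuous_on_subset[OF cg] continuous_on_subset[OF ch])
    then obtain G1 G2 where G: "\<And>w. w \<in> S \<Longrightarrow> norm (kernel_grad w) \<le> G1" "\<And>w. w \<in> S \<Longrightarrow> norm (kernel_hess w) \<le> G2"
      by (auto simp: bounded_iff)
    define G3 where "G3 = (1 + real ?n) * inverse (e ^ ?n)"
    have hb: "norm (kernel_hess (y - z) *v h) \<le> G3 * norm h" if "y \<in> cball y0 e" "z \<in> K" for y z and h :: "real ^ 'n"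
    proof -
      let ?w = "y - z"
      have w: "norm ?w \<ge> e" by (rule far[OF that])
      have w0: "norm ?w > 0" using w e by linarith
      have "norm (kernel_hess ?w *v h) \<le> norm (inverse (norm ?w ^ ?n) *\<^sub>R h) +
        norm ((real ?n * inverse (norm ?w ^ (?n + 2)) * (?w \<bullet> h)) *\<^sub>R ?w)"
        unfolding kernel_hess_mult by (rule norm_triangle_ineq4)
      also have "\<dots> \<le> inverse (norm ?w ^ ?n) * norm h + (real ?n * inverse (norm ?w ^ (?n + 2)) * (norm ?w * norm h)) * norm ?w"
        unfolding norm_scaleR abs_mult using Cauchy_Schwarz_ineq2[of ?w h]
        by (intro add_mono mult_mono) auto
      also have "\<dots> = (1 + real ?n) * inverse (norm ?w ^ ?n) * norm h"
        using w0 by (simp add: field_simps power_add power2_eq_square)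
      also have "\<dots> \<le> (1 + real ?n) * inverse (e ^ ?n) * norm h"
        using w e by (intro mult_right_mono mult_left_mono le_imp_inverse_le power_mono) auto
      finally show ?thesis by (simp add: G3_def)
    qed
    define G where "G = max (max G1 G2) G3"
    have "y \<noteq> z \<and> norm (kernel_grad (y - z)) \<le> G \<and> norm (kernel_hess (y - z)) \<le> G \<and>
      (\<forall>h. norm (kernel_hess (y - z) *v h) \<le> G * norm h)" if "dist y y0 < e" "z \<in> K" for y z
    proof (intro conjI allI)
      have y: "y \<in> cball y0 e" using that by (simp add: dist_commute)
      then have "y - z \<in> S" using that unfolding S_def by blast
      then show "norm (kernel_grad (y - z)) \<le> G" "norm (kernel_hess (y - z)) \<le> G"
        using G unfolding G_def by (auto simp: le_max_iff_disj)
      show "y \<noteq> z" using far[OF y that(2)] e by auto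
      fix h :: "real ^ 'n"
      have "G3 * norm h \<le> G * norm h" by (intro mult_right_mono) (auto simp: G_def)
      then show "norm (kernel_hess (y - z) *v h) \<le> G * norm h" using hb[OF y that(2), of h] by linarith
    qed
    then show ?thesis using e by blast
  qed
  define Gv where "Gv = (\<lambda>y. - \<kappa> *\<^sub>R (\<integral>z. kernel_grad (y - z) \<partial>M))"
  define Hv where "Hv = (\<lambda>y. - \<kappa> *\<^sub>R (\<integral>z. kernel_hess (y - z) \<partial>M))"
  have igrad: "integrable M (\<lambda>z. kernel_grad (y - z))" and ihess: "integrable M (\<lambda>z. kernel_hess (y - z))" if "y \<in> \<Omega>" for y
  proof -
    from loc[OF that] obtain G where *: "\<forall>z. z \<in> K \<longrightarrow> norm (kernel_grad (y - z)) \<le> G \<and> norm (kernel_hess (y - z)) \<le> G"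
      by (metis dist_self)
    show "integrable M (\<lambda>z. kernel_grad (y - z))" "integrable M (\<lambda>z. kernel_hess (y - z))"
      using * K(3) by (auto intro!: integrable_const_bound[where B = G] elim!: eventually_mono)
  qed
  have bl1: "bounded_linear (\<lambda>A :: real ^ 'n ^ 'n. A *v h)" for h
    by (simp add: linear_conv_bounded_linear[symmetric])
       (auto intro!: linearI simp: matrix_vector_mult_add_rdistrib scaleR_matrix_vector_assoc)
  have bl2: "bounded_linear (trace :: real ^ 'n ^ 'n \<Rightarrow> real)"
    by (simp add: linear_conv_bounded_linear[symmetric])
       (auto intro!: linearI simp: trace_def sum.distrib sum_distrib_left)
  show ?thesis
    unfolding harmonic_on_def
  proof (intro exI[of _ Gv] exI[of _ Hv] conjI ballI)
    fix y0 assume y0: "y0 \<in> \<Omega>"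
    obtain e G where e: "e > 0" and G: "\<And>y z. dist y y0 < e \<Longrightarrow> z \<in> K \<Longrightarrow>
      y \<noteq> z \<and> norm (kernel_grad (y - z)) \<le> G \<and> norm (kernel_hess (y - z)) \<le> G \<and>
      (\<forall>h. norm (kernel_hess (y - z) *v h) \<le> G * norm h)" using loc[OF y0] by blast
    have "((\<lambda>y. \<integral>z. g (dist y z) \<partial>M) has_derivative (\<lambda>h. \<integral>z. - \<kappa> * (kernel_grad (y0 - z) \<bullet> h) \<partial>M)) (at y0)"
    proof (rule has_derivative_integral[OF fin e int, where C = "\<bar>\<kappa>\<bar> * G" and f' = "\<lambda>y z h. - \<kappa> * (kernel_grad (y - z) \<bullet> h)"])
      show "AE z in M. \<forall>y. dist y y0 < e \<longrightarrow> ((\<lambda>y. g (dist y z)) has_derivative (\<lambda>h. - \<kappa> * (kernel_grad (y - z) \<bullet> h))) (at y) \<and>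
         (\<forall>h. norm (- \<kappa> * (kernel_grad (y - z) \<bullet> h)) \<le> \<bar>\<kappa>\<bar> * G * norm h)"
        using K(3)
      proof (eventually_elim, intro allI impI conjI)
        fix z y h :: "real ^ 'n" assume z: "z \<in> K" and y: "dist y y0 < e"
        note Gy = G[OF y z]
        have "((\<lambda>y. y - z) has_derivative (\<lambda>h. h)) (at y)" by (auto intro!: derivative_eq_intros)
        from has_derivative_compose[OF this dg[of "y - z"]] Gy
        show "((\<lambda>y. g (dist y z)) has_derivative (\<lambda>h. - \<kappa> * (kernel_grad (y - z) \<bullet> h))) (at y)"
          by (simp add: dist_norm)
        have "\<bar>kernel_grad (y - z) \<bullet> h\<bar> \<le> norm (kernel_grad (y - z)) * norm h" by (rule Cauchy_Schwarz_ineq2)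
        also have "\<dots> \<le> G * norm h" using Gy by (intro mult_right_mono) auto
        finally show "norm (- \<kappa> * (kernel_grad (y - z) \<bullet> h)) \<le> \<bar>\<kappa>\<bar> * G * norm h"
          by (simp add: abs_mult mult.assoc mult_left_mono)
      qed
    qed measurable
    then show "((\<lambda>y. \<integral>z. g (dist y z) \<partial>M) has_derivative (\<lambda>h. Gv y0 \<bullet> h)) (at y0)"
      using igrad[OF y0] by (simp add: Gv_def)
    have "((\<lambda>y. \<integral>z. kernel_grad (y - z) \<partial>M) has_derivative (\<lambda>h. \<integral>z. kernel_hess (y0 - z) *v h \<partial>M)) (at y0)"
    proof (rule has_derivative_integral[OF fin e, where C = G and f' = "\<lambda>y z h. kernel_hess (y - z) *v h"])
      show "integrable M (\<lambda>z. kernel_grad (y - z))" if "dist y y0 < e" for y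
        using G[OF that] K(3) by (auto intro!: integrable_const_bound[where B = G] elim!: eventually_mono)
      show "AE z in M. \<forall>y. dist y y0 < e \<longrightarrow> ((\<lambda>y. kernel_grad (y - z)) has_derivative (\<lambda>h. kernel_hess (y - z) *v h)) (at y) \<and>
         (\<forall>h. norm (kernel_hess (y - z) *v h) \<le> G * norm h)"
        using K(3)
      proof (eventually_elim, intro allI impI conjI)
        fix z y h :: "real ^ 'n" assume z: "z \<in> K" and y: "dist y y0 < e"
        note Gy = G[OF y z]
        have "((\<lambda>y. y - z) has_derivative (\<lambda>h. h)) (at y)" by (auto intro!: derivative_eq_intros)
        from has_derivative_compose[OF this has_derivative_kernel_grad[of "y - z"]] Gy
        show "((\<lambda>y. kernel_grad (y - z)) has_derivative (\<lambda>h. kernel_hess (y - z) *v h)) (at y)" by simp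
        show "norm (kernel_hess (y - z) *v h) \<le> G * norm h" using Gy by blast
      qed
      fix h
      have [measurable]: "(\<lambda>A :: real ^ 'n ^ 'n. A *v h) \<in> borel_measurable borel"
        using bl1[of h] by (simp add: borel_measurable_continuous_onI linear_continuous_on)
      show "(\<lambda>z. kernel_hess (y0 - z) *v h) \<in> borel_measurable M" by measurable
    qed
    then have "((\<lambda>y. \<integral>z. kernel_grad (y - z) \<partial>M) has_derivative (\<lambda>h. (\<integral>z. kernel_hess (y0 - z) \<partial>M) *v h)) (at y0)"
      using integral_bounded_linear[OF bl1 ihess[OF y0]] by simp
    then have "((\<lambda>y. - \<kappa> *\<^sub>R (\<integral>z. kernel_grad (y - z) \<partial>M)) has_derivative (\<lambda>h. - \<kappa> *\<^sub>R ((\<integral>z. kernel_hess (y0 - z) \<partial>M) *v h))) (at y0)"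
      by (rule has_derivative_scaleR_right)
    then show "(Gv has_derivative (\<lambda>h. Hv y0 *v h)) (at y0)"
      unfolding Gv_def Hv_def by (simp only: scaleR_matrix_vector_assoc)
    have "trace (\<integral>z. kernel_hess (y0 - z) \<partial>M) = (\<integral>z. trace (kernel_hess (y0 - z)) \<partial>M)"
      by (rule integral_bounded_linear[OF bl2 ihess[OF y0], symmetric])
    also have "\<dots> = (\<integral>z. 0 \<partial>M)"
    proof (rule integral_cong_AE)
      show "AE z in M. trace (kernel_hess (y0 - z)) = 0"
        using K(3) by eventually_elim (use G[of y0] e in \<open>auto intro!: trace_kernel_hess\<close>)
      have [measurable]: "(trace :: real ^ 'n ^ 'n \<Rightarrow> real) \<in> borel_measurable borel"
        using bl2 by (simp add: borel_measurable_continuous_onI linear_continuous_on)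
      show "(\<lambda>z. trace (kernel_hess (y0 - z))) \<in> borel_measurable M" by measurable
    qed simp
    finally show "trace (Hv y0) = 0"
      using bounded_linear.linear[OF bl2] by (simp add: Hv_def linear_neg linear_scale)
  next
    show "continuous_on \<Omega> Hv"
      unfolding continuous_on_def
    proof
      fix y0 assume y0: "y0 \<in> \<Omega>"
      obtain e G where e: "e > 0" and G: "\<And>y z. dist y y0 < e \<Longrightarrow> z \<in> K \<Longrightarrow>
        y \<noteq> z \<and> norm (kernel_grad (y - z)) \<le> G \<and> norm (kernel_hess (y - z)) \<le> G \<and>
        (\<forall>h. norm (kernel_hess (y - z) *v h) \<le> G * norm h)" using loc[OF y0] by blast
      have "((\<lambda>y. \<integral>z. kernel_hess (y - z) \<partial>M) \<longlongrightarrow> (\<integral>z. kernel_hess (y0 - z) \<partial>M)) (at y0 within \<Omega>)"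
      proof (rule tendsto_integral_at[OF fin e, where C = G])
        show "AE z in M. ((\<lambda>y. kernel_hess (y - z)) \<longlongrightarrow> kernel_hess (y0 - z)) (at y0 within \<Omega>)"
          using K(3)
        proof eventually_elim
          case (elim z)
          then have "y0 - z \<noteq> 0" using G[of y0 z] e by auto
          then have "isCont kernel_hess (y0 - z)"
            using ch by (subst (asm) continuous_on_eq_continuous_at) auto
          then show ?case by (rule isCont_tendsto_compose) (intro tendsto_intros)
        qed
        show "AE z in M. \<forall>y\<in>\<Omega>. dist y y0 < e \<longrightarrow> y \<noteq> y0 \<longrightarrow> norm (kernel_hess (y - z)) \<le> G"
          using K(3) by eventually_elim (use G in blast)
      qed measurable
      then show "(Hv \<longlongrightarrow> Hv y0) (at y0 within \<Omega>)"
        unfolding Hv_def by (intro tendsto_intros)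
    qed
  qed
qed

section \<open>Capacity and measures of bounded energy\<close>

lemma dist_le_ball_ball: "y \<in> ball x s \<Longrightarrow> z \<in> ball x s \<Longrightarrow> dist y z \<le> 2 * s"
  using dist_triangle[of y z x] by (simp add: dist_commute)

lemma ennreal_inverse_antimono: "a \<le> b \<Longrightarrow> inverse b \<le> inverse (a :: ennreal)"
  by (simp add: less_eq_ennreal.rep_eq inverse_ennreal.rep_eq ereal_inverse_antimono)

lemma ennreal_inverse_inverse: "inverse (inverse x) = (x :: ennreal)"
  by (cases x rule: ennreal_cases; cases "x = 0") (auto simp: inverse_ennreal)

lemma newtonian_capacity_measure:
  assumes "newtonian_capacity E \<ge> ennreal c" "c > 0"
  obtains \<nu> where "\<nu> \<in> compact_prob_measures E" "newtonian_energy \<nu> \<le> ennreal (2 / c)"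
proof -
  let ?I = "INF \<mu>\<in>compact_prob_measures E. newtonian_energy \<mu>"
  have "?I = inverse (inverse ?I)" by (simp only: ennreal_inverse_inverse)
  also have "\<dots> \<le> inverse (ennreal c)"
    using assms(1) unfolding newtonian_capacity_def by (rule ennreal_inverse_antimono)
  also have "\<dots> = ennreal (1 / c)" using assms(2) by (simp add: inverse_ennreal inverse_eq_divide)
  also have "\<dots> < ennreal (2 / c)" using assms(2) by (intro ennreal_lessI divide_strict_right_mono) auto
  finally show ?thesis using that by (auto simp: INF_less_iff)
qed

lemma logarithmic_capacity_measure:
  assumes "logarithmic_capacity E \<ge> ennreal c" "c > 0"
  obtains \<nu> where "\<nu> \<in> compact_prob_measures E" "log_energy \<nu> \<le> ereal (ln (2 / c))"
proof -
  let ?I = "INF \<mu>\<in>compact_prob_measures E. log_energy \<mu>"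
  have "?I < ereal (ln (2 / c))"
  proof (cases ?I)
    case (real v)
    then have "ennreal c \<le> ennreal (exp (- v))"
      using assms(1) unfolding logarithmic_capacity_def by simp
    then have "c \<le> exp (- v)" by (simp add: ennreal_le_iff)
    then have "ln c \<le> - v" using assms(2) by (metis exp_gt_zero ln_exp ln_le_cancel_iff)
    moreover have "ln (2 / c) = ln 2 - ln c" using assms(2) by (simp add: ln_div)
    moreover have "ln (2 :: real) > 0" by simp
    ultimately have "v < ln (2 / c)" by linarith
    then show ?thesis using real by simp
  next
    case PInf
    then show ?thesis using assms unfolding logarithmic_capacity_def by simp
  qed simp
  then show ?thesis using that by (auto simp: INF_less_iff)
qed

text \<open>Two points of the ball have distance at most \<open>2 s\<close>, which bounds the kernel and with it
  every energy from below.\<close>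

lemma newtonian_capacity_ball_le:
  fixes E :: "(real ^ 'n) set"
  assumes "E \<subseteq> ball x s" "0 < s"
  shows "newtonian_capacity E \<le> ennreal ((2 * s) ^ (CARD('n) - 2))"
proof -
  let ?m = "CARD('n) - 2"
  have "ennreal (inverse ((2 * s) ^ ?m)) \<le> newtonian_energy \<mu>" if \<mu>: "\<mu> \<in> compact_prob_measures E" for \<mu>
  proof -
    obtain K where K: "prob_space \<mu>" "sets \<mu> = sets borel" "compact K" "K \<subseteq> E" "emeasure \<mu> K = 1"
      using \<mu> by (auto simp: compact_prob_measures_def)
    interpret prob_space \<mu> by fact
    have Km [measurable]: "K \<in> sets \<mu>" using K by (simp add: compact_imp_closed)
    let ?b = "ennreal (inverse ((2 * s) ^ ?m))"
    have le: "?b \<le> inverse (ennreal (dist y z ^ ?m))" if "y \<in> K" "z \<in> K" for y z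
    proof -
      have "dist y z \<le> 2 * s"
        using that K(4) assms(1) by (intro dist_le_ball_ball[of _ x]) auto
      then have "ennreal (dist y z ^ ?m) \<le> ennreal ((2 * s) ^ ?m)" by (intro ennreal_leI power_mono) auto
      then have "inverse (ennreal ((2 * s) ^ ?m)) \<le> inverse (ennreal (dist y z ^ ?m))"
        by (rule ennreal_inverse_antimono)
      then show ?thesis using assms(2) by (simp add: inverse_ennreal)
    qed
    have i: "?b * indicator K y \<le> (\<integral>\<^sup>+z. inverse (ennreal (dist y z ^ ?m)) \<partial>\<mu>)" for y
    proof (cases "y \<in> K")
      case True
      have "?b = (\<integral>\<^sup>+z. ?b * indicator K z \<partial>\<mu>)" using K(5) by (simp add: nn_integral_cmult)
      also have "\<dots> \<le> (\<integral>\<^sup>+z. inverse (ennreal (dist y z ^ ?m)) \<partial>\<mu>)"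
        using le[OF True] by (intro nn_integral_mono) (auto simp: indicator_def)
      finally show ?thesis using True by simp
    qed simp
    have "?b = (\<integral>\<^sup>+y. ?b * indicator K y \<partial>\<mu>)" using K(5) by (simp add: nn_integral_cmult)
    also have "\<dots> \<le> newtonian_energy \<mu>"
      unfolding newtonian_energy_def by (intro nn_integral_mono i)
    finally show ?thesis .
  qed
  then have "ennreal (inverse ((2 * s) ^ ?m)) \<le> (INF \<mu>\<in>compact_prob_measures E. newtonian_energy \<mu>)"
    by (rule INF_greatest)
  then have "newtonian_capacity E \<le> inverse (ennreal (inverse ((2 * s) ^ ?m)))"
    unfolding newtonian_capacity_def by (rule ennreal_inverse_antimono)
  also have "\<dots> = ennreal ((2 * s) ^ ?m)" using assms(2) by (simp add: inverse_ennreal)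
  finally show ?thesis .
qed

lemma measurable_log_kernel [measurable (raw)]:
  assumes [measurable]: "f \<in> borel_measurable M" "g \<in> borel_measurable M"
  shows "(\<lambda>x. log_kernel (f x) (g x)) \<in> borel_measurable M"
proof -
  have "(\<lambda>x. log_kernel (f x) (g x)) = (\<lambda>x. if dist (f x) (g x) = 0 then \<infinity> else ereal (ln (1 / dist (f x) (g x))))"
    by (simp add: log_kernel_def fun_eq_iff)
  then show ?thesis by simp
qed

lemma logarithmic_capacity_ball_le:
  fixes E :: "(real ^ 'n) set"
  assumes "E \<subseteq> ball x s" "0 < s"
  shows "logarithmic_capacity E \<le> ennreal (2 * s)"
proof -
  define l where "l = ln (1 / (2 * s))"
  have "ereal l \<le> log_energy \<mu>" if \<mu>: "\<mu> \<in> compact_prob_measures E" for \<mu>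
  proof -
    obtain K where K: "prob_space \<mu>" "sets \<mu> = sets borel" "compact K" "K \<subseteq> E" "emeasure \<mu> K = 1"
      using \<mu> by (auto simp: compact_prob_measures_def)
    interpret prob_space \<mu> by fact
    have Km [measurable]: "K \<in> sets \<mu>" using K by (simp add: compact_imp_closed)
    have AEK: "AE z in \<mu>. z \<in> K"
      using K(5) Km by (simp add: prob_eq_1[symmetric] measure_def)
    have le: "ereal l \<le> log_kernel y z" if "y \<in> K" "z \<in> K" for y z
    proof (cases "y = z")
      case False
      have "dist y z \<le> 2 * s"
        using that K(4) assms(1) by (intro dist_le_ball_ball[of _ x]) auto
      then have "1 / (2 * s) \<le> 1 / dist y z" using False assms(2) by (simp add: frac_le)
      then have "l \<le> ln (1 / dist y z)" unfolding l_def using False assms(2) by (subst ln_le_cancel_iff) auto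
      then show ?thesis using False by (simp add: log_kernel_def)
    qed (simp add: log_kernel_def)
    have const: "(\<integral>\<^sup>+ x. (\<integral>\<^sup>+ y. ennreal c \<partial>\<mu>) \<partial>\<mu>) = ennreal c" for c by (simp add: emeasure_space_1)
    have P: "ennreal l \<le> (\<integral>\<^sup>+ x. (\<integral>\<^sup>+ y. e2ennreal (log_kernel x y) \<partial>\<mu>) \<partial>\<mu>)"
    proof (subst const[of l, symmetric], rule nn_integral_mono_AE)
      show "AE x in \<mu>. (\<integral>\<^sup>+ y. ennreal l \<partial>\<mu>) \<le> (\<integral>\<^sup>+ y. e2ennreal (log_kernel x y) \<partial>\<mu>)"
        using AEK
      proof eventually_elim
        case (elim x)
        have "ennreal l \<le> e2ennreal (log_kernel x y)" if "y \<in> K" for y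
          using e2ennreal_mono[OF le[OF elim that]] by simp
        then show ?case using AEK by (intro nn_integral_mono_AE) (auto elim!: eventually_mono)
      qed
    qed
    have N: "(\<integral>\<^sup>+ x. (\<integral>\<^sup>+ y. e2ennreal (- log_kernel x y) \<partial>\<mu>) \<partial>\<mu>) \<le> ennreal (- l)"
    proof (subst const[of "- l", symmetric], rule nn_integral_mono_AE)
      show "AE x in \<mu>. (\<integral>\<^sup>+ y. e2ennreal (- log_kernel x y) \<partial>\<mu>) \<le> (\<integral>\<^sup>+ y. ennreal (- l) \<partial>\<mu>)"
        using AEK
      proof eventually_elim
        case (elim x)
        have "e2ennreal (- log_kernel x y) \<le> ennreal (- l)" if "y \<in> K" for y
        proof -
          have "- log_kernel x y \<le> - ereal l" using le[OF elim that] by (simp only: ereal_minus_le_minus)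
          then have "e2ennreal (- log_kernel x y) \<le> e2ennreal (- ereal l)" by (rule e2ennreal_mono)
          then show ?thesis by simp
        qed
        then show ?case using AEK by (intro nn_integral_mono_AE) (auto elim!: eventually_mono)
      qed
    qed
    have "ereal l = enn2ereal (ennreal l) - enn2ereal (ennreal (- l))"
      by (cases "l \<ge> 0") (simp_all add: enn2ereal_ennreal ennreal_neg zero_ennreal.rep_eq)
    also have "\<dots> \<le> log_energy \<mu>"
      unfolding log_energy_def using P N by (intro ereal_minus_mono) (auto simp: less_eq_ennreal.rep_eq)
    finally show ?thesis .
  qed
  then have I: "ereal l \<le> (INF \<mu>\<in>compact_prob_measures E. log_energy \<mu>)" by (rule INF_greatest)
  show ?thesis
  proof (cases "INF \<mu>\<in>compact_prob_measures E. log_energy \<mu>")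
    case (real v)
    then have "exp (- v) \<le> exp (- l)" using I by simp
    also have "exp (- l) = 2 * s" using assms(2) by (simp add: l_def ln_div exp_minus)
    finally show ?thesis using real by (simp add: logarithmic_capacity_def ennreal_leI)
  qed (use I in \<open>auto simp: logarithmic_capacity_def\<close>)
qed

text \<open>On a ball of radius \<open>s\<close> the kernel becomes nonnegative when \<open>ln (2 * s)\<close> is added to it,
  and the energy grows by this constant. The identity is proved with positive and negative parts
  separated, because the energy is a difference of two extended integrals.\<close>

lemma log_energy_positive_kernel:
  fixes \<nu> :: "(real ^ 'n) measure"
  assumes \<nu>: "\<nu> \<in> compact_prob_measures E" and E: "E \<subseteq> ball x s" "0 < s"
    and L: "log_energy \<nu> \<le> ereal L"
  shows "(\<integral>\<^sup>+y. (\<integral>\<^sup>+z. (if y = z then \<infinity> else ennreal (ln (2 * s / dist y z))) \<partial>\<nu>) \<partial>\<nu>) \<le> ennreal (L + ln (2 * s))"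
proof -
  obtain K where K: "prob_space \<nu>" "sets \<nu> = sets borel" "compact K" "K \<subseteq> E" "emeasure \<nu> K = 1"
    using \<nu> by (auto simp: compact_prob_measures_def)
  interpret prob_space \<nu> by fact
  note [measurable_cong] = K(2)
  have Km: "K \<in> sets \<nu>" using K by (simp add: compact_imp_closed)
  have AEK: "AE z in \<nu>. z \<in> K"
    using K(5) Km by (simp add: prob_eq_1[symmetric] measure_def)
  define b where "b = ln (2 * s)"
  define G where "G = (\<lambda>y z :: real ^ 'n. if y = z then \<infinity> else ennreal (ln (2 * s / dist y z)))"
  have G_alt: "G = (\<lambda>y z. if dist y z = 0 then \<infinity> else ennreal (ln (2 * s / dist y z)))"
    by (simp add: G_def fun_eq_iff)
  have [measurable]: "(\<lambda>z. G y z) \<in> borel_measurable borel" for y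
    unfolding G_alt by measurable
  have [measurable]: "(\<lambda>p. G (fst p) (snd p)) \<in> borel_measurable (borel \<Otimes>\<^sub>M borel)"
    unfolding G_alt by measurable
  have [measurable]: "(\<lambda>y. \<integral>\<^sup>+z. G y z \<partial>\<nu>) \<in> borel_measurable borel"
  proof -
    have "(\<lambda>p. G (fst p) (snd p)) \<in> borel_measurable (borel \<Otimes>\<^sub>M \<nu>)" by measurable
    then show ?thesis by (intro borel_measurable_nn_integral) (simp add: split_beta')
  qed
  have dist: "dist y z \<le> 2 * s" if "y \<in> K" "z \<in> K" for y z
    using that K(4) E by (intro dist_le_ball_ball[of _ x]) auto
  have eq: "G y z + e2ennreal (- log_kernel y z) + ennreal (- b) = e2ennreal (log_kernel y z) + ennreal b"
    if "y \<in> K" "z \<in> K" for y z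
  proof (cases "y = z")
    case False
    define k where "k = ln (1 / dist y z)"
    have kb: "ln (2 * s / dist y z) = k + b"
      using False E by (simp add: k_def b_def ln_div)
    have "0 \<le> k + b" unfolding kb[symmetric] using False E dist[OF that] by (intro ln_ge_zero) simp
    then have "ennreal (k + b) + ennreal (- k) + ennreal (- b) = ennreal k + ennreal b"
      by (cases "k \<ge> 0"; cases "b \<ge> 0") (simp_all add: ennreal_neg ennreal_plus[symmetric] del: ennreal_plus)
    then show ?thesis using False by (simp add: G_def log_kernel_def kb k_def[symmetric])
  qed (simp add: G_def log_kernel_def)
  let ?P = "\<integral>\<^sup>+ x. (\<integral>\<^sup>+ y. e2ennreal (log_kernel x y) \<partial>\<nu>) \<partial>\<nu>"
  let ?N = "\<integral>\<^sup>+ x. (\<integral>\<^sup>+ y. e2ennreal (- log_kernel x y) \<partial>\<nu>) \<partial>\<nu>"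
  let ?G = "\<integral>\<^sup>+ x. (\<integral>\<^sup>+ y. G x y \<partial>\<nu>) \<partial>\<nu>"
  have "(\<integral>\<^sup>+ x. (\<integral>\<^sup>+ y. G x y + e2ennreal (- log_kernel x y) + ennreal (- b) \<partial>\<nu>) \<partial>\<nu>) =
     (\<integral>\<^sup>+ x. (\<integral>\<^sup>+ y. e2ennreal (log_kernel x y) + ennreal b \<partial>\<nu>) \<partial>\<nu>)"
    using AEK
  proof (intro nn_integral_cong_AE, eventually_elim)
    case (elim x)
    show ?case using AEK by (intro nn_integral_cong_AE) (auto elim!: eventually_mono simp: eq[OF elim(2)])
  qed
  moreover have "(\<integral>\<^sup>+ x. (\<integral>\<^sup>+ y. G x y + e2ennreal (- log_kernel x y) + ennreal (- b) \<partial>\<nu>) \<partial>\<nu>) = ?G + ?N + ennreal (- b)"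
    by (simp add: nn_integral_add emeasure_space_1)
  moreover have "(\<integral>\<^sup>+ x. (\<integral>\<^sup>+ y. e2ennreal (log_kernel x y) + ennreal b \<partial>\<nu>) \<partial>\<nu>) = ?P + ennreal b"
    by (simp add: nn_integral_add emeasure_space_1)
  ultimately have eq2: "?G + ?N + ennreal (- b) = ?P + ennreal b" by simp
  have "?N \<le> (\<integral>\<^sup>+ x. (\<integral>\<^sup>+ y. ennreal b \<partial>\<nu>) \<partial>\<nu>)"
    using AEK
  proof (intro nn_integral_mono_AE, eventually_elim)
    case (elim x)
    have "e2ennreal (- log_kernel x y) \<le> ennreal b" if "y \<in> K" for y
    proof (cases "x = y")
      case False
      have "ln (dist x y) \<le> b" unfolding b_def using False dist[OF elim(2) that] E by (subst ln_le_cancel_iff) auto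
      then show ?thesis using False by (simp add: log_kernel_def ln_div ennreal_leI)
    qed (simp add: log_kernel_def e2ennreal_neg)
    then show ?case using AEK by (intro nn_integral_mono_AE) (auto elim!: eventually_mono)
  qed
  then have "?N \<le> ennreal b" by (simp add: emeasure_space_1)
  then obtain q where q: "?N = ennreal q" "q \<ge> 0" by (cases ?N) (auto simp: top_unique)
  have PN: "enn2ereal ?P - ereal q \<le> ereal L"
    using L unfolding log_energy_def q(1) using q(2) by (simp add: enn2ereal_ennreal)
  then obtain p where p: "?P = ennreal p" "p \<ge> 0" by (cases ?P) auto
  have pq: "p - q \<le> L" using PN p by (simp add: enn2ereal_ennreal)
  have "?G \<noteq> \<infinity>" using eq2 p(1) by (metis ennreal_add_eq_top ennreal_neq_top infinity_ennreal_def)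
  then obtain e where e: "?G = ennreal e" "e \<ge> 0" by (cases ?G) auto
  have "e + q + max 0 (- b) = p + max 0 b"
  proof -
    have "ennreal (e + q + max 0 (- b)) = ennreal e + ennreal q + ennreal (- b)"
      using q e by (simp add: ennreal_plus)
    also have "\<dots> = ennreal p + ennreal b" using eq2 unfolding p(1) q(1) e(1) .
    also have "\<dots> = ennreal (p + max 0 b)"
      using p by (simp add: ennreal_plus)
    finally have "ennreal (e + q + max 0 (- b)) = ennreal (p + max 0 b)" .
    then show ?thesis using p q e by (subst (asm) ennreal_inj) auto
  qed
  then have "e \<le> L + b" using pq by (auto simp: max_def split: if_splits)
  then show ?thesis using e(1) unfolding G_def b_def by (simp add: ennreal_leI)
qed

section \<open>Barriers made of potentials\<close>

lemma harmonic_on_const: "harmonic_on (\<Omega> :: (real ^ 'n) set) (\<lambda>_. c)"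
proof -
  have "(\<bullet>) (0 :: real ^ 'n) = (\<lambda>_. 0)" "(*v) (0 :: real ^ 'n ^ 'n) = (\<lambda>_. 0)" by auto
  then show ?thesis
    unfolding harmonic_on_def
    by (intro exI[of _ "\<lambda>_. 0"]) (simp add: trace_def)
qed

lemma harmonic_on_add:
  assumes "harmonic_on \<Omega> u" "harmonic_on \<Omega> v"
  shows "harmonic_on \<Omega> (\<lambda>x. u x + v x)"
proof -
  obtain g H where 1: "\<forall>x\<in>\<Omega>. (u has_derivative (\<lambda>h. g x \<bullet> h)) (at x)"
    "\<forall>x\<in>\<Omega>. (g has_derivative (\<lambda>h. H x *v h)) (at x)" "continuous_on \<Omega> H" "\<forall>x\<in>\<Omega>. trace (H x) = 0"
    using assms(1) unfolding harmonic_on_def by blast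
  obtain g' H' where 2: "\<forall>x\<in>\<Omega>. (v has_derivative (\<lambda>h. g' x \<bullet> h)) (at x)"
    "\<forall>x\<in>\<Omega>. (g' has_derivative (\<lambda>h. H' x *v h)) (at x)" "continuous_on \<Omega> H'" "\<forall>x\<in>\<Omega>. trace (H' x) = 0"
    using assms(2) unfolding harmonic_on_def by blast
  show ?thesis
    unfolding harmonic_on_def
  proof (intro exI[of _ "\<lambda>x. g x + g' x"] exI[of _ "\<lambda>x. H x + H' x"] conjI ballI)
    fix x assume x: "x \<in> \<Omega>"
    show "((\<lambda>x. u x + v x) has_derivative (\<lambda>h. (g x + g' x) \<bullet> h)) (at x)"
      using has_derivative_add[OF 1(1)[rule_format, OF x] 2(1)[rule_format, OF x]] by (simp add: inner_add_left)
    show "((\<lambda>x. g x + g' x) has_derivative (\<lambda>h. (H x + H' x) *v h)) (at x)"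
      using has_derivative_add[OF 1(2)[rule_format, OF x] 2(2)[rule_format, OF x]]
      by (simp add: matrix_vector_mult_add_rdistrib)
    show "trace (H x + H' x) = 0" using 1(4) 2(4) x by (simp add: trace_add)
  qed (intro continuous_on_add 1 2)
qed

lemma harmonic_on_sum:
  "finite I \<Longrightarrow> (\<And>i. i \<in> I \<Longrightarrow> harmonic_on \<Omega> (f i)) \<Longrightarrow> harmonic_on \<Omega> (\<lambda>x. \<Sum>i\<in>I. f i x)"
  by (induction I rule: finite_induct) (auto simp: harmonic_on_const harmonic_on_add)

text \<open>The terms decay geometrically in both directions from the index at which \<open>l ^ k\<close> passes
  \<open>v\<close>.\<close>

lemma sum_min_geometric_le:
  fixes l v :: real
  assumes l: "0 < l" "l \<le> 1 / 2" and v: "0 \<le> v"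
  shows "(\<Sum>k=1..M. min (v / l ^ k) (l ^ k / v)) \<le> 4"
proof (cases "v = 0")
  case False
  then have v: "v > 0" using v by simp
  have "\<exists>j. l ^ Suc j \<le> v"
  proof -
    have "(\<lambda>j. l ^ Suc j) \<longlonglongrightarrow> 0" using l by (intro LIMSEQ_Suc LIMSEQ_realpow_zero) auto
    then have "\<forall>\<^sub>F j in sequentially. l ^ Suc j < v" using v by (rule order_tendstoD(2))
    then show ?thesis by (auto simp: eventually_sequentially intro: less_imp_le)
  qed
  then obtain j where j: "l ^ Suc j \<le> v" "\<And>i. i < j \<Longrightarrow> \<not> l ^ Suc i \<le> v"
    using exists_least_iff[of "\<lambda>j. l ^ Suc j \<le> v"] by auto
  define t where "t = (\<lambda>k. if k \<le> j then (1/2 :: real) ^ (j - k) else (1/2) ^ (k - Suc j))"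
  have t0: "0 \<le> t k" for k by (simp add: t_def)
  have le: "min (v / l ^ k) (l ^ k / v) \<le> t k" if k: "1 \<le> k" for k
  proof (cases "k \<le> j")
    case True
    have "v < l ^ j" using j(2)[of "j - 1"] True k by auto
    then have "v / l ^ k \<le> l ^ j / l ^ k" using l by (intro divide_right_mono) auto
    also have "\<dots> = l ^ (j - k)" using True l by (simp add: power_diff)
    also have "\<dots> \<le> (1/2) ^ (j - k)" using l by (intro power_mono) auto
    finally show ?thesis using True by (simp add: t_def min_le_iff_disj)
  next
    case False
    then have "l ^ k = l ^ Suc j * l ^ (k - Suc j)" by (subst power_add[symmetric]) simp
    also have "\<dots> \<le> v * l ^ (k - Suc j)" using j(1) l by (intro mult_right_mono) auto
    also have "\<dots> \<le> v * (1/2) ^ (k - Suc j)" using v l by (intro mult_left_mono power_mono) auto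
    finally have "l ^ k / v \<le> (1/2) ^ (k - Suc j)" using v by (simp add: divide_le_eq mult.commute)
    then show ?thesis using False by (simp add: t_def min_le_iff_disj)
  qed
  have geo: "(\<Sum>i<n. (1/2 :: real) ^ i) \<le> 2" for n
    using sum_gp_strict[of "1/2 :: real" n] by simp
  have "(\<Sum>k=1..M. min (v / l ^ k) (l ^ k / v)) \<le> (\<Sum>k=1..M. t k)" by (intro sum_mono le) auto
  also have "\<dots> \<le> (\<Sum>k\<in>{..j} \<union> {Suc j..<Suc j + M}. t k)" using t0 by (intro sum_mono2) auto
  also have "\<dots> = (\<Sum>k\<in>{..j}. t k) + (\<Sum>k\<in>{Suc j..<Suc j + M}. t k)" by (rule sum.union_disjoint) auto
  also have "(\<Sum>k\<in>{..j}. t k) = (\<Sum>i<Suc j. (1/2) ^ i)"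
    by (rule sum.reindex_bij_witness[of _ "\<lambda>i. j - i" "\<lambda>k. j - k"]) (auto simp: t_def)
  also have "(\<Sum>k\<in>{Suc j..<Suc j + M}. t k) = (\<Sum>i<M. (1/2) ^ i)"
    by (rule sum.reindex_bij_witness[of _ "\<lambda>i. i + Suc j" "\<lambda>k. k - Suc j"]) (auto simp: t_def)
  also have "(\<Sum>i<Suc j. (1/2 :: real) ^ i) + (\<Sum>i<M. (1/2) ^ i) \<le> 4" using geo[of "Suc j"] geo[of M] by linarith
  finally show ?thesis .
qed simp

lemma one_plus_power_le:
  fixes t :: real
  assumes "0 \<le> t" "t \<le> 1"
  shows "(1 + t) ^ m \<le> 1 + (2 ^ m - 1) * t"
proof (induction m)
  case (Suc m)
  have "(1 + t) ^ Suc m \<le> (1 + t) * (1 + (2 ^ m - 1) * t)"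
    using Suc assms by (simp add: mult_left_mono)
  also have "\<dots> = 1 + 2 ^ m * t + (2 ^ m - 1) * t * t" by (simp add: algebra_simps)
  also have "\<dots> \<le> 1 + 2 ^ m * t + (2 ^ m - 1) * t * 1"
    using assms by (intro add_left_mono mult_left_mono) (auto intro!: mult_nonneg_nonneg)
  also have "\<dots> = 1 + (2 ^ Suc m - 1) * t" by (simp add: algebra_simps)
  finally show ?case .
qed simp

lemma capacity_density_Newtonian_measure:
  fixes \<Omega> :: "(real ^ 'n) set"
  assumes n: "CARD('n) \<ge> 3" and \<beta>: "0 < \<beta>" and \<rho>: "0 < \<rho>"
    and cap: "newtonian_capacity (ball x \<rho> - \<Omega>) \<ge> ennreal (\<beta> * \<rho> ^ (CARD('n) - 2))"
  obtains \<nu> K where "prob_space \<nu>" "sets \<nu> = sets borel" "compact K" "K \<subseteq> ball x \<rho> - \<Omega>" "emeasure \<nu> K = 1"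
    "(\<integral>\<^sup>+y. (\<integral>\<^sup>+z. (if y = z then \<infinity> else ennreal ((\<rho> / dist y z) ^ (CARD('n) - 2))) \<partial>\<nu>) \<partial>\<nu>) \<le> ennreal (2 / \<beta>)"
proof -
  let ?m = "CARD('n) - 2"
  have m: "?m \<noteq> 0" using n by simp
  obtain \<nu> where \<nu>: "\<nu> \<in> compact_prob_measures (ball x \<rho> - \<Omega>)" "newtonian_energy \<nu> \<le> ennreal (2 / (\<beta> * \<rho> ^ ?m))"
    using newtonian_capacity_measure[OF cap] \<beta> \<rho> by auto
  obtain K where K: "prob_space \<nu>" "sets \<nu> = sets borel" "compact K" "K \<subseteq> ball x \<rho> - \<Omega>" "emeasure \<nu> K = 1"
    using \<nu>(1) by (auto simp: compact_prob_measures_def)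
  note [measurable_cong] = K(2)
  interpret prob_space \<nu> by fact
  have eq: "(if y = z then \<infinity> else ennreal ((\<rho> / dist y z) ^ ?m)) = ennreal (\<rho> ^ ?m) * inverse (ennreal (dist y z ^ ?m))" for y z :: "real ^ 'n"
  proof (cases "y = z")
    case True then show ?thesis using m \<rho> by (simp add: zero_power ennreal_mult_top)
  next
    case False
    then have "inverse (ennreal (dist y z ^ ?m)) = ennreal (inverse (dist y z ^ ?m))" by (intro inverse_ennreal) simp
    then show ?thesis using False \<rho> by (simp add: ennreal_mult[symmetric] divide_inverse power_mult_distrib power_inverse)
  qed
  have meas: "(\<lambda>p. inverse (ennreal (dist (fst p) (snd p) ^ ?m))) \<in> borel_measurable (borel \<Otimes>\<^sub>M \<nu>)" by measurable
  have [measurable]: "(\<lambda>y. \<integral>\<^sup>+z. inverse (ennreal (dist y z ^ ?m)) \<partial>\<nu>) \<in> borel_measurable borel"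
    using meas by (intro borel_measurable_nn_integral) (simp add: split_beta')
  have "(\<integral>\<^sup>+y. (\<integral>\<^sup>+z. (if y = z then \<infinity> else ennreal ((\<rho> / dist y z) ^ ?m)) \<partial>\<nu>) \<partial>\<nu>) = ennreal (\<rho> ^ ?m) * newtonian_energy \<nu>"
    unfolding eq newtonian_energy_def by (simp add: nn_integral_cmult)
  also have "\<dots> \<le> ennreal (\<rho> ^ ?m) * ennreal (2 / (\<beta> * \<rho> ^ ?m))" by (intro mult_left_mono \<nu>(2)) simp
  also have "\<dots> = ennreal (2 / \<beta>)" using \<beta> \<rho> by (simp add: ennreal_mult[symmetric])
  finally show ?thesis using that K by blast
qed

text \<open>A mass above 1/4 in the small ball would by itself have too much energy.\<close>

lemma Newtonian_measure_center_small:
  fixes x :: "'a::euclidean_space"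
  assumes "prob_space \<nu>" and sets: "sets \<nu> = sets borel" and m: "m \<ge> 1" and \<rho>: "0 < \<rho>" and \<beta>: "0 < \<beta>"
    and E: "(\<integral>\<^sup>+y. (\<integral>\<^sup>+z. (if y = z then \<infinity> else ennreal ((\<rho> / dist y z) ^ m)) \<partial>\<nu>) \<partial>\<nu>) \<le> ennreal (2 / \<beta>)"
    and l: "0 < l" "l \<le> 1 / 2" "l \<le> \<beta> / 64"
  shows "emeasure \<nu> (- ball x (l * \<rho>)) \<ge> ennreal (3 / 4)"
proof -
  interpret prob_space \<nu> by fact
  have sp: "space \<nu> = UNIV" using sets_eq_imp_space_eq[OF sets] by simp
  let ?B = "ball x (l * \<rho>)"
  have B [measurable]: "?B \<in> sets \<nu>" by (simp add: sets)
  define c where "c = (1 / (2 * l)) ^ m"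
  have c0: "0 \<le> c" using l by (simp add: c_def)
  have le: "ennreal c \<le> (if y = z then \<infinity> else ennreal ((\<rho> / dist y z) ^ m))" if "y \<in> ?B" "z \<in> ?B" for y z
  proof (cases "y = z")
    case False
    have "dist y z \<le> 2 * (l * \<rho>)" using that by (rule dist_le_ball_ball)
    then have "1 / (2 * l) \<le> \<rho> / dist y z" using False l \<rho> by (simp add: field_simps)
    then show ?thesis using False l unfolding c_def by (auto intro!: ennreal_leI power_mono)
  qed simp
  have i: "ennreal (c * prob ?B) * indicator ?B y \<le> (\<integral>\<^sup>+z. (if y = z then \<infinity> else ennreal ((\<rho> / dist y z) ^ m)) \<partial>\<nu>)" for y
  proof (cases "y \<in> ?B")
    case True
    have "ennreal (c * prob ?B) = (\<integral>\<^sup>+z. ennreal c * indicator ?B z \<partial>\<nu>)"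
      using c0 by (simp add: nn_integral_cmult emeasure_eq_measure ennreal_mult)
    also have "\<dots> \<le> (\<integral>\<^sup>+z. (if y = z then \<infinity> else ennreal ((\<rho> / dist y z) ^ m)) \<partial>\<nu>)"
    proof (rule nn_integral_mono)
      fix z
      show "ennreal c * indicator ?B z \<le> (if y = z then \<infinity> else ennreal ((\<rho> / dist y z) ^ m))"
        using le[OF True, of z] by (cases "z \<in> ?B") simp_all
    qed
    finally show ?thesis using True by simp
  qed simp
  have "ennreal (c * prob ?B * prob ?B) = (\<integral>\<^sup>+y. ennreal (c * prob ?B) * indicator ?B y \<partial>\<nu>)"
    using c0 by (simp add: nn_integral_cmult emeasure_eq_measure ennreal_mult)
  also have "\<dots> \<le> (\<integral>\<^sup>+y. (\<integral>\<^sup>+z. (if y = z then \<infinity> else ennreal ((\<rho> / dist y z) ^ m)) \<partial>\<nu>) \<partial>\<nu>)"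
    by (intro nn_integral_mono i)
  also note E
  finally have le1: "c * prob ?B * prob ?B \<le> 2 / \<beta>" using \<beta> by (simp add: ennreal_le_iff)
  have "1 / (2 * l) \<le> c"
    unfolding c_def using l m by (intro self_le_power) (auto simp: field_simps)
  then have "(1 / (2 * l)) * (prob ?B * prob ?B) \<le> c * (prob ?B * prob ?B)" by (intro mult_right_mono) auto
  then have "(1 / (2 * l)) * (prob ?B * prob ?B) \<le> 2 / \<beta>" using le1 by (simp add: mult.assoc)
  then have "prob ?B * prob ?B \<le> 2 / \<beta> * (2 * l)" using l by (simp add: field_simps)
  also have "\<dots> \<le> (1/4) * (1/4)" using l \<beta> by (simp add: field_simps)
  finally have "prob ?B \<le> 1/4"
    by (metis abs_le_square_iff abs_of_nonneg measure_nonneg power2_eq_square zero_le_divide_1_iff zero_le_numeral)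
  moreover have "prob (- ?B) = 1 - prob ?B" using prob_compl[OF B] by (simp add: sp Compl_eq_Diff_UNIV)
  ultimately show ?thesis by (simp add: emeasure_eq_measure)
qed

text \<open>The potential \<open>U\<close> comes from a measure of mass between 1/4 and 1 in the shell between the
  radii \<open>l * \<rho>\<close> and \<open>\<rho>\<close>, and the kernel is scaled so that it has size 1 at distance \<open>\<rho>\<close>. Far
  from \<open>x\<close> the potential is small, within distance comparable to \<open>\<rho>\<close> it is bounded, and close to
  \<open>x\<close> it is nearly constant since the measure leaves a hole there. The last line of the claim
  collects these three cases in a bound that can be summed over scales.\<close>

lemma Newtonian_single_scale:
  fixes \<Omega> :: "(real ^ 'n) set"
  assumes n: "CARD('n) \<ge> 3" and \<beta>: "0 < \<beta>"
  obtains \<eta> C l :: real where "0 < \<eta>" "0 \<le> C" "0 < l" "l \<le> 1 / 2"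
    "\<And>x \<rho>. 0 < \<rho> \<Longrightarrow> newtonian_capacity (ball x \<rho> - \<Omega>) \<ge> ennreal (\<beta> * \<rho> ^ (CARD('n) - 2)) \<Longrightarrow>
      \<exists>U. continuous_on UNIV U \<and> harmonic_on \<Omega> U \<and> (\<forall>y. dist y x \<le> \<rho> \<longrightarrow> \<eta> \<le> U y) \<and>
        (\<forall>y. 2 * \<rho> \<le> dist y x \<longrightarrow> U y \<le> 2 * \<rho> / dist y x) \<and>
        (\<forall>y p. dist p x \<le> l * \<rho> / 4 \<longrightarrow>
          U y \<le> U p + C * (min (dist y x / \<rho>) (\<rho> / dist y x) + dist p x / \<rho>))"
proof -
  define m where "m = CARD('n) - 2"
  have m: "m \<ge> 1" using n by (simp add: m_def)
  define l where "l = min (1 / 2) (\<beta> / 64)"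
  have l: "0 < l" "l \<le> 1 / 2" "l \<le> \<beta> / 64" using \<beta> by (auto simp: l_def)
  define C0 where "C0 = 2 ^ m * (8 * (2 / \<beta>))"
  define C1 where "C1 = 2 ^ m * (2 / l) * C0"
  have C0: "0 < C0" using \<beta> by (simp add: C0_def)
  have C1: "0 < C1" using C0 l by (simp add: C1_def)
  define C where "C = max (max C1 (4 * C0 / l)) 2"
  have "\<exists>U. continuous_on UNIV U \<and> harmonic_on \<Omega> U \<and> (\<forall>y. dist y x \<le> \<rho> \<longrightarrow> (1/2) ^ m / 4 \<le> U y) \<and>
        (\<forall>y. 2 * \<rho> \<le> dist y x \<longrightarrow> U y \<le> 2 * \<rho> / dist y x) \<and>
        (\<forall>y p. dist p x \<le> l * \<rho> / 4 \<longrightarrow>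
          U y \<le> U p + C * (min (dist y x / \<rho>) (\<rho> / dist y x) + dist p x / \<rho>))"
    if \<rho>: "0 < \<rho>" and cap: "newtonian_capacity (ball x \<rho> - \<Omega>) \<ge> ennreal (\<beta> * \<rho> ^ (CARD('n) - 2))" for x \<rho>
  proof -
    obtain \<nu> K where K: "prob_space \<nu>" "sets \<nu> = sets borel" "compact K" "K \<subseteq> ball x \<rho> - \<Omega>" "emeasure \<nu> K = 1"
      and E: "(\<integral>\<^sup>+y. (\<integral>\<^sup>+z. (if y = z then \<infinity> else ennreal ((\<rho> / dist y z) ^ m)) \<partial>\<nu>) \<partial>\<nu>) \<le> ennreal (2 / \<beta>)"
      using capacity_density_Newtonian_measure[OF n \<beta> \<rho> cap] unfolding m_def by blast
    note B = Newtonian_measure_center_small[OF K(1,2) m \<rho> \<beta> E l, of x]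
    define g where "g = (\<lambda>t. (\<rho> / t) ^ m)"
    have E': "(\<integral>\<^sup>+y. (\<integral>\<^sup>+z. (if y = z then \<infinity> else ennreal (g (dist y z))) \<partial>\<nu>) \<partial>\<nu>) \<le> ennreal (2 / \<beta>)"
      unfolding g_def by (rule E)
    obtain M K' where M: "finite_measure M" "sets M = sets borel" and K': "compact K'" "K' \<subseteq> - ball x (l * \<rho>)" "K' \<subseteq> K" "K' \<noteq> {}"
      and AEM: "AE z in M. z \<in> K'" "\<And>y. AE z in M. z \<noteq> y" and mass: "1 / 4 \<le> measure M UNIV" "measure M UNIV \<le> 1"
      and int: "\<And>y. integrable M (\<lambda>z. g (dist y z))"
      and cont: "continuous_on UNIV (\<lambda>y. \<integral>z. g (dist y z) \<partial>M)"
      and bound: "\<And>y. (\<integral>z. g (dist y z) \<partial>M) \<le> 2 ^ m * (8 * (2 / \<beta>)) + 0"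
    proof (rule continuous_potential[OF K(1,2,3,5) _ _ _ _ _ _ _ _ _ _ E' _ B, where L = "2 * \<rho>" and a = "2 ^ m" and b = 0])
      show "dist y z \<le> 2 * \<rho>" if "y \<in> K" "z \<in> K" for y z
        using that K(4) by (intro dist_le_ball_ball[of _ x]) auto
      show "g t \<le> g s" if "0 < s" "s \<le> t" for s t
        using that \<rho> unfolding g_def by (intro power_mono divide_left_mono) auto
      show "continuous_on {0<..} g" unfolding g_def by (intro continuous_intros) auto
      show "g \<in> borel_measurable borel" unfolding g_def by measurable
      show "g (t / 2) \<le> 2 ^ m * g t + 0" for t
        by (simp add: g_def power_divide power_mult_distrib field_simps)
    qed (use \<rho> \<beta> in \<open>auto simp: g_def\<close>)
    note [measurable_cong] = M(2)
    interpret finite_measure M by fact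
    have sp: "space M = UNIV" using sets_eq_imp_space_eq[OF M(2)] by simp
    define U where "U = (\<lambda>y. \<integral>z. g (dist y z) \<partial>M)"
    have U0: "0 \<le> U y" for y unfolding U_def g_def using \<rho> by (intro integral_nonneg_AE) auto
    have UC: "U y \<le> C0" for y using bound[of y] by (simp add: U_def C0_def)
    have K'x: "dist x z < \<rho>" "l * \<rho> \<le> dist x z" if "z \<in> K'" for z using that K' K(4) by (auto simp: subset_iff)
    have harm: "harmonic_on \<Omega> U"
      unfolding U_def
    proof (rule harmonic_potential[OF M K'(1,4) AEM(1) _ int])
      show "K' \<inter> \<Omega> = {}" using K' K(4) by auto
      fix w :: "real ^ 'n" assume w: "w \<noteq> 0"
      have "((\<lambda>w. \<rho> ^ m * inverse (norm w ^ m)) has_derivative (\<lambda>h. \<rho> ^ m * (- real m * (kernel_grad w \<bullet> h)))) (at w)"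
        unfolding m_def by (intro has_derivative_mult_right has_derivative_newton_kernel w n)
      then show "((\<lambda>w. g (norm w)) has_derivative (\<lambda>h. - (\<rho> ^ m * real m) * (kernel_grad w \<bullet> h))) (at w)"
        by (simp add: g_def divide_inverse power_mult_distrib power_inverse mult.assoc)
    qed
    have lower: "(1/2) ^ m / 4 \<le> U y" if y: "dist y x \<le> \<rho>" for y
    proof -
      have "(1/2) ^ m / 4 \<le> (1/2) ^ m * measure M UNIV" using mass(1) by simp
      also have "\<dots> = (\<integral>z. (1/2) ^ m \<partial>M)" by (simp add: sp)
      also have "\<dots> \<le> U y"
        unfolding U_def
      proof (rule integral_mono_AE)
        show "AE z in M. (1/2) ^ m \<le> g (dist y z)"
          using AEM(1) AEM(2)[of y]
        proof eventually_elim
          case (elim z)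
          have "dist y z \<le> 2 * \<rho>" using dist_triangle[of y z x] y K'x(1)[OF elim(1)] by linarith
          then have "1/2 \<le> \<rho> / dist y z" using elim \<rho> by (simp add: field_simps)
          then show ?case unfolding g_def by (rule power_mono) simp
        qed
      qed (use int in auto)
      finally show ?thesis .
    qed
    have far: "U y \<le> 2 * \<rho> / dist y x" if y: "2 * \<rho> \<le> dist y x" for y
    proof -
      have q: "0 \<le> 2 * \<rho> / dist y x" "2 * \<rho> / dist y x \<le> 1"
        using y \<rho> by (simp, subst divide_le_eq_1_pos) linarith+
      have "U y \<le> (\<integral>z. 2 * \<rho> / dist y x \<partial>M)"
        unfolding U_def
      proof (rule integral_mono_AE)
        show "AE z in M. g (dist y z) \<le> 2 * \<rho> / dist y x"
          using AEM(1)
        proof eventually_elim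
          case (elim z)
          have "dist y x \<le> dist y z + \<rho>" using dist_triangle[of y x z] K'x(1)[OF elim] by (simp add: dist_commute)
          then have d: "dist y x / 2 \<le> dist y z" using y by linarith
          then have "\<rho> / dist y z \<le> \<rho> / (dist y x / 2)" using y \<rho> by (intro divide_left_mono mult_pos_pos) linarith+
          then have "g (dist y z) \<le> (2 * \<rho> / dist y x) ^ m"
            unfolding g_def using \<rho> by (intro power_mono) (auto simp: field_simps)
          also have "\<dots> \<le> (2 * \<rho> / dist y x) ^ 1" using q m by (intro power_decreasing) auto
          finally show ?case by simp
        qed
      qed (use int in auto)
      also have "\<dots> = (2 * \<rho> / dist y x) * measure M UNIV" by (simp add: sp)
      also have "\<dots> \<le> (2 * \<rho> / dist y x) * 1" using mass q by (intro mult_left_mono) auto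
      finally show ?thesis by simp
    qed
    have near: "U y \<le> U p + C1 * (dist y p / \<rho>)" if y: "dist y x \<le> l * \<rho> / 4" and p: "dist p x \<le> l * \<rho> / 4" for y p
    proof -
      let ?s = "2 / l * (dist y p / \<rho>)"
      have s0: "0 \<le> ?s" using l \<rho> by simp
      have "U y \<le> (\<integral>z. (1 + 2 ^ m * ?s) * g (dist p z) \<partial>M)"
        unfolding U_def
      proof (rule integral_mono_AE)
        show "AE z in M. g (dist y z) \<le> (1 + 2 ^ m * ?s) * g (dist p z)"
          using AEM(1)
        proof eventually_elim
          case (elim z)
          have lr: "0 < l * \<rho>" using l \<rho> by simp
          have yz: "l * \<rho> / 2 \<le> dist y z" using dist_triangle[of x z y] K'x(2)[OF elim] y lr dist_commute[of x y] by linarith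
          have pz: "l * \<rho> / 2 \<le> dist p z" using dist_triangle[of x z p] K'x(2)[OF elim] p lr dist_commute[of x p] by linarith
          have yp: "dist y p \<le> l * \<rho> / 2" using dist_triangle[of y p x] y p dist_commute[of x p] by linarith
          define t where "t = dist y p / dist y z"
          have t: "0 \<le> t" "t \<le> 1" using yp yz lr by (auto simp: t_def divide_le_eq)
          have "t \<le> dist y p / (l * \<rho> / 2)" 
          proof -
            have "0 < dist y z" using yz lr by linarith
            then show ?thesis unfolding t_def using yz lr by (intro divide_left_mono mult_pos_pos) simp_all
          qed
          then have ts: "t \<le> ?s" by (simp add: field_simps)
          have yz0: "0 < dist y z" using yz lr by linarith
          then have "dist y z * (1 + t) = dist y z + dist y p" by (simp add: t_def distrib_left)
          then have "dist p z \<le> dist y z * (1 + t)"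
            using dist_triangle[of p z y] dist_commute[of p y] by linarith
          then have "\<rho> / dist y z \<le> (1 + t) * (\<rho> / dist p z)"
          proof -
            assume le: "dist p z \<le> dist y z * (1 + t)"
            have pz0: "0 < dist p z" using pz lr by linarith
            have "\<rho> * dist p z \<le> \<rho> * (dist y z * (1 + t))" using le \<rho> by (intro mult_left_mono) auto
            then show ?thesis using yz0 pz0 by (simp add: divide_le_eq) (simp add: field_simps)
          qed
          then have "g (dist y z) \<le> ((1 + t) * (\<rho> / dist p z)) ^ m"
            unfolding g_def using \<rho> by (intro power_mono) auto
          also have "\<dots> = (1 + t) ^ m * g (dist p z)" by (simp add: g_def power_mult_distrib power_divide)
          also have "\<dots> \<le> (1 + 2 ^ m * ?s) * g (dist p z)"
          proof (rule mult_right_mono)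
            have "(1 + t) ^ m \<le> 1 + (2 ^ m - 1) * t" by (rule one_plus_power_le[OF t])
            also have "(2 ^ m - 1) * t \<le> 2 ^ m * ?s" using t ts by (intro mult_mono) auto
            finally show "(1 + t) ^ m \<le> 1 + 2 ^ m * ?s" by simp
          qed (use \<rho> in \<open>simp add: g_def\<close>)
          finally show ?case .
        qed
      qed (use int in auto)
      also have "\<dots> = (1 + 2 ^ m * ?s) * U p" unfolding U_def by (rule integral_mult_right_zero)
      also have "\<dots> = U p + (2 ^ m * ?s) * U p" by (simp only: distrib_right mult_1)
      also have "\<dots> \<le> U p + (2 ^ m * ?s) * C0" using l \<rho> UC by (intro add_left_mono mult_left_mono mult_nonneg_nonneg) auto
      also have "\<dots> = U p + C1 * (dist y p / \<rho>)" by (simp add: C1_def)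
      finally show ?thesis .
    qed
    have comb: "U y \<le> U p + C * (min (dist y x / \<rho>) (\<rho> / dist y x) + dist p x / \<rho>)" if p: "dist p x \<le> l * \<rho> / 4" for y p
    proof -
      let ?mm = "min (dist y x / \<rho>) (\<rho> / dist y x)"
      have Cp: "0 \<le> C * (dist p x / \<rho>)" using \<rho> C1 by (simp add: C_def le_max_iff_disj)
      have mm0: "0 \<le> ?mm" using \<rho> by simp
      consider "dist y x \<le> l * \<rho> / 4" | "2 * \<rho> \<le> dist y x" | "l * \<rho> / 4 < dist y x" "dist y x < 2 * \<rho>" by linarith
      then show ?thesis
      proof cases
        case 1
        have "l * \<rho> / 4 \<le> \<rho>" using l \<rho> by (simp add: field_simps)
        have mm: "?mm = dist y x / \<rho>"
        proof (cases "y = x")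
          case False
          have "dist y x \<le> \<rho>" using 1 \<open>l * \<rho> / 4 \<le> \<rho>\<close> by linarith
          then have "dist y x / \<rho> \<le> 1" "1 \<le> \<rho> / dist y x" using False \<rho> by (auto simp: le_divide_eq divide_le_eq)
          then show ?thesis by linarith
        qed simp
        have "dist y p / \<rho> \<le> ?mm + dist p x / \<rho>"
          using dist_triangle[of y p x] \<rho> unfolding mm by (simp add: dist_commute add_divide_distrib[symmetric] divide_right_mono)
        then have "C1 * (dist y p / \<rho>) \<le> C * (?mm + dist p x / \<rho>)"
          using C1 \<rho> by (intro mult_mono) (auto simp: C_def)
        then show ?thesis using near[OF 1 p] by linarith
      next
        case 2
        then have "0 < dist y x" "\<rho> \<le> dist y x" using \<rho> by linarith+
        then have "\<rho> / dist y x \<le> 1" "1 \<le> dist y x / \<rho>" using \<rho> by (auto simp: le_divide_eq divide_le_eq)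
        then have mm: "?mm = \<rho> / dist y x" by (auto simp: min_def)
        have "2 * \<rho> / dist y x = 2 * ?mm" by (simp add: mm)
        also have "\<dots> \<le> C * ?mm" using mm0 by (intro mult_right_mono) (auto simp: C_def)
        finally have "U y \<le> C * ?mm" using far[OF 2] by linarith
        then show ?thesis using U0[of p] Cp by (simp add: distrib_left)
      next
        case 3
        have "l / 4 \<le> dist y x / \<rho>" using 3 \<rho> by (simp add: le_divide_eq)
        moreover have "0 < l * \<rho>" using l \<rho> by simp
        then have "0 < dist y x" using 3 by linarith
        then have "1 / 2 \<le> \<rho> / dist y x" using 3 \<rho> by (simp add: le_divide_eq)
        ultimately have mm: "l / 4 \<le> ?mm" using l by auto
        have "C0 = 4 * C0 / l * (l / 4)" using l by simp
        also have "\<dots> \<le> C * ?mm" using mm l C0 by (intro mult_mono) (auto simp: C_def)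
        finally have "U y \<le> C * ?mm" using UC[of y] by linarith
        then show ?thesis using U0[of p] Cp by (simp add: distrib_left)
      qed
    qed
    show ?thesis
      using cont harm lower far comb unfolding U_def by (intro exI[of _ "\<lambda>y. \<integral>z. g (dist y z) \<partial>M"]) blast
  qed
  moreover have "0 < (1/2 :: real) ^ m / 4" "0 \<le> C" using C1 by (auto simp: C_def)
  ultimately show ?thesis using that[of "(1/2) ^ m / 4" C l] l by blast
qed

text \<open>The function \<open>s\<close> is large at \<open>p\<close>, up to \<open>C\<close> attains its supremum there, and is at most \<open>C\<close>
  away from \<open>x\<close>. The constant \<open>C\<close> does not depend on \<open>T\<close>, so the harmonic measure of the
  boundary outside the ball, which is at most \<open>C / T\<close>, can be made small by choosing \<open>T\<close>.\<close>

definition admits_barriers :: "(real ^ 'n) set \<Rightarrow> (real ^ 'n) set \<Rightarrow> real \<Rightarrow> bool" where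
  "admits_barriers \<Omega> F D \<longleftrightarrow> (\<exists>C\<ge>0. \<forall>T. \<exists>c>0. c < 1 \<and>
    (\<forall>x\<in>F. \<forall>r p. 0 < r \<longrightarrow> r \<le> D \<longrightarrow> p \<in> ball x (c * r) \<longrightarrow>
      (\<exists>s. continuous_on UNIV s \<and> harmonic_on \<Omega> s \<and> (\<forall>y. s y \<le> s p + C) \<and>
        (\<forall>y. r \<le> dist y x \<longrightarrow> s y \<le> C) \<and> T \<le> s p)))"

text \<open>The barrier is the sum of the potentials of the scales \<open>l ^ k * r\<close> for \<open>k = 1, ..., M\<close>. At
  \<open>p\<close> each scale contributes at least \<open>\<eta>\<close>, whereas all errors are geometric sums and bounded
  independently of \<open>M\<close>.\<close>

lemma Newtonian_barrier:
  fixes \<Omega> :: "(real ^ 'n) set"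
  assumes n: "CARD('n) \<ge> 3" and \<beta>: "0 < \<beta>"
    and cap: "\<And>x r. x \<in> F \<Longrightarrow> 0 < r \<Longrightarrow> r \<le> D \<Longrightarrow> newtonian_capacity (ball x r - \<Omega>) \<ge> ennreal (\<beta> * r ^ (CARD('n) - 2))"
  shows "admits_barriers \<Omega> F D"
proof -
  obtain \<eta> C l :: real where \<eta>: "0 < \<eta>" and C: "0 \<le> C" and l: "0 < l" "l \<le> 1 / 2"
    and single: "\<And>x \<rho>. 0 < \<rho> \<Longrightarrow> newtonian_capacity (ball x \<rho> - \<Omega>) \<ge> ennreal (\<beta> * \<rho> ^ (CARD('n) - 2)) \<Longrightarrow>
      \<exists>U. continuous_on UNIV U \<and> harmonic_on \<Omega> U \<and> (\<forall>y. dist y x \<le> \<rho> \<longrightarrow> \<eta> \<le> U y) \<and>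
        (\<forall>y. 2 * \<rho> \<le> dist y x \<longrightarrow> U y \<le> 2 * \<rho> / dist y x) \<and>
        (\<forall>y p. dist p x \<le> l * \<rho> / 4 \<longrightarrow>
          U y \<le> U p + C * (min (dist y x / \<rho>) (\<rho> / dist y x) + dist p x / \<rho>))"
    using Newtonian_single_scale[OF n \<beta>, of \<Omega>] by blast
  have geo1: "(\<Sum>k=1..M. l ^ k) \<le> 1" for M
  proof -
    have "(\<Sum>k=1..M. l ^ k) \<le> (\<Sum>k=1..M. (1/2) ^ k)" using l by (intro sum_mono power_mono) auto
    also have "\<dots> \<le> 1" by (induction M) (auto simp: sum_gp)
    finally show ?thesis .
  qed
  have "\<exists>c>0. c < 1 \<and> (\<forall>x\<in>F. \<forall>r p. 0 < r \<longrightarrow> r \<le> D \<longrightarrow> p \<in> ball x (c * r) \<longrightarrow>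
    (\<exists>s. continuous_on UNIV s \<and> harmonic_on \<Omega> s \<and> (\<forall>y. s y \<le> s p + (5 * C + 2)) \<and>
      (\<forall>y. r \<le> dist y x \<longrightarrow> s y \<le> 5 * C + 2) \<and> T \<le> s p))" for T
  proof -
    obtain M :: nat where M: "T / \<eta> \<le> real M" using real_arch_simple by blast
    define c where "c = l ^ Suc M / 4"
    have c: "0 < c" "c < 1"
    proof -
      have "l ^ Suc M \<le> 1 ^ Suc M" using l by (intro power_mono) auto
      then show "0 < c" "c < 1" using l by (auto simp: c_def)
    qed
    have "\<exists>s. continuous_on UNIV s \<and> harmonic_on \<Omega> s \<and> (\<forall>y. s y \<le> s p + (5 * C + 2)) \<and>
      (\<forall>y. r \<le> dist y x \<longrightarrow> s y \<le> 5 * C + 2) \<and> T \<le> s p"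
      if x: "x \<in> F" and r: "0 < r" "r \<le> D" and p: "p \<in> ball x (c * r)" for x r p
    proof -
      define \<rho> where "\<rho> = (\<lambda>k. l ^ k * r)"
      have \<rho>0: "0 < \<rho> k" for k using l r by (simp add: \<rho>_def)
      have \<rho>r: "\<rho> k \<le> r" for k
      proof -
        have "l ^ k \<le> 1 ^ k" using l by (intro power_mono) auto
        then show ?thesis using r by (simp add: \<rho>_def)
      qed
      have "\<exists>U. continuous_on UNIV U \<and> harmonic_on \<Omega> U \<and> (\<forall>y. dist y x \<le> \<rho> k \<longrightarrow> \<eta> \<le> U y) \<and>
        (\<forall>y. 2 * \<rho> k \<le> dist y x \<longrightarrow> U y \<le> 2 * \<rho> k / dist y x) \<and>
        (\<forall>y p. dist p x \<le> l * \<rho> k / 4 \<longrightarrow>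
          U y \<le> U p + C * (min (dist y x / \<rho> k) (\<rho> k / dist y x) + dist p x / \<rho> k))" for k
        using \<rho>r[of k] r by (intro single \<rho>0 cap x) auto
      then obtain U where U: "\<And>k. continuous_on UNIV (U k)" "\<And>k. harmonic_on \<Omega> (U k)"
        "\<And>k y. dist y x \<le> \<rho> k \<Longrightarrow> \<eta> \<le> U k y" "\<And>k y. 2 * \<rho> k \<le> dist y x \<Longrightarrow> U k y \<le> 2 * \<rho> k / dist y x"
        "\<And>k y p. dist p x \<le> l * \<rho> k / 4 \<Longrightarrow> U k y \<le> U k p + C * (min (dist y x / \<rho> k) (\<rho> k / dist y x) + dist p x / \<rho> k)"
        by metis
      define s where "s = (\<lambda>y. \<Sum>k=1..M. U k y)"
      have pk: "dist p x \<le> l * \<rho> k / 4" if "k \<le> M" for k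
      proof -
        have "l ^ Suc M \<le> l ^ Suc k" using that l by (intro power_decreasing) auto
        then have "l ^ Suc M * r \<le> l ^ Suc k * r" using r by (intro mult_right_mono) auto
        then have "c * r \<le> l * \<rho> k / 4" by (simp add: c_def \<rho>_def mult.assoc)
        then show ?thesis using p by (simp add: dist_commute)
      qed
      have "continuous_on UNIV s" unfolding s_def by (intro continuous_on_sum U)
      moreover have "harmonic_on \<Omega> s" unfolding s_def by (intro harmonic_on_sum U) simp
      moreover have "s y \<le> s p + (5 * C + 2)" for y
      proof -
        have "s y \<le> (\<Sum>k=1..M. U k p + C * (min (dist y x / \<rho> k) (\<rho> k / dist y x) + dist p x / \<rho> k))"
          unfolding s_def by (intro sum_mono U(5) pk) auto
        also have "\<dots> = s p + C * ((\<Sum>k=1..M. min (dist y x / r / l ^ k) (l ^ k / (dist y x / r))) + (\<Sum>k=1..M. dist p x / \<rho> k))"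
          by (simp add: s_def sum.distrib sum_distrib_left[symmetric] \<rho>_def mult.commute)
        also have "\<dots> \<le> s p + C * (4 + 1)"
        proof (intro add_left_mono mult_left_mono add_mono C)
          show "(\<Sum>k=1..M. min (dist y x / r / l ^ k) (l ^ k / (dist y x / r))) \<le> 4"
            by (rule sum_min_geometric_le[OF l]) (use r in auto)
          have "(\<Sum>k=1..M. dist p x / \<rho> k) \<le> (\<Sum>k=1..M. l ^ (Suc M - k))"
          proof (rule sum_mono)
            fix k assume k: "k \<in> {1..M}"
            have "0 \<le> l ^ Suc M * r" using l r by simp
            moreover have "dist p x < l ^ Suc M * r / 4" using p by (simp add: c_def dist_commute)
            ultimately have "dist p x \<le> l ^ Suc M * r" by linarith
            also have "\<dots> = l ^ (Suc M - k) * \<rho> k" using k by (simp add: \<rho>_def mult.assoc[symmetric] power_add[symmetric])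
            finally show "dist p x / \<rho> k \<le> l ^ (Suc M - k)" using \<rho>0[of k] by (simp add: divide_le_eq)
          qed
          also have "\<dots> = (\<Sum>k=1..M. l ^ k)"
            by (rule sum.reindex_bij_witness[of _ "\<lambda>k. Suc M - k" "\<lambda>k. Suc M - k"]) auto
          also have "\<dots> \<le> 1" by (rule geo1)
          finally show "(\<Sum>k=1..M. dist p x / \<rho> k) \<le> 1" .
        qed
        finally show ?thesis by simp
      qed
      moreover have "s y \<le> 5 * C + 2" if y: "r \<le> dist y x" for y
      proof -
        have "s y \<le> (\<Sum>k=1..M. 2 * l ^ k)"
          unfolding s_def
        proof (rule sum_mono)
          fix k assume k: "k \<in> {1..M}"
          have "l ^ k \<le> l ^ 1" using k l by (intro power_decreasing) auto
          then have "2 * l ^ k \<le> 1" using l by simp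
          then have "2 * l ^ k * r \<le> 1 * r" using r by (intro mult_right_mono) auto
          then have "U k y \<le> 2 * \<rho> k / dist y x" using y by (intro U(4)) (simp add: \<rho>_def)
          also have "\<dots> \<le> 2 * \<rho> k / r" using y r \<rho>0[of k] by (intro divide_left_mono mult_pos_pos) auto
          also have "\<dots> = 2 * l ^ k" using r by (simp add: \<rho>_def)
          finally show "U k y \<le> 2 * l ^ k" .
        qed
        also have "\<dots> = 2 * (\<Sum>k=1..M. l ^ k)" by (simp add: sum_distrib_left)
        also have "\<dots> \<le> 2" using geo1[of M] by simp
        finally show ?thesis using C by simp
      qed
      moreover have "T \<le> s p"
      proof -
        have "T \<le> real M * \<eta>" using M \<eta> by (simp add: divide_le_eq)
        also have "\<dots> = (\<Sum>k=1..M. \<eta>)" by simp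
        also have "\<dots> \<le> s p"
          unfolding s_def
        proof (intro sum_mono U(3))
          fix k assume "k \<in> {1..M}"
          then have "dist p x \<le> l * \<rho> k / 4" by (intro pk) auto
          also have "\<dots> \<le> \<rho> k" using l \<rho>0[of k] by (simp add: field_simps)
          finally show "dist p x \<le> \<rho> k" .
        qed
        finally show ?thesis .
      qed
      ultimately show ?thesis by blast
    qed
    then show ?thesis using c by blast
  qed
  then show ?thesis
    unfolding admits_barriers_def using C by (intro exI[of _ "5 * C + 2"]) auto
qed

section \<open>Lower bounds for harmonic measure\<close>

text \<open>In the plane one measure at scale \<open>\<theta> * r\<close> suffices: its potential with kernel
  \<open>ln (r / dist y z)\<close> is at least a quarter of \<open>ln (1 / (2 * \<theta>))\<close> near \<open>x\<close>, exceeds its values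
  near \<open>x\<close> nowhere by more than a constant, and is bounded above at distance \<open>r\<close> and beyond. It
  tends to \<open>- \<infinity>\<close> far away, which is harmless because only upper bounds are required.\<close>

lemma logarithmic_barrier:
  fixes \<Omega> :: "(real ^ 'n) set"
  assumes n: "CARD('n) = 2" and \<beta>: "0 < \<beta>"
    and cap: "\<And>x r. x \<in> F \<Longrightarrow> 0 < r \<Longrightarrow> r \<le> D \<Longrightarrow> logarithmic_capacity (ball x r - \<Omega>) \<ge> ennreal (\<beta> * r)"
  shows "admits_barriers \<Omega> F D"
proof -
  define A where "A = max 1 (ln (4 / \<beta>))"
  have A: "1 \<le> A" by (simp add: A_def)
  have ln2: "0 \<le> ln (2 :: real)" by simp
  define C where "C = 8 * A + ln 2"
  have C: "0 \<le> C" "ln 2 \<le> C" using A ln2 by (auto simp: C_def)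
  have "\<exists>c>0. c < 1 \<and> (\<forall>x\<in>F. \<forall>r p. 0 < r \<longrightarrow> r \<le> D \<longrightarrow> p \<in> ball x (c * r) \<longrightarrow>
    (\<exists>s. continuous_on UNIV s \<and> harmonic_on \<Omega> s \<and> (\<forall>y. s y \<le> s p + C) \<and> (\<forall>y. r \<le> dist y x \<longrightarrow> s y \<le> C) \<and> T \<le> s p))" for T
  proof -
    \<comment> \<open>The factor 4 compensates the mass of the measure, which may be as small as 1/4.\<close>
    define \<theta> where "\<theta> = exp (- (4 * \<bar>T\<bar>)) / 2"
    have \<theta>: "0 < \<theta>" "\<theta> \<le> 1 / 2" by (auto simp: \<theta>_def)
    define L where "L = 4 * \<bar>T\<bar>"
    have L: "ln (1 / (2 * \<theta>)) = L" by (simp add: \<theta>_def L_def ln_div)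
    have "\<exists>s. continuous_on UNIV s \<and> harmonic_on \<Omega> s \<and> (\<forall>y. s y \<le> s p + C) \<and> (\<forall>y. r \<le> dist y x \<longrightarrow> s y \<le> C) \<and> T \<le> s p"
      if x: "x \<in> F" and r: "0 < r" "r \<le> D" and p: "p \<in> ball x (\<theta> * r)" for x r p
    proof -
      define \<rho> where "\<rho> = \<theta> * r"
      have \<rho>: "0 < \<rho>" using \<theta> r by (simp add: \<rho>_def)
      have \<rho>2: "\<rho> \<le> r / 2" using mult_right_mono[OF \<theta>(2), of r] r by (simp add: \<rho>_def)
      have "logarithmic_capacity (ball x \<rho> - \<Omega>) \<ge> ennreal (\<beta> * \<rho>)"
        using \<rho>2 r by (intro cap x \<rho>) auto
      then obtain \<nu> where \<nu>: "\<nu> \<in> compact_prob_measures (ball x \<rho> - \<Omega>)" "log_energy \<nu> \<le> ereal (ln (2 / (\<beta> * \<rho>)))"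
        using logarithmic_capacity_measure \<beta> \<rho> by (metis mult_pos_pos)
      obtain K where K: "prob_space \<nu>" "sets \<nu> = sets borel" "compact K" "K \<subseteq> ball x \<rho> - \<Omega>" "emeasure \<nu> K = 1"
        using \<nu>(1) by (auto simp: compact_prob_measures_def)
      define g where "g = (\<lambda>t. ln (2 * \<rho> / t))"
      have E: "(\<integral>\<^sup>+y. (\<integral>\<^sup>+z. (if y = z then \<infinity> else ennreal (g (dist y z))) \<partial>\<nu>) \<partial>\<nu>) \<le> ennreal A"
      proof -
        have "(\<integral>\<^sup>+y. (\<integral>\<^sup>+z. (if y = z then \<infinity> else ennreal (g (dist y z))) \<partial>\<nu>) \<partial>\<nu>) \<le> ennreal (ln (2 / (\<beta> * \<rho>)) + ln (2 * \<rho>))"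
          unfolding g_def by (rule log_energy_positive_kernel[OF \<nu>(1) _ \<rho> \<nu>(2)]) auto
        also have "ln (2 / (\<beta> * \<rho>)) + ln (2 * \<rho>) = ln (2 / (\<beta> * \<rho>) * (2 * \<rho>))"
          using \<beta> \<rho> by (intro ln_mult_pos[symmetric]) auto
        also have "2 / (\<beta> * \<rho>) * (2 * \<rho>) = 4 / \<beta>" using \<beta> \<rho> by simp
        finally show ?thesis by (rule order_trans) (auto simp: A_def intro!: ennreal_leI)
      qed
      obtain M K' where M: "finite_measure M" "sets M = sets borel" and K': "compact K'" "K' \<subseteq> K" "K' \<noteq> {}"
        and AEM: "AE z in M. z \<in> K'" "\<And>y. AE z in M. z \<noteq> y" and mass: "1 / 4 \<le> measure M UNIV" "measure M UNIV \<le> 1"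
        and int: "\<And>y. integrable M (\<lambda>z. g (dist y z))"
        and cont: "continuous_on UNIV (\<lambda>y. \<integral>z. g (dist y z) \<partial>M)"
        and bound: "\<And>y. (\<integral>z. g (dist y z) \<partial>M) \<le> 1 * (8 * A) + ln 2"
      proof (rule continuous_potential[OF K(1,2,3,5) _ _ _ _ _ _ _ _ _ _ E, where L = "2 * \<rho>" and a = 1 and b = "ln 2" and B = UNIV])
        show "dist y z \<le> 2 * \<rho>" if "y \<in> K" "z \<in> K" for y z
          using that K(4) by (intro dist_le_ball_ball[of _ x]) auto
        show "g t \<le> g s" if st: "0 < s" "s \<le> t" for s t
        proof -
          have "2 * \<rho> / t \<le> 2 * \<rho> / s" using st \<rho> by (intro divide_left_mono) auto
          then show ?thesis unfolding g_def using st \<rho> by (subst ln_le_cancel_iff) auto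
        qed
        show "continuous_on {0<..} g" unfolding g_def using \<rho> by (intro continuous_intros) auto
        show "g \<in> borel_measurable borel" unfolding g_def by measurable
        show "g (t / 2) \<le> 1 * g t + ln 2" if t: "0 < t" for t
        proof -
          have "g (t / 2) = ln ((2 * \<rho> / t) * 2)" by (simp add: g_def)
          also have "\<dots> = g t + ln 2" unfolding g_def using t \<rho> by (intro ln_mult_pos) auto
          finally show ?thesis by simp
        qed
        have "space \<nu> = UNIV" using sets_eq_imp_space_eq[OF K(2)] by simp
        then have "emeasure \<nu> UNIV = 1" using prob_space.emeasure_space_1[OF K(1)] by simp
        then show "ennreal (3 / 4) \<le> emeasure \<nu> UNIV" by simp
      qed (use \<rho> A in \<open>auto simp: g_def\<close>)
      note [measurable_cong] = M(2)
      interpret finite_measure M by fact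
      have sp: "space M = UNIV" using sets_eq_imp_space_eq[OF M(2)] by simp
      define m where "m = measure M UNIV"
      define U where "U = (\<lambda>y. \<integral>z. g (dist y z) \<partial>M)"
      have K'x: "dist x z < \<rho>" if "z \<in> K'" for z using that K' K(4) by (auto simp: subset_iff)
      have harm: "harmonic_on \<Omega> U"
        unfolding U_def
      proof (rule harmonic_potential[OF M K'(1,3) AEM(1) _ int])
        show "K' \<inter> \<Omega> = {}" using K' K(4) by auto
        fix w :: "real ^ 'n" assume w: "w \<noteq> 0"
        show "((\<lambda>w. g (norm w)) has_derivative (\<lambda>h. - 1 * (kernel_grad w \<bullet> h))) (at w)"
          unfolding g_def using \<rho> by (intro has_derivative_log_kernel w n) auto
      qed
      define s where "s = (\<lambda>y. m * L + U y)"
      have "continuous_on UNIV s" unfolding s_def U_def by (intro continuous_intros cont)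
      moreover have "harmonic_on \<Omega> s" unfolding s_def by (intro harmonic_on_add harmonic_on_const harm)
      moreover have Up: "0 \<le> U p"
        unfolding U_def
      proof (rule integral_nonneg_AE)
        show "AE z in M. 0 \<le> g (dist p z)"
          using AEM(1) AEM(2)[of p]
        proof eventually_elim
          case (elim z)
          have "dist p z \<le> 2 * \<rho>" using dist_triangle[of p z x] K'x[OF elim(1)] p by (simp add: \<rho>_def dist_commute)
          then show ?case unfolding g_def using elim \<rho> by (intro ln_ge_zero) (simp add: le_divide_eq)
        qed
      qed
      moreover have "s y \<le> s p + C" for y using bound[of y] Up by (simp add: s_def U_def C_def)
      moreover have "s y \<le> C" if y: "r \<le> dist y x" for y
      proof -
        have "U y \<le> (\<integral>z. ln 2 - L \<partial>M)"
          unfolding U_def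
        proof (rule integral_mono_AE)
          show "AE z in M. g (dist y z) \<le> ln 2 - L"
            using AEM(1)
          proof eventually_elim
            case (elim z)
            have "dist y x \<le> dist y z + dist x z" using dist_triangle[of y x z] by (simp add: dist_commute)
            then have d: "r / 2 \<le> dist y z" using K'x[OF elim] y \<rho>2 by linarith
            have "2 * \<rho> / dist y z \<le> 2 * \<rho> / (r / 2)" using d r \<rho> by (intro divide_left_mono mult_pos_pos) auto
            also have "\<dots> = 2 / (1 / (2 * \<theta>))" using r \<theta> by (simp add: \<rho>_def)
            finally have "g (dist y z) \<le> ln (2 / (1 / (2 * \<theta>)))"
            proof -
              assume le: "2 * \<rho> / dist y z \<le> 2 / (1 / (2 * \<theta>))"
              have "0 < dist y z" using d r by linarith
              then have "0 < 2 * \<rho> / dist y z" using \<rho> by simp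
              moreover have "0 < 2 / (1 / (2 * \<theta>))" using \<theta> by simp
              ultimately show ?thesis unfolding g_def using le by (simp only: ln_le_cancel_iff)
            qed
            also have "\<dots> = ln 2 - ln (1 / (2 * \<theta>))" using \<theta> by (intro ln_divide_pos) auto
            finally show ?case by (simp only: L)
          qed
        qed (use int in auto)
        also have "\<dots> = m * (ln 2 - L)" by (simp add: sp m_def)
        finally have "s y \<le> m * ln 2" by (simp add: s_def algebra_simps)
        also have "\<dots> \<le> 1 * ln 2" using mass by (intro mult_right_mono) (auto simp: m_def)
        finally show ?thesis using C by simp
      qed
      moreover have "T \<le> s p"
      proof -
        have "1 / 4 * L \<le> m * L" using mass by (intro mult_right_mono) (auto simp: m_def L_def)
        then show ?thesis using Up by (simp add: s_def L_def)
      qed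
      ultimately show ?thesis by blast
    qed
    then show ?thesis using \<theta> by (intro exI[of _ \<theta>]) auto
  qed
  then show ?thesis unfolding admits_barriers_def using C by blast
qed

lemma capacity_density_admits_barriers:
  fixes \<Omega> :: "(real ^ 'n) set"
  assumes "CARD('n) \<ge> 2" "capacity_density_condition \<Omega>"
  shows "admits_barriers \<Omega> (frontier \<Omega>) (diameter \<Omega>)"
proof -
  obtain \<beta> where \<beta>: "\<beta> > 0" and cap: "\<And>x r. x \<in> frontier \<Omega> \<Longrightarrow> 0 < r \<Longrightarrow> r \<le> diameter \<Omega> \<Longrightarrow>
        (if CARD('n) = 2
         then logarithmic_capacity (ball x r - \<Omega>) \<ge> ennreal (\<beta> * r)
         else newtonian_capacity (ball x r - \<Omega>) \<ge> ennreal (\<beta> * r ^ (CARD('n) - 2)))"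
    using assms(2) unfolding capacity_density_condition_def by blast
  show ?thesis
  proof (cases "CARD('n) = 2")
    case True
    show ?thesis by (rule logarithmic_barrier[OF True \<beta>]) (use cap True in auto)
  next
    case False
    then have n: "CARD('n) \<ge> 3" using assms(1) by linarith
    show ?thesis by (rule Newtonian_barrier[OF n \<beta>]) (use cap False in auto)
  qed
qed

text \<open>Let \<open>\<mu>\<close> be harmonic measure at \<open>p\<close> and \<open>B\<close> the ball. Integrating the barrier gives
  \<open>s p \<le> C + s p * \<mu> B\<close>, hence \<open>1 - \<mu> B \<le> C / T\<close>. The argument applies to every measure that
  represents harmonic functions at \<open>p\<close>, in particular to the chosen one.\<close>

theorem harmonic_measure_ball_lower:
  fixes \<Omega> :: "(real ^ 'n) set"
  assumes n: "CARD('n) \<ge> 2" and cdc: "capacity_density_condition \<Omega>" and \<Omega>: "open \<Omega>" "bounded \<Omega>"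
    and \<epsilon>: "0 < \<epsilon>"
  shows "\<exists>c>0. c < 1 \<and> (\<forall>x\<in>frontier \<Omega>. \<forall>r p. 0 < r \<longrightarrow> r \<le> diameter \<Omega> \<longrightarrow> p \<in> \<Omega> \<inter> ball x (c * r) \<longrightarrow>
    1 - \<epsilon> \<le> measure (harmonic_measure \<Omega> p) (frontier \<Omega> \<inter> ball x r))"
proof -
  obtain C where C: "C \<ge> 0" and bar: "\<And>T. \<exists>c>0. c < 1 \<and> (\<forall>x\<in>frontier \<Omega>. \<forall>r p. 0 < r \<longrightarrow> r \<le> diameter \<Omega> \<longrightarrow> p \<in> ball x (c * r) \<longrightarrow>
    (\<exists>s. continuous_on UNIV s \<and> harmonic_on \<Omega> s \<and> (\<forall>y. s y \<le> s p + C) \<and> (\<forall>y. r \<le> dist y x \<longrightarrow> s y \<le> C) \<and> T \<le> s p))"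
    using capacity_density_admits_barriers[OF n cdc] unfolding admits_barriers_def by blast
  define T where "T = C / \<epsilon> + 1"
  have T: "0 < T" using C \<epsilon> by (simp add: T_def add_nonneg_pos)
  obtain c where c: "0 < c" "c < 1" and barT: "\<And>x r p. x \<in> frontier \<Omega> \<Longrightarrow> 0 < r \<Longrightarrow> r \<le> diameter \<Omega> \<Longrightarrow> p \<in> ball x (c * r) \<Longrightarrow>
    (\<exists>s. continuous_on UNIV s \<and> harmonic_on \<Omega> s \<and> (\<forall>y. s y \<le> s p + C) \<and> (\<forall>y. r \<le> dist y x \<longrightarrow> s y \<le> C) \<and> T \<le> s p)"
    using bar[of T] by blast
  have "1 - \<epsilon> \<le> measure (harmonic_measure \<Omega> p) (frontier \<Omega> \<inter> ball x r)"
    if x: "x \<in> frontier \<Omega>" and r: "0 < r" "r \<le> diameter \<Omega>" and p: "p \<in> \<Omega> \<inter> ball x (c * r)" for x r p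
  proof -
    let ?\<mu> = "harmonic_measure \<Omega> p"
    let ?B = "frontier \<Omega> \<inter> ball x r"
    have hm: "is_harmonic_measure \<Omega> p ?\<mu>" using is_harmonic_measure_harmonic_measure[OF \<Omega>] p by auto
    then interpret prob_space ?\<mu> by (simp add: is_harmonic_measure_def)
    have sets: "sets ?\<mu> = sets (restrict_space borel (frontier \<Omega>))" using hm by (simp add: is_harmonic_measure_def)
    note [measurable_cong] = sets
    have sp: "space ?\<mu> = frontier \<Omega>" using sets_eq_imp_space_eq[OF sets] by (simp add: space_restrict_space)
    have B: "?B \<in> sets ?\<mu>" by (auto simp: sets sets_restrict_space)
    obtain s where s: "continuous_on UNIV s" "harmonic_on \<Omega> s" "\<And>y. s y \<le> s p + C" "\<And>y. r \<le> dist y x \<Longrightarrow> s y \<le> C" "T \<le> s p"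
      using barT[OF x r, of p] p by blast
    have sp0: "0 < s p" using T s(5) by linarith
    have "bounded (s ` frontier \<Omega>)"
      using s(1) \<Omega>(2) by (intro compact_imp_bounded compact_continuous_image) (auto intro: continuous_on_subset compact_frontier_bounded)
    then obtain K where K: "\<And>y. y \<in> frontier \<Omega> \<Longrightarrow> \<bar>s y\<bar> \<le> K" by (auto simp: bounded_iff)
    have sm: "s \<in> borel_measurable ?\<mu>"
      unfolding measurable_cong_sets[OF sets refl]
      by (rule measurable_restrict_space1[OF borel_measurable_continuous_onI[OF s(1)]])
    have int: "integrable ?\<mu> s" by (rule integrable_const_bound[where B = K]) (use K sm in \<open>auto simp: sp intro!: AE_I2\<close>)
    have int2: "integrable ?\<mu> (\<lambda>y. s p * indicator ?B y)"
      using B by (intro integrable_mult_right integrable_real_indicator) (auto simp: emeasure_eq_measure)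
    have "s p = (\<integral>y. s y \<partial>?\<mu>)"
      using hm s(2) continuous_on_subset[OF s(1)] by (auto simp: is_harmonic_measure_def)
    also have "\<dots> \<le> (\<integral>y. C + s p * indicator ?B y \<partial>?\<mu>)"
    proof (rule integral_mono[OF int])
      show "integrable ?\<mu> (\<lambda>y. C + s p * indicator ?B y)"
        by (rule Bochner_Integration.integrable_add[OF integrable_const int2])
      fix y assume "y \<in> space ?\<mu>"
      then show "s y \<le> C + s p * indicator ?B y"
        using s(3)[of y] s(4)[of y] by (auto simp: sp indicator_def dist_commute not_less)
    qed
    also have "\<dots> = C + s p * prob ?B"
      unfolding Bochner_Integration.integral_add[OF integrable_const int2]
      using sets.sets_into_space[OF B] by (simp add: prob_space Int_absorb2)
    finally have le: "s p * (1 - prob ?B) \<le> C" by (simp add: algebra_simps)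
    have "T * (1 - prob ?B) \<le> s p * (1 - prob ?B)" using s(5) by (intro mult_right_mono) auto
    then have "T * (1 - prob ?B) \<le> C" using le by linarith
    also have "C \<le> T * \<epsilon>" using \<epsilon> by (simp add: T_def distrib_right)
    finally show ?thesis using T by simp
  qed
  then show ?thesis using c by blast
qed

section \<open>The geometry of the boundary\<close>

text \<open>A connected annulus about \<open>x\<close> that misses the boundary lies in \<open>\<Omega>\<close> or in its complement.
  In the second case the connected set \<open>\<Omega>\<close>, which comes arbitrarily close to \<open>x\<close>, is confined to
  the inner ball and has too small a diameter. In the first case the complement of \<open>\<Omega>\<close> in the
  outer ball is confined to the inner ball and has too small a capacity.\<close>

theorem frontier_uniformly_perfect:
  fixes \<Omega> :: "(real ^ 'n) set"
  assumes n: "CARD('n) \<ge> 2" and cdc: "capacity_density_condition \<Omega>" and \<Omega>: "connected \<Omega>" "bounded \<Omega>"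
  shows "\<exists>c>0. \<forall>x\<in>frontier \<Omega>. \<forall>r. 0 < r \<longrightarrow> r \<le> diameter \<Omega> \<longrightarrow>
    (\<exists>z\<in>frontier \<Omega>. c * r \<le> dist z x \<and> dist z x < r)"
proof -
  obtain \<beta> where \<beta>: "\<beta> > 0" and cap: "\<And>x r. x \<in> frontier \<Omega> \<Longrightarrow> 0 < r \<Longrightarrow> r \<le> diameter \<Omega> \<Longrightarrow>
        (if CARD('n) = 2
         then logarithmic_capacity (ball x r - \<Omega>) \<ge> ennreal (\<beta> * r)
         else newtonian_capacity (ball x r - \<Omega>) \<ge> ennreal (\<beta> * r ^ (CARD('n) - 2)))"
    using cdc unfolding capacity_density_condition_def by blast
  define c where "c = min (1 / 4) (\<beta> / 4)"
  have c: "0 < c" "c \<le> 1 / 4" "4 * c \<le> \<beta>" using \<beta> by (auto simp: c_def)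
  have "\<exists>z\<in>frontier \<Omega>. c * r \<le> dist z x \<and> dist z x < r"
    if x: "x \<in> frontier \<Omega>" and r: "0 < r" "r \<le> diameter \<Omega>" for x r
  proof (rule ccontr)
    assume no: "\<not> ?thesis"
    define A where "A = {y. c * r \<le> norm (y - x) \<and> norm (y - x) < r}"
    have cr: "c * r \<le> r / 4" using c r by (simp add: field_simps)
    have AF: "A \<inter> frontier \<Omega> = {}" using no by (auto simp: A_def dist_norm)
    have "connected A" unfolding A_def using n by (intro connected_annulus) simp
    then have "A \<inter> \<Omega> = {} \<or> A \<subseteq> \<Omega>" using connected_Int_frontier[of A \<Omega>] AF by blast
    then show False
    proof
      assume A: "A \<inter> \<Omega> = {}"
      let ?B = "ball x (r / 2)"
      have "?B \<inter> \<Omega> \<noteq> {}"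
      proof -
        have "x \<in> closure \<Omega>" using x by (simp add: frontier_def)
        then obtain y where "y \<in> \<Omega>" "dist y x < r / 2" using r by (meson closure_approachable half_gt_zero)
        then show ?thesis by (auto simp: dist_commute)
      qed
      moreover have "\<Omega> \<inter> frontier ?B = {}"
      proof -
        have "y \<in> A" if "y \<in> frontier ?B" for y
        proof -
          have "norm (y - x) = r / 2" using that r by (simp add: dist_norm norm_minus_commute)
          then have "c * r \<le> norm (y - x)" "norm (y - x) < r" using cr r by linarith+
          then show ?thesis by (simp add: A_def)
        qed
        then show ?thesis using A by blast
      qed
      ultimately have sub: "\<Omega> \<subseteq> ?B" using connected_Int_frontier[OF \<Omega>(1), of ?B] by blast
      have small: "norm (y - x) < c * r" if "y \<in> \<Omega>" for y
      proof -
        have "norm (y - x) < r / 2" using that sub by (auto simp: dist_norm norm_minus_commute)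
        moreover have "y \<notin> A" using that A by blast
        ultimately show ?thesis using r by (simp add: A_def)
      qed
      have "diameter \<Omega> \<le> 2 * (c * r)"
      proof (rule diameter_le)
        show "\<Omega> \<noteq> {} \<or> 0 \<le> 2 * (c * r)" using c r by simp
        fix y z assume "y \<in> \<Omega>" "z \<in> \<Omega>"
        then show "norm (y - z) \<le> 2 * (c * r)"
          using small[of y] small[of z] norm_triangle_ineq4[of "y - x" "z - x"] by simp
      qed
      then show False using r cr by linarith
    next
      assume A: "A \<subseteq> \<Omega>"
      have sub: "ball x r - \<Omega> \<subseteq> ball x (c * r)"
        using A by (force simp: A_def dist_norm norm_minus_commute)
      have s: "0 < c * r" using c r by simp
      show False
      proof (cases "CARD('n) = 2")
        case True
        have "ennreal (\<beta> * r) \<le> ennreal (2 * (c * r))"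
          using cap[OF x r] True logarithmic_capacity_ball_le[OF sub s] by (auto intro: order_trans)
        then have "\<beta> * r \<le> 2 * c * r" using s by (simp add: ennreal_le_iff mult.assoc)
        then have "\<beta> \<le> 2 * c" using r by simp
        then show False using c by linarith
      next
        case False
        define m where "m = CARD('n) - 2"
        have m: "1 \<le> m" using n False by (simp add: m_def)
        have "ennreal (\<beta> * r ^ m) \<le> ennreal ((2 * (c * r)) ^ m)"
          using cap[OF x r] False newtonian_capacity_ball_le[OF sub s] unfolding m_def by (auto intro: order_trans)
        then have "\<beta> * r ^ m \<le> (2 * (c * r)) ^ m" using s by (simp add: ennreal_le_iff)
        also have "\<dots> = (2 * c) ^ m * r ^ m" by (simp add: power_mult_distrib)
        finally have "\<beta> \<le> (2 * c) ^ m" using r by simp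
        also have "\<dots> \<le> (2 * c) ^ 1" using c m by (intro power_decreasing) auto
        finally show False using c by simp
      qed
    qed
  qed
  then show ?thesis using c by blast
qed

lemma diameter_open_pos:
  fixes \<Omega> :: "(real ^ 'n) set"
  assumes "open \<Omega>" "bounded \<Omega>" "\<Omega> \<noteq> {}"
  shows "0 < diameter \<Omega>"
proof -
  obtain y e where y: "e > 0" "ball y e \<subseteq> \<Omega>" using assms(1,3) by (metis ex_in_conv open_contains_ball)
  have "0 < diameter (ball y e)" using y(1) by (simp add: diameter_ball)
  also have "\<dots> \<le> diameter \<Omega>" using y(2) assms(2) by (rule diameter_subset)
  finally show ?thesis .
qed

text \<open>The scale \<open>s\<close> of the boundary balls is at most \<open>r / 2\<close>, for disjointness, and below the
  diameter of \<open>\<Omega>\<close>. The corkscrew condition is applied at the smaller scale \<open>c * s\<close>, where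
  harmonic measure already sees little outside the ball of radius \<open>s\<close>.\<close>

theorem frontier_covering_bound:
  fixes \<Omega> :: "(real ^ 'n) set"
  assumes n: "CARD('n) = d + 1" "d \<ge> 1" and \<Omega>: "open \<Omega>" "bounded \<Omega>" "\<Omega> \<noteq> {}"
    and cork: "corkscrew_condition \<Omega>" and cdc: "capacity_density_condition \<Omega>" and pack: "packing_property \<Omega>"
  shows "\<exists>C\<ge>0. \<forall>x\<in>frontier \<Omega>. \<forall>r R A. 0 < r \<longrightarrow> r \<le> 1 \<longrightarrow> r \<le> R \<longrightarrow> finite A \<longrightarrow> A \<subseteq> frontier \<Omega> \<inter> ball x R \<longrightarrow>
    separated r A \<longrightarrow> real (card A) \<le> C * (R / r) ^ d"
proof -
  have n2: "CARD('n) \<ge> 2" using n by simp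
  have F0: "frontier \<Omega> \<noteq> {}" by (rule frontier_nonempty_bounded[OF \<Omega>(2,3)])
  have diam: "0 < diameter \<Omega>" by (rule diameter_open_pos[OF \<Omega>])
  define Pk where "Pk = (\<lambda>\<epsilon> C. \<forall>x\<in>frontier \<Omega>. \<forall>R>0. \<forall>(J :: nat set) (p :: nat \<Rightarrow> real ^ 'n) E.
           (\<forall>j\<in>J. p j \<in> \<Omega> \<inter> ball x R) \<and>
           (\<forall>j\<in>J. E j \<in> sets borel \<and> E j \<subseteq> frontier \<Omega>) \<and>
           (\<forall>j\<in>J. measure (harmonic_measure \<Omega> (p j)) (E j) \<ge> 1 - \<epsilon>) \<and>
           (\<forall>j\<in>J. \<forall>k\<in>J. k \<noteq> j \<longrightarrow> E j \<inter> E k = {}) \<longrightarrow>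
           (\<lambda>j. infdist (p j) (frontier \<Omega>) ^ (CARD('n) - 1)) summable_on J \<and>
           (\<Sum>\<^sub>\<infinity>j\<in>J. infdist (p j) (frontier \<Omega>) ^ (CARD('n) - 1)) \<le> C * R ^ (CARD('n) - 1))"
  have "\<exists>\<epsilon>\<^sub>0>0. \<forall>\<epsilon>. 0 < \<epsilon> \<and> \<epsilon> < \<epsilon>\<^sub>0 \<longrightarrow> (\<exists>C. Pk \<epsilon> C)"
    using pack unfolding packing_property_def Pk_def .
  then obtain \<epsilon>0 where \<epsilon>0: "\<epsilon>0 > 0" and pk: "\<And>\<epsilon>. 0 < \<epsilon> \<Longrightarrow> \<epsilon> < \<epsilon>0 \<Longrightarrow> \<exists>C. Pk \<epsilon> C" by blast
  define \<epsilon> where "\<epsilon> = \<epsilon>0 / 2"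
  have \<epsilon>: "0 < \<epsilon>" "\<epsilon> < \<epsilon>0" using \<epsilon>0 by (auto simp: \<epsilon>_def)
  obtain C0 where C0': "Pk \<epsilon> C0" using pk[OF \<epsilon>] by blast
  have d: "CARD('n) - 1 = d" using n by simp
  have C0: "(\<Sum>\<^sub>\<infinity>j\<in>J. infdist (p j) (frontier \<Omega>) ^ d) \<le> C0 * R ^ d"
    if "x \<in> frontier \<Omega>" "R > 0" "\<forall>j\<in>J. p j \<in> \<Omega> \<inter> ball x R"
      "\<forall>j\<in>J. E j \<in> sets borel \<and> E j \<subseteq> frontier \<Omega>"
      "\<forall>j\<in>J. 1 - \<epsilon> \<le> measure (harmonic_measure \<Omega> (p j)) (E j)"
      "\<forall>j\<in>J. \<forall>k\<in>J. k \<noteq> j \<longrightarrow> E j \<inter> E k = {}" for x R and J :: "nat set" and p E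
  proof -
    have "(\<lambda>j. infdist (p j) (frontier \<Omega>) ^ d) summable_on J \<and>
      (\<Sum>\<^sub>\<infinity>j\<in>J. infdist (p j) (frontier \<Omega>) ^ d) \<le> C0 * R ^ d"
      by (rule C0'[unfolded Pk_def d, rule_format, OF that(1,2), where E = E]) (intro conjI that)
    then show ?thesis by blast
  qed
  obtain c where c: "0 < c" "c < 1" and low: "\<And>x r p. x \<in> frontier \<Omega> \<Longrightarrow> 0 < r \<Longrightarrow> r \<le> diameter \<Omega> \<Longrightarrow> p \<in> \<Omega> \<inter> ball x (c * r) \<Longrightarrow>
    1 - \<epsilon> \<le> measure (harmonic_measure \<Omega> p) (frontier \<Omega> \<inter> ball x r)"
    using harmonic_measure_ball_lower[OF n2 cdc \<Omega>(1,2) \<epsilon>(1)] by blast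
  obtain \<alpha> where \<alpha>: "\<alpha> > 0" and ck: "\<And>x r. x \<in> frontier \<Omega> \<Longrightarrow> 0 < r \<Longrightarrow> r < diameter \<Omega> \<Longrightarrow> \<exists>p. ball p (\<alpha> * r) \<subseteq> \<Omega> \<inter> ball x r"
    using cork unfolding corkscrew_condition_def by blast
  define \<kappa> where "\<kappa> = min (1 / 2) (diameter \<Omega> / 2)"
  have \<kappa>: "0 < \<kappa>" "\<kappa> \<le> 1 / 2" "\<kappa> < diameter \<Omega>" using diam by (auto simp: \<kappa>_def)
  define q where "q = \<alpha> * c * \<kappa>"
  have q: "0 < q" using \<alpha> c \<kappa> by (simp add: q_def)
  define C where "C = \<bar>C0\<bar> * (2 / q) ^ d"
  have bound: "real (card A) \<le> C * (R / r) ^ d"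
    if x: "x \<in> frontier \<Omega>" and r: "0 < r" "r \<le> 1" "r \<le> R" and A: "finite A" "A \<subseteq> frontier \<Omega> \<inter> ball x R"
      and sep: "separated r A" for x r R A
  proof -
    define s where "s = \<kappa> * r"
    have s: "0 < s" "s \<le> r / 2" "s < diameter \<Omega>"
    proof -
      show "0 < s" using \<kappa> r by (simp add: s_def)
      show "s \<le> r / 2" using mult_right_mono[OF \<kappa>(2), of r] r by (simp add: s_def)
      have "s \<le> \<kappa> * 1" unfolding s_def using \<kappa> r by (intro mult_left_mono) auto
      then show "s < diameter \<Omega>" using \<kappa> by simp
    qed
    have cs: "0 < c * s" "c * s < s" using c s by auto
    then have cs': "c * s < diameter \<Omega>" using s by linarith
    have "\<exists>p. ball p (\<alpha> * (c * s)) \<subseteq> \<Omega> \<inter> ball a (c * s)" if "a \<in> A" for a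
      using that A cs(1) cs' by (intro ck) auto
    then obtain P where P: "\<And>a. a \<in> A \<Longrightarrow> ball (P a) (\<alpha> * (c * s)) \<subseteq> \<Omega> \<inter> ball a (c * s)" by metis
    have Pin: "P a \<in> \<Omega> \<inter> ball a (c * s)" if "a \<in> A" for a
      using P[OF that] \<alpha> cs by (meson centre_in_ball mult_pos_pos subsetD)
    have Pd: "q * r \<le> infdist (P a) (frontier \<Omega>)" if a: "a \<in> A" for a
    proof -
      have "q * r = \<alpha> * (c * s)" by (simp add: q_def s_def)
      also have "\<dots> \<le> infdist (P a) (frontier \<Omega>)"
        unfolding infdist_notempty[OF F0]
      proof (rule cINF_greatest[OF F0])
        fix y assume y: "y \<in> frontier \<Omega>"
        then have "y \<notin> \<Omega>" using \<Omega>(1) by (simp add: frontier_def interior_open)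
        then have "y \<notin> ball (P a) (\<alpha> * (c * s))" using P[OF a] by blast
        then show "\<alpha> * (c * s) \<le> dist (P a) y" by simp
      qed
      finally show ?thesis .
    qed
    obtain e where e: "bij_betw e {0..<card A} A" using ex_bij_betw_nat_finite[OF A(1)] by blast
    let ?J = "{0..<card A}"
    have eA: "e j \<in> A" if "j \<in> ?J" for j using e that by (auto simp: bij_betw_def)
    have "(\<Sum>\<^sub>\<infinity>j\<in>?J. infdist (P (e j)) (frontier \<Omega>) ^ d) \<le> C0 * (2 * R) ^ d"
    proof (rule C0[OF x, where E = "\<lambda>j. frontier \<Omega> \<inter> ball (e j) s"])
      show "2 * R > 0" using r by simp
      show "\<forall>j\<in>?J. P (e j) \<in> \<Omega> \<inter> ball x (2 * R)"
      proof
        fix j assume j: "j \<in> ?J"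
        have "dist x (P (e j)) \<le> dist x (e j) + dist (e j) (P (e j))" by (rule dist_triangle)
        also have "\<dots> < R + c * s" using Pin[OF eA[OF j]] A(2) eA[OF j] by (intro add_strict_mono) auto
        also have "\<dots> \<le> 2 * R" using cs s r by linarith
        finally show "P (e j) \<in> \<Omega> \<inter> ball x (2 * R)" using Pin[OF eA[OF j]] by simp
      qed
      show "\<forall>j\<in>?J. frontier \<Omega> \<inter> ball (e j) s \<in> sets borel \<and> frontier \<Omega> \<inter> ball (e j) s \<subseteq> frontier \<Omega>"
        by (auto simp: frontier_closed)
      show "\<forall>j\<in>?J. 1 - \<epsilon> \<le> measure (harmonic_measure \<Omega> (P (e j))) (frontier \<Omega> \<inter> ball (e j) s)"
        using eA A Pin s by (intro ballI low) auto
      show "\<forall>j\<in>?J. \<forall>k\<in>?J. k \<noteq> j \<longrightarrow> frontier \<Omega> \<inter> ball (e j) s \<inter> (frontier \<Omega> \<inter> ball (e k) s) = {}"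
      proof (intro ballI impI)
        fix j k assume jk: "j \<in> ?J" "k \<in> ?J" "k \<noteq> j"
        then have "e j \<noteq> e k" using e by (auto simp: bij_betw_def inj_on_def)
        then have "r \<le> dist (e j) (e k)" using sep eA jk unfolding separated_def by blast
        then show "frontier \<Omega> \<inter> ball (e j) s \<inter> (frontier \<Omega> \<inter> ball (e k) s) = {}"
          using s disjoint_ballI[of s s "e j" "e k"] by auto
      qed
    qed
    then have le: "(\<Sum>j\<in>?J. infdist (P (e j)) (frontier \<Omega>) ^ d) \<le> C0 * (2 * R) ^ d" by simp
    have "real (card A) * (q * r) ^ d = (\<Sum>j\<in>?J. (q * r) ^ d)" by simp
    also have "\<dots> \<le> (\<Sum>j\<in>?J. infdist (P (e j)) (frontier \<Omega>) ^ d)"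
      using q r Pd eA by (intro sum_mono power_mono) auto
    also note le
    also have "C0 * (2 * R) ^ d \<le> \<bar>C0\<bar> * (2 * R) ^ d" using r by (intro mult_right_mono) auto
    finally have "real (card A) \<le> \<bar>C0\<bar> * (2 * R) ^ d / (q * r) ^ d" using q r by (simp add: le_divide_eq)
    also have "\<dots> = C * (R / r) ^ d" by (simp add: C_def power_mult_distrib power_divide)
    finally show ?thesis .
  qed
  have "0 \<le> C" using q by (simp add: C_def)
  then show ?thesis
    by (intro exI[of _ C] conjI ballI allI impI bound) auto
qed

section \<open>Cubes on the boundary of a domain\<close>

theorem proposition1p3:
  fixes \<Omega> :: "(real ^ 'n) set" and d :: nat
  assumes "d \<ge> 1" and "CARD('n) = d + 1"
    and "open \<Omega>" and "connected \<Omega>" and "bounded \<Omega>"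
    and "corkscrew_condition \<Omega>"
    and "capacity_density_condition \<Omega>"
    and "packing_property \<Omega>"
  shows "\<exists>(N :: nat) (\<S> :: nat \<Rightarrow> (real ^ 'n) set set). N > 0 \<and>
    (\<forall>j. \<forall>S\<in>\<S> j. S \<in> sets borel \<and> S \<subseteq> frontier \<Omega>) \<and>
    (\<exists>a>0. \<exists>b>0. \<forall>j. \<forall>S\<in>\<S> j.
       a * gen_length N j \<le> diameter S \<and> diameter S \<le> b * gen_length N j) \<and>
    (\<forall>j. frontier \<Omega> = \<Union> (\<S> j)) \<and>
    (\<forall>j. \<forall>S\<in>\<S> j. \<forall>S'\<in>\<S> j. S' \<noteq> S \<longrightarrow> S \<inter> S' = {}) \<and>
    (\<forall>j k. j < k \<longrightarrow> (\<forall>S\<in>\<S> j. \<forall>S'\<in>\<S> k. S' \<subseteq> S \<or> S' \<inter> S = {})) \<and>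
    (\<exists>c\<^sub>0>0. \<forall>j. \<forall>S\<in>\<S> j. \<exists>x\<in>S. ball x (c\<^sub>0 * gen_length N j) \<inter> frontier \<Omega> \<subseteq> S) \<and>
    (\<exists>C>0. \<forall>\<tau>. 0 < \<tau> \<and> \<tau> < 1 \<longrightarrow> (\<forall>j. \<forall>S\<in>\<S> j.
       real (boundary_cube_count (frontier \<Omega>) S (\<tau> * gen_length N j)) \<le> C * \<tau> powr (1 / C - real d)))"
proof -
  let ?F = "frontier \<Omega>"
  have n2: "CARD('n) \<ge> 2" using assms(1,2) by simp
  have compact_F: "compact ?F" using assms(5) by (rule compact_frontier_bounded)
  obtain C0 where C0: "0 \<le> C0" and bound: "\<And>x r R A. x \<in> ?F \<Longrightarrow> 0 < r \<Longrightarrow> r \<le> 1 \<Longrightarrow> r \<le> R \<Longrightarrow> finite A \<Longrightarrow>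
      A \<subseteq> ?F \<inter> ball x R \<Longrightarrow> separated r A \<Longrightarrow> real (card A) \<le> C0 * (R / r) ^ d"
  proof (cases "\<Omega> = {}")
    case True
    then show ?thesis using that[of 0] by simp
  next
    case False
    then show ?thesis
      using frontier_covering_bound[OF assms(2,1,3,5) False assms(6,7,8)] that by metis
  qed
  interpret covering_bound ?F d C0
    using compact_F assms(1) C0 bound by unfold_locales
  obtain c where c: "0 < c" and perfect: "\<And>x r. x \<in> ?F \<Longrightarrow> 0 < r \<Longrightarrow> r \<le> diameter \<Omega> \<Longrightarrow>
      \<exists>z\<in>?F. c * r \<le> dist z x \<and> dist z x < r"
    using frontier_uniformly_perfect[OF n2 assms(7,4,5)] by blast
  \<comment> \<open>Generation 0 has length 1, which may exceed the diameter of \<open>\<Omega>\<close>; the factor \<open>\<kappa>\<close> brings radii up to 1 below the diameter.\<close>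
  define \<kappa> where "\<kappa> = (if \<Omega> = {} then 1 else min 1 (diameter \<Omega>))"
  have \<kappa>: "0 < \<kappa>" "\<kappa> \<le> 1"
    using diameter_open_pos[OF assms(3,5)] by (auto simp: \<kappa>_def)
  have "\<exists>z\<in>?F. c * \<kappa> * r \<le> dist z x \<and> dist z x < r" if x: "x \<in> ?F" and r: "0 < r" "r \<le> 1" for x r
  proof -
    have "\<kappa> \<le> diameter \<Omega>" using x by (auto simp: \<kappa>_def)
    moreover have le: "\<kappa> * r \<le> \<kappa> * 1" "\<kappa> * r \<le> 1 * r"
      using \<kappa> r by (auto intro: mult_left_mono mult_right_mono)
    ultimately have "\<kappa> * r \<le> diameter \<Omega>" by linarith
    then have "\<exists>z\<in>?F. c * (\<kappa> * r) \<le> dist z x \<and> dist z x < \<kappa> * r"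
      using \<kappa> r by (intro perfect[OF x]) auto
    then show ?thesis using le(2) by (force simp: mult.assoc)
  qed
  then show ?thesis using c \<kappa> by (intro cubes_with_small_boundary[of "c * \<kappa>"]) auto
qed


end
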